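(* Let $R$ be a Noetherian local (respectively graded-local) ring with maximal (respectively homogeneous maximal) ideal $\mathfrak{m}$ and residue field $R/\mathfrak{m}=\mathbb{K}$. Let $I$ be an ideal (respectively homogeneous ideal) of $R$ such that the symbolic Rees algebra $R_s(I)$ is a Noetherian ring, and let $d_1,\ldots,d_s$ be the degrees of the generators of $R_s(I)$ as an $R$-algebra. Then $\operatorname{sdefect}(I,m)$ is eventually a quasi-polynomial in $m$ with quasi-period $d=\operatorname{lcm}(d_1,\ldots,d_s)$.
   Context: For an ideal $I$ of a commutative Noetherian ring $R$, the $m$-th symbolic power is $I^{(m)}=\bigcap_{\mathfrak p\in \mathrm{Ass}(I)}(I^m R_{\mathfrak p}\cap R)$, where $\mathrm{Ass}(I)$ is the set of associated primes of $R/I$. The symbolic Rees algebra is $R_s(I)=\bigoplus_{i\ge 0} I^{(i)}t^i\subseteq R[t]$, graded by the power of $t$; the degrees of generators refer to this grading. The $m$-th symbolic defect is $\operatorname{sdefect}(I,m)=\mu\left(I^{(m)}/I^m\right)$, the minimal number of generators of the $R$-module $I^{(m)}/I^m$. A quasi-polynomial is a function $f:\mathbb{N}\to\mathbb{Q}$ such that for some $n\in\mathbb{N}$ there exist rational polynomials $f_0,\ldots,f_{n-1}$ with $f(m)=f_r(m)$ whenever $m\equiv r \pmod n$; such a value $n$ is called a quasi-period of $f$. A function is eventually a quasi-polynomial with quasi-period $n$ if it agrees with such an $f$ for all sufficiently large $m$. *)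

theory Defs
  imports
    "HOL-Number_Theory.Cong"
    "HOL-Computational_Algebra.Polynomial"
    "HOL-Algebra.Ring_Divisibility"
    "HOL-Algebra.Ideal_Product"
    "HOL-Algebra.Generated_Rings"
    "HOL-Algebra.UnivPoly"
begin

section \<open>Modules: quotients, generators, associated primes\<close>

text \<open>
  The record type of modules extends that of rings, so the fields for multiplication and unit
  have to be filled in; they play no role.
\<close>

definition ideal_module :: "('a, 'b) ring_scheme \<Rightarrow> 'a set \<Rightarrow> ('a, 'a) module" where
  "ideal_module R J =
     \<lparr>carrier = J, mult = undefined, one = undefined, zero = \<zero>\<^bsub>R\<^esub>, add = add R,
      smult = mult R\<rparr>"

text \<open>For a submodule \<open>N\<close> of \<open>M\<close>; the union in the scalar multiplication is over equal cosets.\<close>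

definition quot_module :: "('a, 'c, 'd) module_scheme \<Rightarrow> 'c set \<Rightarrow> ('a, 'c set) module" where
  "quot_module M N =
     \<lparr>carrier = a_rcosets\<^bsub>M\<^esub> N, mult = undefined, one = undefined, zero = N, add = set_add M,
      smult = (\<lambda>r X. \<Union>x\<in>X. N +>\<^bsub>M\<^esub> (r \<odot>\<^bsub>M\<^esub> x))\<rparr>"

definition generated_submodule ::
  "('a, 'b) ring_scheme \<Rightarrow> ('a, 'c, 'd) module_scheme \<Rightarrow> 'c set \<Rightarrow> 'c set" where
  "generated_submodule R M S = \<Inter>{N. submodule N R M \<and> S \<subseteq> N}"

text \<open>The minimal number of generators; meaningful for finitely generated modules.\<close>

definition min_generators :: "('a, 'b) ring_scheme \<Rightarrow> ('a, 'c, 'd) module_scheme \<Rightarrow> nat" where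
  "min_generators R M =
     (LEAST k. \<exists>S. S \<subseteq> carrier M \<and> finite S \<and> card S = k
                 \<and> generated_submodule R M S = carrier M)"

definition associated_primes ::
  "('a, 'b) ring_scheme \<Rightarrow> ('a, 'c, 'd) module_scheme \<Rightarrow> 'a set set" where
  "associated_primes R M =
     {p. primeideal p R \<and> (\<exists>x\<in>carrier M. p = {r \<in> carrier R. r \<odot>\<^bsub>M\<^esub> x = \<zero>\<^bsub>M\<^esub>})}"

definition Ass :: "('a, 'b) ring_scheme \<Rightarrow> 'a set \<Rightarrow> 'a set set" where
  "Ass R I = associated_primes R (quot_module (ideal_module R (carrier R)) I)"


section \<open>Localization\<close>

text \<open>
  For a multiplicative subset \<open>S\<close> of \<open>R\<close>, the fraction \<open>r / s\<close> is the class of \<open>(r, s)\<close> modulo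
  \<open>(r, s) \<sim> (r', s') \<longleftrightarrow> (\<exists>u\<in>S. u (r s' - r' s) = 0)\<close>. The ring operations are given on
  representatives: all the sets in each of the unions are equal.
\<close>

definition fraction :: "('a, 'b) ring_scheme \<Rightarrow> 'a set \<Rightarrow> 'a \<Rightarrow> 'a \<Rightarrow> ('a \<times> 'a) set" where
  "fraction R S r s =
     {(r', s'). r' \<in> carrier R \<and> s' \<in> S
        \<and> (\<exists>u\<in>S. u \<otimes>\<^bsub>R\<^esub> ((r \<otimes>\<^bsub>R\<^esub> s') \<ominus>\<^bsub>R\<^esub> (r' \<otimes>\<^bsub>R\<^esub> s)) = \<zero>\<^bsub>R\<^esub>)}"

definition localization :: "('a, 'b) ring_scheme \<Rightarrow> 'a set \<Rightarrow> ('a \<times> 'a) set ring" where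
  "localization R S =
     \<lparr>carrier = {fraction R S r s |r s. r \<in> carrier R \<and> s \<in> S},
      mult = (\<lambda>X Y. \<Union>(r, s)\<in>X. \<Union>(r', s')\<in>Y. fraction R S (r \<otimes>\<^bsub>R\<^esub> r') (s \<otimes>\<^bsub>R\<^esub> s')),
      one = fraction R S \<one>\<^bsub>R\<^esub> \<one>\<^bsub>R\<^esub>,
      zero = fraction R S \<zero>\<^bsub>R\<^esub> \<one>\<^bsub>R\<^esub>,
      add = (\<lambda>X Y. \<Union>(r, s)\<in>X. \<Union>(r', s')\<in>Y.
               fraction R S ((r \<otimes>\<^bsub>R\<^esub> s') \<oplus>\<^bsub>R\<^esub> (r' \<otimes>\<^bsub>R\<^esub> s)) (s \<otimes>\<^bsub>R\<^esub> s'))\<rparr>"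

definition to_localization :: "('a, 'b) ring_scheme \<Rightarrow> 'a set \<Rightarrow> 'a \<Rightarrow> ('a \<times> 'a) set" where
  "to_localization R S r = fraction R S r \<one>\<^bsub>R\<^esub>"

text \<open>
  \<open>J R\<^sub>p \<inter> R\<close>: the preimage in \<open>R\<close>, under the canonical map, of the ideal that the image of \<open>J\<close>
  generates in the localization at the prime \<open>p\<close>.
\<close>

definition localized_contraction :: "('a, 'b) ring_scheme \<Rightarrow> 'a set \<Rightarrow> 'a set \<Rightarrow> 'a set" where
  "localized_contraction R p J =
     (let S = carrier R - p
      in {r \<in> carrier R. to_localization R S r
            \<in> genideal (localization R S) (to_localization R S ` J)})"


section \<open>Symbolic powers, symbolic Rees algebra, symbolic defect\<close>

primrec ideal_power :: "('a, 'b) ring_scheme \<Rightarrow> 'a set \<Rightarrow> nat \<Rightarrow> 'a set" where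
  "ideal_power R I 0 = carrier R"
| "ideal_power R I (Suc m) = ideal_prod R I (ideal_power R I m)"

text \<open>
  The intersection is taken inside \<open>R\<close>, so that it is \<open>R\<close> when \<open>Ass R I\<close> is empty (\<open>I = R\<close>).
\<close>

definition symbolic_power :: "('a, 'b) ring_scheme \<Rightarrow> 'a set \<Rightarrow> nat \<Rightarrow> 'a set" where
  "symbolic_power R I m =
     carrier R \<inter> (\<Inter>p\<in>Ass R I. localized_contraction R p (ideal_power R I m))"

definition symbolic_Rees_algebra ::
  "('a, 'b) ring_scheme \<Rightarrow> 'a set \<Rightarrow> ('a, nat \<Rightarrow> 'a) up_ring" where
  "symbolic_Rees_algebra R I =
     (UP R)\<lparr>carrier := {f \<in> carrier (UP R). \<forall>i. up_ring.coeff (UP R) f i \<in> symbolic_power R I i}\<rparr>"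

definition Rees_component :: "('a, 'b) ring_scheme \<Rightarrow> 'a set \<Rightarrow> nat \<Rightarrow> (nat \<Rightarrow> 'a) set" where
  "Rees_component R I i = (\<lambda>a. up_ring.monom (UP R) a i) ` symbolic_power R I i"

text \<open>
  \<open>g 0, \<dots>, g (s - 1)\<close> are homogeneous of degrees \<open>d 0, \<dots>, d (s - 1)\<close> and generate the
  symbolic Rees algebra as an algebra over \<open>R\<close>, i.e. over the constant polynomials. Elements of
  degree zero already lie in \<open>R\<close>, so all degrees are required to be positive.
\<close>

definition homogeneous_generators ::
  "('a, 'b) ring_scheme \<Rightarrow> 'a set \<Rightarrow> nat \<Rightarrow> (nat \<Rightarrow> nat \<Rightarrow> 'a) \<Rightarrow> (nat \<Rightarrow> nat) \<Rightarrow> bool" where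
  "homogeneous_generators R I s g d \<longleftrightarrow>
     (\<forall>i<s. 0 < d i \<and> g i \<in> Rees_component R I (d i)) \<and>
     generate_ring (UP R) ((\<lambda>r. up_ring.monom (UP R) r 0) ` carrier R \<union> g ` {..<s})
       = carrier (symbolic_Rees_algebra R I)"

definition sdefect :: "('a, 'b) ring_scheme \<Rightarrow> 'a set \<Rightarrow> nat \<Rightarrow> nat" where
  "sdefect R I m =
     min_generators R (quot_module (ideal_module R (symbolic_power R I m)) (ideal_power R I m))"


section \<open>Local and graded-local rings\<close>

definition local_ring :: "('a, 'b) ring_scheme \<Rightarrow> 'a set \<Rightarrow> bool" where
  "local_ring R m \<longleftrightarrow> cring R \<and> maximalideal m R \<and> (\<forall>n. maximalideal n R \<longrightarrow> n = m)"

text \<open>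
  \<open>R\<close> is the internal direct sum of the additive subgroups \<open>A i\<close>. Gradings by the natural numbers
  are those with \<open>A i = {0}\<close> for \<open>i < 0\<close>.
\<close>

definition graded_ring :: "('a, 'b) ring_scheme \<Rightarrow> (int \<Rightarrow> 'a set) \<Rightarrow> bool" where
  "graded_ring R A \<longleftrightarrow>
     cring R \<and>
     (\<forall>i. additive_subgroup (A i) R) \<and>
     (\<forall>i j. \<forall>x\<in>A i. \<forall>y\<in>A j. x \<otimes>\<^bsub>R\<^esub> y \<in> A (i + j)) \<and>
     (\<forall>x\<in>carrier R. \<exists>!f. (\<forall>i. f i \<in> A i) \<and> finite {i. f i \<noteq> \<zero>\<^bsub>R\<^esub>}
                         \<and> x = finsum R f {i. f i \<noteq> \<zero>\<^bsub>R\<^esub>})"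

definition homogeneous_ideal :: "('a, 'b) ring_scheme \<Rightarrow> (int \<Rightarrow> 'a set) \<Rightarrow> 'a set \<Rightarrow> bool" where
  "homogeneous_ideal R A J \<longleftrightarrow> ideal J R \<and> J = genideal R (J \<inter> (\<Union>i. A i))"

definition maximal_homogeneous_ideal ::
  "('a, 'b) ring_scheme \<Rightarrow> (int \<Rightarrow> 'a set) \<Rightarrow> 'a set \<Rightarrow> bool" where
  "maximal_homogeneous_ideal R A m \<longleftrightarrow>
     homogeneous_ideal R A m \<and> m \<noteq> carrier R \<and>
     (\<forall>J. homogeneous_ideal R A J \<and> m \<subseteq> J \<longrightarrow> J = m \<or> J = carrier R)"

text \<open>
  The ideal \<open>m\<close> is the only maximal element among the proper homogeneous ideals, and \<open>R / m\<close> is a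
  field. The latter is not automatic: the zero ideal of \<open>k[t, 1/t]\<close> has the former property.
\<close>

definition graded_local_ring ::
  "('a, 'b) ring_scheme \<Rightarrow> (int \<Rightarrow> 'a set) \<Rightarrow> 'a set \<Rightarrow> bool" where
  "graded_local_ring R A m \<longleftrightarrow>
     graded_ring R A \<and> maximalideal m R \<and> maximal_homogeneous_ideal R A m \<and>
     (\<forall>n. maximal_homogeneous_ideal R A n \<longrightarrow> n = m)"


section \<open>Quasi-polynomials\<close>

text \<open>
  A quasi-period has to be positive: modulo \<open>0\<close> the condition on the values would be void.
\<close>

definition quasi_polynomial :: "(nat \<Rightarrow> rat) \<Rightarrow> nat \<Rightarrow> bool" where
  "quasi_polynomial f n \<longleftrightarrow>
     0 < n \<and> (\<exists>p :: nat \<Rightarrow> rat poly. \<forall>m. \<forall>r<n. [m = r] (mod n) \<longrightarrow> f m = poly (p r) (of_nat m))"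

definition eventually_quasi_polynomial :: "(nat \<Rightarrow> rat) \<Rightarrow> nat \<Rightarrow> bool" where
  "eventually_quasi_polynomial f n \<longleftrightarrow>
     (\<exists>g. quasi_polynomial g n \<and> (\<forall>\<^sub>F m in sequentially. f m = g m))"

end

theory Submission
  imports Defs "HOL-Library.List_Lexorder"
begin

text \<open>
  Write \<open>J\<^sub>m\<close> for the \<open>m\<close>-th symbolic power of \<open>I\<close>. By Nakayama's lemma the symbolic defect is the
  dimension of \<open>J\<^sub>m / (I\<^sup>m + \<mm> J\<^sub>m)\<close> over the residue field, hence the difference of the dimensions of
  \<open>J\<^sub>m / \<mm> J\<^sub>m\<close> and of the image of \<open>I\<^sup>m\<close> in it. Summing over \<open>m\<close>, the first spaces make up a
  graded algebra, the fibre ring of the symbolic Rees algebra, which is generated in the degrees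
  \<open>d i\<close>; the second ones make up the subalgebra generated by the image of \<open>I\<close> in degree \<open>1\<close>. So both
  dimensions are Hilbert functions of finitely generated graded algebras, and these are eventually
  quasi-polynomial, with any common multiple of the degrees of the generators as quasi-period.

  The Hilbert functions are computed without quotient algebras. Fix generators and order the
  exponent vectors of their monomials lexicographically; a monomial is nonstandard if modulo
  \<open>\<mm> J\<^sub>m\<close> it is a combination of smaller monomials of its degree. The standard monomials of degree
  \<open>m\<close> form a basis (\<open>standard_monomials_basis\<close>), and multiples of nonstandard monomials are
  nonstandard (\<open>up_closed_nonstandard\<close>). What is left is to count the vectors of a given weighted
  degree outside an up-closed set, which Dickson's lemma makes possible by induction on the number
  of variables (\<open>standard_count_polynomial_on_progressions\<close>). Linear algebra over the residue
  field enters only through the exchange property of the closure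
  \<open>X \<mapsto> (X) + \<mm> J\<^sub>m\<close> on subsets of \<open>J\<^sub>m\<close> (\<open>exchange_closure_modulo_mm\<close>).

  A local ring is graded-local for the grading concentrated in degree \<open>0\<close>, so only the graded case
  has to be treated. There Nakayama's lemma applies to homogeneous ideals, which requires that the
  symbolic powers of \<open>I\<close> are homogeneous (\<open>graded_symbolic_power\<close>) and that the generators
  which realize the minimal number are chosen homogeneous; the generators of the
  symbolic Rees algebra may be inhomogeneous for the grading of \<open>R\<close>, as only their monomials are
  counted.
\<close>

section \<open>Functions that are eventually polynomial on residue classes\<close>

text \<open>
  The polynomial is in the index \<open>k\<close> of the progression, and the residue \<open>r\<close> is not restricted to
  \<open>r < n\<close>. This makes the property visibly invariant under shifts of the argument.
\<close>

definition polynomial_on_progressions :: "(nat \<Rightarrow> rat) \<Rightarrow> nat \<Rightarrow> bool" where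
  "polynomial_on_progressions f n \<longleftrightarrow>
     (\<forall>r. \<exists>p. \<forall>\<^sub>F k in sequentially. f (r + n * k) = poly p (of_nat k))"

lemma polynomial_on_progressions_eventually_cong:
  assumes "polynomial_on_progressions f n" and "0 < n" and "\<forall>\<^sub>F m in sequentially. f m = g m"
  shows "polynomial_on_progressions g n"
  unfolding polynomial_on_progressions_def
proof
  fix r
  from assms(1) obtain p where p: "\<forall>\<^sub>F k in sequentially. f (r + n * k) = poly p (of_nat k)"
    unfolding polynomial_on_progressions_def by blast
  have "filterlim (\<lambda>k. r + n * k) at_top sequentially"
  proof (rule filterlim_at_top_mono[OF filterlim_ident])
    show "\<forall>\<^sub>F k in sequentially. k \<le> r + n * k"
      using assms(2) by (intro always_eventually allI) (cases n; simp)
  qed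
  from eventually_compose_filterlim[OF assms(3) this]
  have "\<forall>\<^sub>F k in sequentially. f (r + n * k) = g (r + n * k)" .
  with p have "\<forall>\<^sub>F k in sequentially. g (r + n * k) = poly p (of_nat k)"
    by eventually_elim simp
  thus "\<exists>p. \<forall>\<^sub>F k in sequentially. g (r + n * k) = poly p (of_nat k)" by blast
qed

lemma polynomial_on_progressions_const: "polynomial_on_progressions (\<lambda>_. c) n"
  unfolding polynomial_on_progressions_def by (rule allI, rule exI[of _ "[:c:]"]) simp

lemma polynomial_on_progressions_add:
  assumes "polynomial_on_progressions f n" "polynomial_on_progressions g n"
  shows "polynomial_on_progressions (\<lambda>m. f m + g m) n"
  unfolding polynomial_on_progressions_def
proof
  fix r
  from assms obtain p q where
    "\<forall>\<^sub>F k in sequentially. f (r + n * k) = poly p (of_nat k)"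
    "\<forall>\<^sub>F k in sequentially. g (r + n * k) = poly q (of_nat k)"
    unfolding polynomial_on_progressions_def by meson
  hence "\<forall>\<^sub>F k in sequentially. f (r + n * k) + g (r + n * k) = poly (p + q) (of_nat k)"
    by eventually_elim simp
  thus "\<exists>p. \<forall>\<^sub>F k in sequentially. f (r + n * k) + g (r + n * k) = poly p (of_nat k)" by blast
qed

lemma polynomial_on_progressions_diff:
  assumes "polynomial_on_progressions f n" "polynomial_on_progressions g n"
  shows "polynomial_on_progressions (\<lambda>m. f m - g m) n"
  unfolding polynomial_on_progressions_def
proof
  fix r
  from assms obtain p q where
    "\<forall>\<^sub>F k in sequentially. f (r + n * k) = poly p (of_nat k)"
    "\<forall>\<^sub>F k in sequentially. g (r + n * k) = poly q (of_nat k)"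
    unfolding polynomial_on_progressions_def by meson
  hence "\<forall>\<^sub>F k in sequentially. f (r + n * k) - g (r + n * k) = poly (p - q) (of_nat k)"
    by eventually_elim simp
  thus "\<exists>p. \<forall>\<^sub>F k in sequentially. f (r + n * k) - g (r + n * k) = poly p (of_nat k)" by blast
qed

lemma polynomial_on_progressions_sum:
  assumes "\<And>i. i \<in> S \<Longrightarrow> polynomial_on_progressions (f i) n"
  shows "polynomial_on_progressions (\<lambda>m. \<Sum>i\<in>S. f i m) n"
  using assms
  by (induction S rule: infinite_finite_induct)
     (auto intro: polynomial_on_progressions_const polynomial_on_progressions_add)

lemma polynomial_on_progressions_shift_forward:
  assumes "polynomial_on_progressions f n"
  shows "polynomial_on_progressions (\<lambda>m. f (m + c)) n"
  unfolding polynomial_on_progressions_def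
proof
  fix r
  from assms obtain p where "\<forall>\<^sub>F k in sequentially. f ((r + c) + n * k) = poly p (of_nat k)"
    unfolding polynomial_on_progressions_def by blast
  thus "\<exists>p. \<forall>\<^sub>F k in sequentially. f (r + n * k + c) = poly p (of_nat k)"
    by (auto simp: ac_simps)
qed

text \<open>
  The truncated subtraction only disturbs finitely many values. As \<open>c \<le> n * c\<close>, a backward shift by
  \<open>c\<close> is a forward shift by \<open>n * c - c\<close> followed by a shift of the index.
\<close>

lemma polynomial_on_progressions_shift_backward:
  assumes "polynomial_on_progressions f n" "0 < n"
  shows "polynomial_on_progressions (\<lambda>m. f (m - c)) n"
  unfolding polynomial_on_progressions_def
proof
  fix r
  from assms(1) obtain p where
    "\<forall>\<^sub>F k in sequentially. f ((r + n * c - c) + n * k) = poly p (of_nat k)"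
    unfolding polynomial_on_progressions_def by blast
  hence "\<forall>\<^sub>F k in sequentially. f ((r + n * c - c) + n * (k - c)) = poly p (of_nat (k - c))"
    using eventually_compose_filterlim[of _ sequentially "\<lambda>k. k - c" sequentially]
      filterlim_minus_const_nat_at_top by blast
  moreover have "\<forall>\<^sub>F k in sequentially. c \<le> k" by (rule eventually_ge_at_top)
  ultimately have "\<forall>\<^sub>F k in sequentially.
      f (r + n * k - c) = poly (pcompose p [:- of_nat c, 1:]) (of_nat k)"
  proof eventually_elim
    case (elim k)
    have "c \<le> n * c" using assms(2) by simp
    moreover have "n * (k - c) + n * c = n * k"
      using elim(2) by (simp add: diff_mult_distrib2)
    ultimately have "(r + n * c - c) + n * (k - c) = r + n * k - c" by linarith
    thus ?case using elim by (simp add: poly_pcompose of_nat_diff)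
  qed
  thus "\<exists>p. \<forall>\<^sub>F k in sequentially. f (r + n * k - c) = poly p (of_nat k)" by blast
qed

text \<open>
  By the binomial theorem, the difference of \<open>x ^ (n + 1)\<close> is \<open>(n + 1) * x ^ n\<close> up to powers below
  \<open>n\<close>, and those have antidifferences by induction.
\<close>

lemma exists_antidifference_monomial:
  "\<exists>q :: rat poly. \<forall>x. poly q (x + 1) - poly q x = x ^ n"
proof (induction n rule: less_induct)
  case (less n)
  then obtain Q :: "nat \<Rightarrow> rat poly" where Q: "\<And>i x. i < n \<Longrightarrow> poly (Q i) (x + 1) - poly (Q i) x = x ^ i"
    by metis
  define q where "q = Polynomial.smult (1 / of_nat (Suc n))
    (Polynomial.monom 1 (Suc n) - (\<Sum>i<n. Polynomial.smult (of_nat (Suc n choose i)) (Q i)))"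
  have "poly q (x + 1) - poly q x = x ^ n" for x :: rat
  proof -
    have "(x + 1) ^ Suc n = (\<Sum>i\<le>Suc n. of_nat (Suc n choose i) * x ^ i)"
      using binomial_ring[of x 1 "Suc n"] by simp
    also have "\<dots> = (\<Sum>i<n. of_nat (Suc n choose i) * x ^ i) + of_nat (Suc n) * x ^ n + x ^ Suc n"
      by (simp add: lessThan_Suc_atMost[symmetric] del: binomial_Suc_Suc)
    finally have "(x + 1) ^ Suc n - x ^ Suc n - (\<Sum>i<n. of_nat (Suc n choose i) * x ^ i)
        = of_nat (Suc n) * x ^ n" by simp
    moreover have "(\<Sum>i<n. of_nat (Suc n choose i) * x ^ i)
      = (\<Sum>i<n. of_nat (Suc n choose i) * poly (Q i) (x + 1)) - (\<Sum>i<n. of_nat (Suc n choose i) * poly (Q i) x)"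
      unfolding sum_subtractf[symmetric] right_diff_distrib[symmetric]
      by (intro sum.cong refl) (simp add: Q)
    moreover have "poly q (x + 1) - poly q x = 1 / of_nat (Suc n) *
        ((x + 1) ^ Suc n - x ^ Suc n - ((\<Sum>i<n. of_nat (Suc n choose i) * poly (Q i) (x + 1))
          - (\<Sum>i<n. of_nat (Suc n choose i) * poly (Q i) x)))"
      unfolding q_def poly_smult poly_diff poly_monom poly_sum
      by (simp only: right_diff_distrib mult_1)
    ultimately show ?thesis by simp
  qed
  thus ?case by blast
qed

lemma exists_antidifference:
  fixes p :: "rat poly"
  shows "\<exists>q. \<forall>x. poly q (x + 1) - poly q x = poly p x"
proof -
  obtain Q :: "nat \<Rightarrow> rat poly" where Q: "\<And>n x. poly (Q n) (x + 1) - poly (Q n) x = x ^ n"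
    using exists_antidifference_monomial by metis
  have "poly (\<Sum>i\<le>degree p. Polynomial.smult (poly.coeff p i) (Q i)) (x + 1)
      - poly (\<Sum>i\<le>degree p. Polynomial.smult (poly.coeff p i) (Q i)) x = poly p x" for x
    unfolding poly_sum poly_smult sum_subtractf[symmetric] right_diff_distrib[symmetric] Q
    by (simp add: poly_altdef)
  thus ?thesis by blast
qed

text \<open>
  The step \<open>d\<close> of the difference only has to divide the quasi-period \<open>n\<close>: the difference with step
  \<open>n\<close> is a sum of \<open>n / d\<close> shifts of it. Along a progression of step \<open>n\<close>, an antidifference of the
  polynomial then agrees with \<open>H\<close> up to a constant.
\<close>

lemma polynomial_on_progressions_of_difference:
  assumes D: "polynomial_on_progressions (\<lambda>m. H (m + d) - H m) n" and "d dvd n" and "0 < n"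
  shows "polynomial_on_progressions H n"
  unfolding polynomial_on_progressions_def
proof
  fix r
  obtain c where c: "n = d * c" using assms(2) by blast
  have tele: "H (m + d * j) - H m = (\<Sum>i<j. H (m + i * d + d) - H (m + i * d))" for m j
    by (induction j) (simp_all add: algebra_simps)
  have "polynomial_on_progressions (\<lambda>m. \<Sum>i<c. H (m + i * d + d) - H (m + i * d)) n"
    by (intro polynomial_on_progressions_sum polynomial_on_progressions_shift_forward[OF D])
  hence "polynomial_on_progressions (\<lambda>m. H (m + n) - H m) n" by (simp add: tele c)
  then obtain p where "\<forall>\<^sub>F k in sequentially. H (r + n * k + n) - H (r + n * k) = poly p (of_nat k)"
    unfolding polynomial_on_progressions_def by blast
  then obtain K where K: "\<And>k. K \<le> k \<Longrightarrow> H (r + n * k + n) - H (r + n * k) = poly p (of_nat k)"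
    unfolding eventually_sequentially by blast
  obtain q where q: "\<And>x. poly q (x + 1) - poly q x = poly p x"
    using exists_antidifference by blast
  define C where "C = H (r + n * K) - poly q (of_nat K)"
  have "H (r + n * k) = poly q (of_nat k) + C" if "K \<le> k" for k
    using that
  proof (induction k rule: dec_induct)
    case (step k)
    have "H (r + n * Suc k) = H (r + n * k) + poly p (of_nat k)"
      using K[OF step(1)] by (simp add: algebra_simps)
    thus ?case using step q[of "of_nat k"] by (simp add: algebra_simps)
  qed (simp add: C_def)
  hence "\<forall>\<^sub>F k in sequentially. H (r + n * k) = poly (q + [:C:]) (of_nat k)"
    unfolding eventually_sequentially by auto
  thus "\<exists>p. \<forall>\<^sub>F k in sequentially. H (r + n * k) = poly p (of_nat k)" by blast
qed

lemma eventually_quasi_polynomialI: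
  assumes f: "polynomial_on_progressions f n" and "0 < n"
  shows "eventually_quasi_polynomial f n"
proof -
  obtain p where p: "\<And>r. \<forall>\<^sub>F k in sequentially. f (r + n * k) = poly (p r) (of_nat k)"
    using f unfolding polynomial_on_progressions_def by metis
  \<comment> \<open>from \<open>m = r + n * k\<close>, the index is \<open>k = (m - r) / n\<close>\<close>
  define P where "P r = pcompose (p r) [:- of_nat r / of_nat n, 1 / of_nat n:]" for r
  define g where "g m = poly (P (m mod n)) (of_nat m)" for m
  have "quasi_polynomial g n"
    unfolding quasi_polynomial_def
  proof (intro conjI exI[of _ P] allI impI)
    fix m r assume "r < n" "[m = r] (mod n)"
    thus "g m = poly (P r) (of_nat m)" by (simp add: g_def unique_euclidean_semiring_class.cong_def)
  qed fact
  moreover have "\<forall>\<^sub>F m in sequentially. f m = g m"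
  proof -
    have "\<forall>\<^sub>F k in sequentially. \<forall>r\<in>{..<n}. f (r + n * k) = poly (p r) (of_nat k)"
      by (rule eventually_ball_finite) (auto simp: p)
    then obtain K where K: "\<And>k r. K \<le> k \<Longrightarrow> r < n \<Longrightarrow> f (r + n * k) = poly (p r) (of_nat k)"
      unfolding eventually_sequentially by auto
    have "f m = g m" if "n * K \<le> m" for m
    proof -
      have "K \<le> m div n" using that \<open>0 < n\<close> by (simp add: less_eq_div_iff_mult_less_eq mult.commute)
      from K[OF this, of "m mod n"] have "f m = poly (p (m mod n)) (of_nat (m div n))"
        using \<open>0 < n\<close> by simp
      moreover have "(of_nat (m div n) :: rat) = (of_nat m - of_nat (m mod n)) / of_nat n"
      proof -
        have "(of_nat m :: rat) = of_nat (m mod n) + of_nat n * of_nat (m div n)"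
          unfolding of_nat_mult[symmetric] of_nat_add[symmetric] by simp
        thus ?thesis using \<open>0 < n\<close> by simp
      qed
      ultimately show ?thesis by (simp add: g_def P_def poly_pcompose diff_divide_distrib)
    qed
    thus ?thesis unfolding eventually_sequentially by blast
  qed
  ultimately show ?thesis unfolding eventually_quasi_polynomial_def by blast
qed

section \<open>Counting the exponent vectors outside an up-closed set\<close>

definition weighted_degree :: "nat list \<Rightarrow> nat list \<Rightarrow> nat" where
  "weighted_degree ds a = sum_list (map2 (*) ds a)"

lemma weighted_degree_Nil [simp]: "weighted_degree [] a = 0"
  by (simp add: weighted_degree_def)

lemma weighted_degree_Cons [simp]: "weighted_degree (d # ds) (k # a) = d * k + weighted_degree ds a"
  by (simp add: weighted_degree_def)

lemma finite_weighted_degree: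
  assumes "\<forall>d\<in>set ds. 0 < d"
  shows "finite {a. length a = length ds \<and> weighted_degree ds a = m}"
proof -
  have "set a \<subseteq> {..m}" if "length a = length ds" "weighted_degree ds a = m" for a
    using that(1) assms unfolding that(2)[symmetric]
  proof (induction a ds rule: list_induct2)
    case (Cons k a d ds)
    have "k \<le> d * k + weighted_degree ds a" using Cons.prems by (intro trans_le_add1) simp
    moreover have "set a \<subseteq> {..weighted_degree ds a}" using Cons by simp
    ultimately show ?case by auto
  qed simp
  hence "{a. length a = length ds \<and> weighted_degree ds a = m}
      \<subseteq> {a. set a \<subseteq> {..m} \<and> length a = length ds}" by auto
  thus ?thesis by (rule finite_subset) (intro finite_lists_length_eq finite_atMost)
qed

text \<open>
  Dickson's lemma: pass to a subsequence along which the first entries increase, and apply the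
  induction hypothesis to the tails. A monotone sequence of natural numbers that decreases is
  constant from its minimum on.
\<close>

lemma dickson:
  fixes a :: "nat \<Rightarrow> nat list"
  assumes "\<And>i. length (a i) = n"
  shows "\<exists>\<phi> :: nat \<Rightarrow> nat. strict_mono \<phi> \<and> (\<forall>i j. i \<le> j \<longrightarrow> list_all2 (\<le>) (a (\<phi> i)) (a (\<phi> j)))"
  using assms
proof (induction n arbitrary: a)
  case 0
  thus ?case by (intro exI[of _ id]) (auto simp: strict_mono_def)
next
  case (Suc n)
  have len: "length (a i) = Suc n" for i by fact
  obtain \<phi> :: "nat \<Rightarrow> nat" where \<phi>: "strict_mono \<phi>" "monoseq (\<lambda>i. hd (a (\<phi> i)))"
    using seq_monosub[of "\<lambda>i. hd (a i)"] by blast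
  have "\<exists>c. \<forall>i j. c \<le> i \<longrightarrow> i \<le> j \<longrightarrow> hd (a (\<phi> i)) \<le> hd (a (\<phi> j))"
  proof (cases "\<forall>i j. i \<le> j \<longrightarrow> hd (a (\<phi> i)) \<le> hd (a (\<phi> j))")
    case False
    hence dec: "\<And>i j. i \<le> j \<Longrightarrow> hd (a (\<phi> j)) \<le> hd (a (\<phi> i))"
      using \<phi>(2) unfolding monoseq_def by blast
    obtain c where "\<And>j. hd (a (\<phi> c)) \<le> hd (a (\<phi> j))"
      using ex_has_least_nat[of "\<lambda>_. True" undefined "\<lambda>i. hd (a (\<phi> i))"] by auto
    thus ?thesis by (metis dec order_trans)
  qed blast
  then obtain c where c: "\<And>i j. c \<le> i \<Longrightarrow> i \<le> j \<Longrightarrow> hd (a (\<phi> i)) \<le> hd (a (\<phi> j))" by blast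
  obtain \<psi> :: "nat \<Rightarrow> nat" where \<psi>: "strict_mono \<psi>"
    "\<And>i j. i \<le> j \<Longrightarrow> list_all2 (\<le>) (tl (a (\<phi> (c + \<psi> i)))) (tl (a (\<phi> (c + \<psi> j))))"
    using Suc.IH[of "\<lambda>i. tl (a (\<phi> (c + i)))"] len by (auto simp: strict_mono_def)
  define \<theta> where "\<theta> i = \<phi> (c + \<psi> i)" for i
  have "strict_mono \<theta>"
    using \<phi>(1) \<psi>(1) unfolding \<theta>_def strict_mono_def by simp
  moreover have "list_all2 (\<le>) (a (\<theta> i)) (a (\<theta> j))" if "i \<le> j" for i j
  proof -
    have "\<psi> i \<le> \<psi> j" using \<psi>(1) that by (simp add: strict_mono_less_eq)
    hence "hd (a (\<theta> i)) \<le> hd (a (\<theta> j))" unfolding \<theta>_def by (intro c) auto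
    moreover have "a k = hd (a k) # tl (a k)" for k using len[of k] by (cases "a k") auto
    ultimately show ?thesis using \<psi>(2)[OF that] unfolding \<theta>_def by (metis list.rel_intros(2))
  qed
  ultimately show ?case by blast
qed

definition up_closed :: "nat list set \<Rightarrow> bool" where
  "up_closed U \<longleftrightarrow> (\<forall>a\<in>U. \<forall>b. list_all2 (\<le>) a b \<longrightarrow> b \<in> U)"

text \<open>
  If the chain grew forever, elements that are new at infinitely many levels would form a sequence
  in which no element lies below a later one, contrary to Dickson's lemma.
\<close>

lemma up_closed_chain_stabilizes:
  fixes U :: "nat \<Rightarrow> nat list set"
  assumes up: "\<And>k. up_closed (U k)" and "incseq U" and len: "\<And>k a. a \<in> U k \<Longrightarrow> length a = n"
  shows "\<exists>N. \<forall>k\<ge>N. U k = U N"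
proof (rule ccontr)
  assume unstable: "\<not> ?thesis"
  have ex: "\<exists>k>N. \<exists>a. a \<in> U k \<and> a \<notin> U N" for N
  proof -
    obtain k where "k \<ge> N" "U k \<noteq> U N" using unstable by blast
    thus ?thesis using \<open>incseq U\<close> unfolding incseq_def by (metis le_neq_implies_less subset_antisym subsetI)
  qed
  then obtain next_level new where nl: "\<And>N. next_level N > N" "\<And>N. new N \<in> U (next_level N)" "\<And>N. new N \<notin> U N"
    by metis
  define l where "l i = (next_level ^^ i) 0" for i
  have l: "l (Suc i) = next_level (l i)" for i by (simp add: l_def)
  have "strict_mono l" by (simp add: strict_mono_Suc_iff l nl)
  obtain \<phi> :: "nat \<Rightarrow> nat" where \<phi>: "strict_mono \<phi>" "\<And>i j. i \<le> j \<Longrightarrow> list_all2 (\<le>) (new (l (\<phi> i))) (new (l (\<phi> j)))"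
    using dickson[of "\<lambda>i. new (l i)" n] len[OF nl(2)] by blast
  have "\<phi> 0 < \<phi> 1" using \<phi>(1) by (simp add: strict_mono_def)
  hence "l (Suc (\<phi> 0)) \<le> l (\<phi> 1)" using \<open>strict_mono l\<close> by (simp add: strict_mono_less_eq)
  hence "U (next_level (l (\<phi> 0))) \<subseteq> U (l (\<phi> 1))" using \<open>incseq U\<close> by (simp add: l incseq_def)
  hence "new (l (\<phi> 0)) \<in> U (l (\<phi> 1))" using nl(2) by blast
  hence "new (l (\<phi> 1)) \<in> U (l (\<phi> 1))"
    using up \<phi>(2)[of 0 1] unfolding up_closed_def by simp
  thus False using nl(3) by blast
qed

text \<open>
  If \<open>U\<close> is the set of exponents of a monomial ideal, this is the Hilbert function of the quotient of
  the polynomial ring with variables in degrees \<open>ds\<close> by that ideal.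
\<close>

definition standard_count :: "nat list \<Rightarrow> nat list set \<Rightarrow> nat \<Rightarrow> nat" where
  "standard_count ds U m = card {a. length a = length ds \<and> weighted_degree ds a = m \<and> a \<notin> U}"

lemma standard_count_Cons:
  assumes pos: "0 < d" "\<forall>d\<in>set ds. 0 < d" and "m \<le> d * M + e" "e < d"
  shows "standard_count (d # ds) U m =
    (\<Sum>k\<le>M. if d * k \<le> m then standard_count ds {a. k # a \<in> U} (m - d * k) else 0)"
proof -
  define S where "S k = {a. length a = length ds \<and> d * k + weighted_degree ds a = m \<and> k # a \<notin> U}" for k
  have fin: "finite (S k)" for k
    by (rule finite_subset[OF _ finite_weighted_degree[OF pos(2), of "m - d * k"]]) (auto simp: S_def)
  have bound: "k \<le> M" if "d * k \<le> m" for k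
  proof (rule ccontr)
    assume "\<not> k \<le> M"
    hence "Suc M \<le> k" by simp
    hence "d * Suc M \<le> d * k" by (rule mult_le_mono2)
    thus False using that assms by simp
  qed
  have "{a. length a = length (d # ds) \<and> weighted_degree (d # ds) a = m \<and> a \<notin> U}
      = (\<Union>k\<le>M. (#) k ` S k)" (is "?A = ?B")
  proof
    show "?A \<subseteq> ?B"
    proof
      fix a assume a: "a \<in> ?A"
      then obtain k b where "a = k # b" by (cases a) auto
      with a bound[of k] show "a \<in> ?B" by (auto simp: S_def)
    qed
  qed (auto simp: S_def)
  hence count: "standard_count (d # ds) U m = (\<Sum>k\<le>M. card ((#) k ` S k))"
    unfolding standard_count_def by (simp only:) (rule card_UN_disjoint, auto simp: fin)
  show ?thesis
    unfolding count
  proof (rule sum.cong[OF refl])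
    fix k
    have "card (S k) = (if d * k \<le> m then standard_count ds {a. k # a \<in> U} (m - d * k) else 0)"
    proof (cases "d * k \<le> m")
      case True
      hence "S k = {a. length a = length ds \<and> weighted_degree ds a = m - d * k \<and> a \<notin> {a. k # a \<in> U}}"
        by (auto simp: S_def)
      thus ?thesis using True by (simp add: standard_count_def)
    next
      case False
      hence "S k = {}" by (auto simp: S_def)
      thus ?thesis using False by simp
    qed
    thus "card ((#) k ` S k) = (if d * k \<le> m then standard_count ds {a. k # a \<in> U} (m - d * k) else 0)"
      by (simp add: card_image)
  qed
qed

text \<open>
  Induction on the number of variables. The slices \<open>V k\<close> of \<open>U\<close>, given by first exponent \<open>k\<close>,
  increase with \<open>k\<close> and are constant for \<open>k \<ge> N\<close>. If \<open>d\<close> is the weight of the first variable and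
  \<open>h k\<close> the count for the slice \<open>V k\<close>, the count for \<open>U\<close> is \<open>H m = (\<Sum>k. h k (m - d * k))\<close>. In
  \<open>H (m + d) - H m\<close> the contributions of the constant slices cancel, so that it is a finite sum of
  shifts of the \<open>h k\<close>.
\<close>

theorem standard_count_polynomial_on_progressions:
  assumes "\<forall>d\<in>set ds. 0 < d \<and> d dvd L" and "0 < L"
    and "up_closed U" and "\<And>a. a \<in> U \<Longrightarrow> length a = length ds"
  shows "polynomial_on_progressions (\<lambda>m. of_nat (standard_count ds U m)) L"
  using assms
proof (induction ds arbitrary: U)
  case Nil
  have "standard_count [] U m = 0" if "0 < m" for m
    using that by (simp add: standard_count_def)
  hence "\<forall>\<^sub>F m in sequentially. 0 = (of_nat (standard_count [] U m) :: rat)"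
    unfolding eventually_sequentially by (intro exI[of _ 1]) auto
  from polynomial_on_progressions_eventually_cong[OF polynomial_on_progressions_const \<open>0 < L\<close> this]
  show ?case .
next
  case (Cons d ds)
  define V where "V k = {a. k # a \<in> U}" for k
  have d: "0 < d" "d dvd L" "\<forall>d\<in>set ds. 0 < d" using Cons.prems by auto
  have lenV: "length a = length ds" if "a \<in> V k" for k a
    using Cons.prems(4) that by (fastforce simp: V_def)
  have up: "k' # b \<in> U" if "k # a \<in> U" "k \<le> k'" "list_all2 (\<le>) a b" for k k' a b
  proof -
    have "list_all2 (\<le>) (k # a) (k' # b)" using that by simp
    thus ?thesis using Cons.prems(3) that(1) unfolding up_closed_def by blast
  qed
  have upV: "up_closed (V k)" for k
    unfolding up_closed_def V_def using up[OF _ order_refl] by blast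
  have "incseq V"
  proof (rule incseq_SucI, rule subsetI)
    fix k a assume a: "a \<in> V k"
    have "list_all2 (\<le>) a a" by (simp add: list_all2_refl)
    thus "a \<in> V (Suc k)"
      using up[of k a "Suc k" a] a unfolding V_def by simp
  qed
  then obtain N where N: "\<And>k. k \<ge> N \<Longrightarrow> V k = V N"
    using up_closed_chain_stabilizes[of V] upV lenV by blast
  define h :: "nat \<Rightarrow> nat \<Rightarrow> rat" where "h k m = of_nat (standard_count ds (V k) m)" for k m
  define H :: "nat \<Rightarrow> rat" where "H m = of_nat (standard_count (d # ds) U m)" for m
  have h: "polynomial_on_progressions (h k) L" for k
    unfolding h_def by (rule Cons.IH) (use Cons.prems upV lenV in auto)
  have H_eq: "H m = (\<Sum>k\<le>M. if d * k \<le> m then h k (m - d * k) else 0)" if "m < d * Suc M" for m M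
  proof -
    have "m \<le> d * M + (d - 1)" "d - 1 < d" using that d(1) by auto
    from standard_count_Cons[OF d(1,3) this] show ?thesis
      unfolding H_def h_def V_def by (simp add: if_distrib cong: if_cong)
  qed
  \<comment> \<open>peeling off the slice \<open>k = 0\<close> and reindexing the others; for \<open>k \<ge> N\<close> consecutive
     slices are equal and cancel\<close>
  have diff: "H (m + d) - H m = h 0 (m + d) + (\<Sum>k<N. h (Suc k) (m - d * k) - h k (m - d * k))"
    if "d * N \<le> m" for m
  proof -
    define M where "M = m div d"
    have M: "m < d * Suc M" "N \<le> Suc M" "d * M \<le> m"
    proof -
      show "m < d * Suc M"
        using mod_less_divisor[OF d(1), of m] mult_div_mod_eq[of d m] unfolding M_def mult_Suc_right
        by linarith
      show "N \<le> Suc M" using div_le_mono[OF that, of d] d(1) unfolding M_def by simp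
      show "d * M \<le> m" unfolding M_def by simp
    qed
    have le: "d * k \<le> m" if "k \<le> M" for k
      using M(3) mult_le_mono2[OF that, of d] by linarith
    have "m + d < d * Suc (Suc M)" using M(1) by simp
    from H_eq[OF this]
    have top: "H (m + d) = h 0 (m + d) + (\<Sum>k\<le>M. h (Suc k) (m - d * k))"
      by (subst (asm) sum.atMost_Suc_shift) (auto intro!: sum.cong simp: le)
    have bot: "H m = (\<Sum>k\<le>M. h k (m - d * k))"
      unfolding H_eq[OF M(1)] by (intro sum.cong) (auto simp: le)
    have "H (m + d) - H m = h 0 (m + d) + (\<Sum>k\<le>M. h (Suc k) (m - d * k) - h k (m - d * k))"
      unfolding top bot sum_subtractf by (rule add_diff_eq[symmetric])
    moreover have "(\<Sum>k\<le>M. h (Suc k) (m - d * k) - h k (m - d * k))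
        = (\<Sum>k<N. h (Suc k) (m - d * k) - h k (m - d * k))"
    proof (rule sum.mono_neutral_right)
      show "finite {..M}" by (rule finite_atMost)
      show "\<forall>k\<in>{..M} - {..<N}. h (Suc k) (m - d * k) - h k (m - d * k) = 0"
      proof
        fix k assume "k \<in> {..M} - {..<N}"
        hence "V (Suc k) = V N" "V k = V N" using N[of k] N[of "Suc k"] by auto
        thus "h (Suc k) (m - d * k) - h k (m - d * k) = 0" by (simp add: h_def)
      qed
      show "{..<N} \<subseteq> {..M}" using M(2) by auto
    qed
    ultimately show ?thesis by (simp only:)
  qed
  have ev: "\<forall>\<^sub>F m in sequentially.
      h 0 (m + d) + (\<Sum>k<N. h (Suc k) (m - d * k) - h k (m - d * k)) = H (m + d) - H m"
    using eventually_ge_at_top[of "d * N"] by eventually_elim (simp only: diff)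
  have "polynomial_on_progressions
      (\<lambda>m. h 0 (m + d) + (\<Sum>k<N. h (Suc k) (m - d * k) - h k (m - d * k))) L"
    by (intro polynomial_on_progressions_add polynomial_on_progressions_sum
        polynomial_on_progressions_diff polynomial_on_progressions_shift_forward
        polynomial_on_progressions_shift_backward h \<open>0 < L\<close>)
  from polynomial_on_progressions_eventually_cong[OF this \<open>0 < L\<close> ev]
  have "polynomial_on_progressions (\<lambda>m. H (m + d) - H m) L" .
  from polynomial_on_progressions_of_difference[OF this d(2) \<open>0 < L\<close>] show ?case
    unfolding H_def .
qed

section \<open>Independence and rank for closure operators with exchange\<close>

text \<open>
  Linear span and linear independence without a vector space: with the exchange property, all
  maximal independent sets have the same size (the closure operator of a matroid).
\<close>

locale exchange_closure =
  fixes E :: "'a set" and cl :: "'a set \<Rightarrow> 'a set"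
  assumes cl_carrier: "X \<subseteq> E \<Longrightarrow> cl X \<subseteq> E"
    and cl_extensive: "X \<subseteq> E \<Longrightarrow> X \<subseteq> cl X"
    and cl_least: "\<lbrakk>Y \<subseteq> E; X \<subseteq> cl Y\<rbrakk> \<Longrightarrow> cl X \<subseteq> cl Y"
    and cl_exchange: "\<lbrakk>X \<subseteq> E; x \<in> E; y \<in> cl (insert x X); y \<notin> cl X\<rbrakk> \<Longrightarrow> x \<in> cl (insert y X)"
begin

definition indep :: "'a set \<Rightarrow> bool" where
  "indep A \<longleftrightarrow> A \<subseteq> E \<and> (\<forall>a\<in>A. a \<notin> cl (A - {a}))"

lemma cl_mono: "X \<subseteq> Y \<Longrightarrow> Y \<subseteq> E \<Longrightarrow> cl X \<subseteq> cl Y"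
  by (rule cl_least) (use cl_extensive in blast)+

lemma indep_carrier: "indep A \<Longrightarrow> A \<subseteq> E"
  by (simp add: indep_def)

lemma indep_empty: "indep {}"
  by (simp add: indep_def)

lemma indep_subset:
  assumes "indep A" "B \<subseteq> A"
  shows "indep B"
proof -
  have "cl (B - {b}) \<subseteq> cl (A - {b})" for b
    by (rule cl_mono) (use assms indep_carrier in blast)+
  with assms show ?thesis unfolding indep_def by blast
qed

lemma indep_insert:
  assumes A: "indep A" and b: "b \<in> E" "b \<notin> cl A"
  shows "indep (insert b A)"
  unfolding indep_def
proof (intro conjI ballI)
  show "insert b A \<subseteq> E" using A b indep_carrier by blast
  fix a assume a: "a \<in> insert b A"
  have "b \<notin> A" using b cl_extensive[OF indep_carrier[OF A]] by blast
  show "a \<notin> cl (insert b A - {a})"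
  proof (cases "a = b")
    case True
    thus ?thesis using b \<open>b \<notin> A\<close> by simp
  next
    case False
    hence "a \<in> A" using a by simp
    hence notin: "a \<notin> cl (A - {a})" using A by (simp add: indep_def)
    show ?thesis
    proof
      assume "a \<in> cl (insert b A - {a})"
      hence "a \<in> cl (insert b (A - {a}))" using False by (simp add: insert_Diff_if)
      hence "b \<in> cl (insert a (A - {a}))"
        by (intro cl_exchange[OF _ b(1)]) (use notin A indep_carrier in auto)
      thus False using b \<open>a \<in> A\<close> by (simp add: insert_absorb)
    qed
  qed
qed

text \<open>
  Steinitz exchange: an element of \<open>A\<close> outside \<open>B\<close> can be replaced by some element of \<open>B\<close> without
  losing independence, since \<open>B\<close> cannot lie in the closure of the rest of \<open>A\<close>.
\<close>

theorem indep_card_le_spanning: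
  assumes "indep A" "finite A" "finite B" "B \<subseteq> E" "A \<subseteq> cl B"
  shows "card A \<le> card B"
  using assms
proof (induction "card (A - B)" arbitrary: A rule: less_induct)
  case less
  show ?case
  proof (cases "A \<subseteq> B")
    case True
    thus ?thesis using less.prems by (simp add: card_mono)
  next
    case False
    then obtain a where a: "a \<in> A" "a \<notin> B" by blast
    \<comment> \<open>exchange \<open>a\<close> for an element \<open>b\<close> of \<open>B\<close>\<close>
    define A' where "A' = A - {a}"
    have "indep A'" unfolding A'_def by (rule indep_subset[OF less.prems(1)]) blast
    hence A': "indep A'" "finite A'" "A' \<subseteq> E"
      using less.prems(2) indep_carrier[of A'] unfolding A'_def by simp_all
    have "a \<notin> cl A'" using less.prems(1) a(1) by (simp add: indep_def A'_def)
    hence "\<not> cl B \<subseteq> cl A'" using less.prems(5) a(1) by auto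
    hence "\<not> B \<subseteq> cl A'" using cl_least[OF A'(3), of B] by auto
    then obtain b where b: "b \<in> B" "b \<notin> cl A'" by blast
    have "b \<notin> A'" using b(2) cl_extensive[OF A'(3)] by blast
    have "insert b A' - B = (A - B) - {a}" using b(1) unfolding A'_def by auto
    hence "insert b A' - B \<subset> A - B" using a by auto
    hence smaller: "card (insert b A' - B) < card (A - B)"
      by (intro psubset_card_mono finite_Diff less.prems(2))
    have ind: "indep (insert b A')" using indep_insert[OF A'(1)] b less.prems(4) by blast
    have "insert b A' \<subseteq> cl B"
      using less.prems(5) b(1) cl_extensive[OF less.prems(4)] unfolding A'_def by blast
    from less.hyps[OF smaller ind _ less.prems(3,4) this]
    have "card (insert b A') \<le> card B" using A'(2) by blast
    moreover have "card (insert b A') = card A"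
      using \<open>b \<notin> A'\<close> A'(2) card_Suc_Diff1[OF less.prems(2) a(1)] unfolding A'_def by simp
    ultimately show ?thesis by simp
  qed
qed

lemma extend_indep_by_generators:
  assumes A: "indep A" and "finite C" "C \<subseteq> E"
  shows "\<exists>T\<subseteq>C. T \<inter> A = {} \<and> indep (A \<union> T) \<and> C \<subseteq> cl (A \<union> T)"
  using assms(2,3)
proof (induction C rule: finite_induct)
  case empty
  thus ?case using A by auto
next
  case (insert c C)
  then obtain T where T: "T \<subseteq> C" "T \<inter> A = {}" "indep (A \<union> T)" "C \<subseteq> cl (A \<union> T)" by auto
  show ?case
  proof (cases "c \<in> cl (A \<union> T)")
    case True
    thus ?thesis using T by blast
  next
    case False
    have "c \<in> E" using insert.prems by simp
    have ind: "indep (A \<union> insert c T)" using indep_insert[OF T(3) \<open>c \<in> E\<close> False] by simp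
    have "cl (A \<union> T) \<subseteq> cl (A \<union> insert c T)"
      by (rule cl_mono[OF _ indep_carrier[OF ind]]) blast
    moreover have "c \<in> cl (A \<union> insert c T)"
      using cl_extensive[OF indep_carrier[OF ind]] by blast
    moreover have "c \<notin> A" using False cl_extensive[OF indep_carrier[OF T(3)]] by blast
    ultimately show ?thesis using T ind by (intro exI[of _ "insert c T"]) auto
  qed
qed

text \<open>
  Going through the family in increasing order and keeping the elements that are not in the closure
  of their predecessors gives a basis of the closure of the family.
\<close>

lemma greedy_basis:
  fixes x :: "'i::linorder \<Rightarrow> 'a"
  assumes "finite P" "x ` P \<subseteq> E"
  defines "B \<equiv> {a \<in> P. x a \<notin> cl (x ` {b \<in> P. b < a})}"
  shows "inj_on x B" "indep (x ` B)" "x ` P \<subseteq> cl (x ` B)"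
proof -
  have "inj_on x B \<and> indep (x ` B) \<and> x ` P \<subseteq> cl (x ` B)"
    using assms(1,2) unfolding B_def
  proof (induction P rule: finite_linorder_max_induct)
    case empty
    thus ?case by (simp add: indep_empty)
  next
    case (insert p P)
    define B where "B = {a \<in> P. x a \<notin> cl (x ` {b \<in> P. b < a})}"
    define B' where "B' = {a \<in> insert p P. x a \<notin> cl (x ` {b \<in> insert p P. b < a})}"
    have IH: "inj_on x B" "indep (x ` B)" "x ` P \<subseteq> cl (x ` B)"
      using insert.IH insert.prems unfolding B_def by auto
    have E: "x ` B \<subseteq> E" "x ` P \<subseteq> E" "x p \<in> E" using insert.prems unfolding B_def by auto
    have cl_eq: "cl (x ` P) = cl (x ` B)"
    proof
      show "cl (x ` P) \<subseteq> cl (x ` B)" by (rule cl_least[OF E(1) IH(3)])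
      show "cl (x ` B) \<subseteq> cl (x ` P)" by (rule cl_mono[OF _ E(2)]) (auto simp: B_def)
    qed
    have below: "{b \<in> insert p P. b < a} = {b \<in> P. b < a}" if "a \<in> P" for a
      using insert.hyps(2) that by auto
    have top: "{b \<in> insert p P. b < p} = P" using insert.hyps(2) by auto
    have B': "B' = (if x p \<in> cl (x ` B) then B else insert p B)"
    proof -
      have "a \<in> B' \<longleftrightarrow> a \<in> (if x p \<in> cl (x ` B) then B else insert p B)" for a
      proof (cases "a = p")
        case True
        have "p \<notin> P" using insert.hyps(2) by auto
        thus ?thesis unfolding B'_def True mem_Collect_eq top cl_eq by (simp add: B_def)
      next
        case False
        thus ?thesis unfolding B'_def B_def using below[of a] by (cases "a \<in> P") simp_all
      qed
      thus ?thesis by blast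
    qed
    have "inj_on x B' \<and> indep (x ` B') \<and> x ` insert p P \<subseteq> cl (x ` B')"
    proof (cases "x p \<in> cl (x ` B)")
      case True
      thus ?thesis using IH B' by simp
    next
      case False
      have ind: "indep (insert (x p) (x ` B))" by (rule indep_insert[OF IH(2) E(3) False])
      have "x p \<notin> x ` B" using False cl_extensive[OF E(1)] by blast
      moreover have "insert (x p) (x ` B) \<subseteq> cl (insert (x p) (x ` B))"
        by (rule cl_extensive[OF indep_carrier[OF ind]])
      moreover have "cl (x ` B) \<subseteq> cl (insert (x p) (x ` B))"
        by (rule cl_mono[OF _ indep_carrier[OF ind]]) blast
      ultimately show ?thesis using IH B' ind False by auto
    qed
    thus ?case unfolding B'_def .
  qed
  thus "inj_on x B" "indep (x ` B)" "x ` P \<subseteq> cl (x ` B)" by auto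
qed

text \<open>
  The rank of the contraction by \<open>cl A\<close>: it is the least number of elements that together with \<open>A\<close>
  span everything, and it is attained inside every finite spanning set \<open>C\<close>.
\<close>

theorem relative_rank:
  assumes A: "indep A" "finite A" and B: "indep B" "finite B" "cl B = E"
  shows "card A \<le> card B"
    and "\<lbrakk>finite C; C \<subseteq> E; cl C = E\<rbrakk> \<Longrightarrow> \<exists>T\<subseteq>C. card T = card B - card A \<and> cl (A \<union> T) = E"
    and "\<lbrakk>finite S; S \<subseteq> E; cl (A \<union> S) = E\<rbrakk> \<Longrightarrow> card B - card A \<le> card S"
proof -
  show "card A \<le> card B"
    using indep_card_le_spanning[OF A B(2) indep_carrier[OF B(1)]] indep_carrier[OF A(1)] B(3) by simp
next
  assume C: "finite C" "C \<subseteq> E" "cl C = E"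
  obtain T where T: "T \<subseteq> C" "T \<inter> A = {}" "indep (A \<union> T)" "C \<subseteq> cl (A \<union> T)"
    using extend_indep_by_generators[OF A(1) C(1,2)] by blast
  have fin: "finite (A \<union> T)" using A(2) C(1) T(1) finite_subset by blast
  have span: "cl (A \<union> T) = E"
    using cl_least[OF indep_carrier[OF T(3)] T(4)] C(3) cl_carrier[OF indep_carrier[OF T(3)]] by simp
  have "card (A \<union> T) \<le> card B"
    using indep_card_le_spanning[OF T(3) fin B(2) indep_carrier[OF B(1)]] indep_carrier[OF T(3)] B(3)
    by simp
  moreover have "card B \<le> card (A \<union> T)"
    using indep_card_le_spanning[OF B(1,2) fin indep_carrier[OF T(3)]] indep_carrier[OF B(1)] span
    by simp
  ultimately have "card T = card B - card A"
    using card_Un_disjoint[of A T] fin T(2) by (simp add: Int_commute)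
  thus "\<exists>T\<subseteq>C. card T = card B - card A \<and> cl (A \<union> T) = E" using T(1) span by blast
next
  assume S: "finite S" "S \<subseteq> E" "cl (A \<union> S) = E"
  have "finite (A \<union> S)" "A \<union> S \<subseteq> E" using A(2) S(1,2) indep_carrier[OF A(1)] by auto
  from indep_card_le_spanning[OF B(1,2) this]
  have "card B \<le> card (A \<union> S)" using indep_carrier[OF B(1)] S(3) by simp
  also have "\<dots> \<le> card A + card S" by (rule card_Un_le)
  finally show "card B - card A \<le> card S" by simp
qed

end

section \<open>Localization and symbolic powers\<close>

lemma (in cring) idealI':
  assumes "H \<subseteq> carrier R" "\<zero> \<in> H"
    and add: "\<And>a b. \<lbrakk>a \<in> H; b \<in> H\<rbrakk> \<Longrightarrow> a \<oplus> b \<in> H"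
    and mult: "\<And>a x. \<lbrakk>a \<in> H; x \<in> carrier R\<rbrakk> \<Longrightarrow> x \<otimes> a \<in> H"
  shows "ideal H R"
proof (rule idealI)
  show "ring R" by (rule ring_axioms)
  have neg: "\<ominus> a \<in> H" if "a \<in> H" for a
  proof -
    have "a \<in> carrier R" using that assms(1) by blast
    hence "\<ominus> a = (\<ominus> \<one>) \<otimes> a" by algebra
    thus ?thesis using mult[OF that] by simp
  qed
  show "subgroup H (add_monoid R)"
    by (rule add.subgroupI) (use assms neg in \<open>auto simp: a_inv_def[symmetric]\<close>)
  show mult': "x \<otimes> a \<in> H" if "a \<in> H" "x \<in> carrier R" for a x by (rule mult[OF that])
  show "a \<otimes> x \<in> H" if "a \<in> H" "x \<in> carrier R" for a x
    using mult'[OF that] m_comm[of a x] assms(1) that by auto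
qed

locale multiplicative_subset = cring R for R (structure) +
  fixes S :: "'a set"
  assumes S_carrier: "S \<subseteq> carrier R" and S_one: "\<one> \<in> S"
    and S_mult: "\<lbrakk>a \<in> S; b \<in> S\<rbrakk> \<Longrightarrow> a \<otimes> b \<in> S"
begin

abbreviation frac :: "'a \<Rightarrow> 'a \<Rightarrow> ('a \<times> 'a) set" where "frac \<equiv> fraction R S"

lemma S_closed [simp]: "s \<in> S \<Longrightarrow> s \<in> carrier R"
  using S_carrier by blast

declare S_one [simp] S_mult [simp]

lemma frac_mem_iff:
  assumes "r \<in> carrier R" "s \<in> S"
  shows "(r', s') \<in> frac r s \<longleftrightarrow>
    r' \<in> carrier R \<and> s' \<in> S \<and> (\<exists>u\<in>S. u \<otimes> (r \<otimes> s') = u \<otimes> (r' \<otimes> s))"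
proof -
  have "u \<otimes> (r \<otimes> s' \<ominus> r' \<otimes> s) = \<zero> \<longleftrightarrow> u \<otimes> (r \<otimes> s') = u \<otimes> (r' \<otimes> s)"
    if "u \<in> S" "r' \<in> carrier R" "s' \<in> S" for u
  proof -
    have "u \<otimes> (r \<otimes> s' \<ominus> r' \<otimes> s) = u \<otimes> (r \<otimes> s') \<ominus> u \<otimes> (r' \<otimes> s)"
      using assms that S_closed[of u] S_closed[of s] S_closed[of s'] by algebra
    thus ?thesis using assms that by (simp add: r_right_minus_eq)
  qed
  thus ?thesis unfolding fraction_def by auto
qed

lemma frac_self: "\<lbrakk>r \<in> carrier R; s \<in> S\<rbrakk> \<Longrightarrow> (r, s) \<in> frac r s"
  by (auto simp: frac_mem_iff)

lemma frac_trans: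
  assumes "r \<in> carrier R" "s \<in> S" "(r', s') \<in> frac r s"
  shows "frac r' s' \<subseteq> frac r s"
proof
  fix z assume z: "z \<in> frac r' s'"
  obtain a b where z_eq: "z = (a, b)" by (cases z)
  obtain u where r': "r' \<in> carrier R" "s' \<in> S" and u: "u \<in> S" "u \<otimes> (r \<otimes> s') = u \<otimes> (r' \<otimes> s)"
    using assms(3) frac_mem_iff[OF assms(1,2)] by blast
  obtain v where a: "a \<in> carrier R" "b \<in> S" and v: "v \<in> S" "v \<otimes> (r' \<otimes> b) = v \<otimes> (a \<otimes> s')"
    using z unfolding z_eq frac_mem_iff[OF r'] by blast
  note car = assms(1) r'(1) a(1) S_closed[OF assms(2)] S_closed[OF r'(2)] S_closed[OF a(2)]
    S_closed[OF u(1)] S_closed[OF v(1)]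
  have "(u \<otimes> v \<otimes> s') \<otimes> (r \<otimes> b) = (v \<otimes> b) \<otimes> (u \<otimes> (r \<otimes> s'))" using car by algebra
  also have "\<dots> = (u \<otimes> s) \<otimes> (v \<otimes> (r' \<otimes> b))" unfolding u(2) using car by algebra
  also have "\<dots> = (u \<otimes> v \<otimes> s') \<otimes> (a \<otimes> s)" unfolding v(2) using car by algebra
  finally have "(u \<otimes> v \<otimes> s') \<otimes> (r \<otimes> b) = (u \<otimes> v \<otimes> s') \<otimes> (a \<otimes> s)" .
  moreover have "u \<otimes> v \<otimes> s' \<in> S" by (intro S_mult u(1) v(1) r'(2))
  ultimately show "z \<in> frac r s"
    unfolding z_eq frac_mem_iff[OF assms(1,2)] using a by blast
qed

lemma frac_eqI:
  assumes "r \<in> carrier R" "s \<in> S" "r' \<in> carrier R" "s' \<in> S"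
    and "u \<in> S" "u \<otimes> (r \<otimes> s') = u \<otimes> (r' \<otimes> s)"
  shows "frac r s = frac r' s'"
proof
  have "(r, s) \<in> frac r' s'" "(r', s') \<in> frac r s"
    unfolding frac_mem_iff[OF assms(1,2)] frac_mem_iff[OF assms(3,4)]
    using assms by (metis, metis)
  thus "frac r s \<subseteq> frac r' s'" "frac r' s' \<subseteq> frac r s"
    using frac_trans assms by blast+
qed

lemma frac_eqD:
  assumes "r \<in> carrier R" "s \<in> S" "r' \<in> carrier R" "s' \<in> S" "frac r s = frac r' s'"
  shows "\<exists>u\<in>S. u \<otimes> (r \<otimes> s') = u \<otimes> (r' \<otimes> s)"
  using frac_self[OF assms(3,4)] frac_mem_iff[OF assms(1,2), of r' s'] assms(5) by blast

lemma frac_cancel: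
  assumes "r \<in> carrier R" "s \<in> S" "t \<in> S"
  shows "frac (t \<otimes> r) (t \<otimes> s) = frac r s"
proof (rule frac_eqI[where u = \<one>])
  show "\<one> \<otimes> (t \<otimes> r \<otimes> s) = \<one> \<otimes> (r \<otimes> (t \<otimes> s))"
    using assms(1) S_closed[OF assms(2)] S_closed[OF assms(3)] by algebra
qed (use assms in simp_all)

lemma frac_zero: "s \<in> S \<Longrightarrow> frac \<zero> s = frac \<zero> \<one>"
  by (rule frac_eqI[where u = \<one>]) simp_all

abbreviation L :: "('a \<times> 'a) set ring" where "L \<equiv> localization R S"

lemma carrier_L: "carrier L = {frac r s |r s. r \<in> carrier R \<and> s \<in> S}"
  by (simp add: localization_def)

lemma zero_L: "\<zero>\<^bsub>L\<^esub> = frac \<zero> \<one>" and one_L: "\<one>\<^bsub>L\<^esub> = frac \<one> \<one>"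
  by (simp_all add: localization_def)

lemma frac_carrier: "\<lbrakk>r \<in> carrier R; s \<in> S\<rbrakk> \<Longrightarrow> frac r s \<in> carrier L"
  by (auto simp: carrier_L)

text \<open>
  The operations of the localization are unions over representatives; this evaluates them once the
  result is known not to depend on the representatives.
\<close>

lemma UN_frac_const:
  assumes "r \<in> carrier R" "s \<in> S" "r' \<in> carrier R" "s' \<in> S"
    and "\<And>a b c d. \<lbrakk>(a, b) \<in> frac r s; (c, d) \<in> frac r' s'\<rbrakk> \<Longrightarrow> F a b c d = C"
  shows "(\<Union>(a, b)\<in>frac r s. \<Union>(c, d)\<in>frac r' s'. F a b c d) = C"
  using frac_self[OF assms(1,2)] frac_self[OF assms(3,4)] assms(5) by fast

lemma mult_frac:
  assumes rs: "r \<in> carrier R" "s \<in> S" "r' \<in> carrier R" "s' \<in> S"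
  shows "frac r s \<otimes>\<^bsub>L\<^esub> frac r' s' = frac (r \<otimes> r') (s \<otimes> s')"
proof -
  have "frac (a \<otimes> c) (b \<otimes> d) = frac (r \<otimes> r') (s \<otimes> s')"
    if members: "(a, b) \<in> frac r s" "(c, d) \<in> frac r' s'" for a b c d
  proof -
    obtain u where ab: "a \<in> carrier R" "b \<in> S" and u: "u \<in> S" "u \<otimes> (r \<otimes> b) = u \<otimes> (a \<otimes> s)"
      using members(1) frac_mem_iff[OF rs(1,2)] by blast
    obtain v where cd: "c \<in> carrier R" "d \<in> S" and v: "v \<in> S" "v \<otimes> (r' \<otimes> d) = v \<otimes> (c \<otimes> s')"
      using members(2) frac_mem_iff[OF rs(3,4)] by blast
    note car = rs(1,3) ab(1) cd(1) rs(2,4)[THEN S_closed] S_closed[OF ab(2)] S_closed[OF cd(2)]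
      S_closed[OF u(1)] S_closed[OF v(1)]
    show ?thesis
    proof (rule frac_eqI[where u = "u \<otimes> v"])
      have "(u \<otimes> v) \<otimes> (a \<otimes> c \<otimes> (s \<otimes> s')) = (u \<otimes> (a \<otimes> s)) \<otimes> (v \<otimes> (c \<otimes> s'))"
        using car by algebra
      also have "\<dots> = (u \<otimes> v) \<otimes> (r \<otimes> r' \<otimes> (b \<otimes> d))"
        unfolding u(2)[symmetric] v(2)[symmetric] using car by algebra
      finally show "(u \<otimes> v) \<otimes> (a \<otimes> c \<otimes> (s \<otimes> s')) = (u \<otimes> v) \<otimes> (r \<otimes> r' \<otimes> (b \<otimes> d))" .
    qed (use rs ab cd u v in simp_all)
  qed
  from UN_frac_const[OF rs this] show ?thesis by (simp add: localization_def)
qed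

lemma add_frac:
  assumes rs: "r \<in> carrier R" "s \<in> S" "r' \<in> carrier R" "s' \<in> S"
  shows "frac r s \<oplus>\<^bsub>L\<^esub> frac r' s' = frac (r \<otimes> s' \<oplus> r' \<otimes> s) (s \<otimes> s')"
proof -
  have "frac (a \<otimes> d \<oplus> c \<otimes> b) (b \<otimes> d) = frac (r \<otimes> s' \<oplus> r' \<otimes> s) (s \<otimes> s')"
    if members: "(a, b) \<in> frac r s" "(c, d) \<in> frac r' s'" for a b c d
  proof -
    obtain u where ab: "a \<in> carrier R" "b \<in> S" and u: "u \<in> S" "u \<otimes> (r \<otimes> b) = u \<otimes> (a \<otimes> s)"
      using members(1) frac_mem_iff[OF rs(1,2)] by blast
    obtain v where cd: "c \<in> carrier R" "d \<in> S" and v: "v \<in> S" "v \<otimes> (r' \<otimes> d) = v \<otimes> (c \<otimes> s')"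
      using members(2) frac_mem_iff[OF rs(3,4)] by blast
    note car = rs(1,3) ab(1) cd(1) rs(2,4)[THEN S_closed] S_closed[OF ab(2)] S_closed[OF cd(2)]
      S_closed[OF u(1)] S_closed[OF v(1)]
    show ?thesis
    proof (rule frac_eqI[where u = "u \<otimes> v"])
      have "(u \<otimes> v) \<otimes> ((a \<otimes> d \<oplus> c \<otimes> b) \<otimes> (s \<otimes> s'))
          = (v \<otimes> d \<otimes> s') \<otimes> (u \<otimes> (a \<otimes> s)) \<oplus> (u \<otimes> b \<otimes> s) \<otimes> (v \<otimes> (c \<otimes> s'))"
        using car by algebra
      also have "\<dots> = (u \<otimes> v) \<otimes> ((r \<otimes> s' \<oplus> r' \<otimes> s) \<otimes> (b \<otimes> d))"
        unfolding u(2)[symmetric] v(2)[symmetric] using car by algebra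
      finally show "(u \<otimes> v) \<otimes> ((a \<otimes> d \<oplus> c \<otimes> b) \<otimes> (s \<otimes> s'))
          = (u \<otimes> v) \<otimes> ((r \<otimes> s' \<oplus> r' \<otimes> s) \<otimes> (b \<otimes> d))" .
    qed (use rs ab cd u v in simp_all)
  qed
  from UN_frac_const[OF rs this] show ?thesis by (simp add: localization_def)
qed

lemma cring_localization: "cring L"
proof (intro cringI abelian_groupI comm_monoidI)
  fix x y z assume "x \<in> carrier L" "y \<in> carrier L" "z \<in> carrier L"
  then obtain a s b t c w where
    x: "x = frac a s" "a \<in> carrier R" "s \<in> S" and y: "y = frac b t" "b \<in> carrier R" "t \<in> S" and
    z: "z = frac c w" "c \<in> carrier R" "w \<in> S"
    unfolding carrier_L by blast
  note car = x(2) y(2) z(2) S_closed[OF x(3)] S_closed[OF y(3)] S_closed[OF z(3)]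
  note S = x(3) y(3) z(3)
  show "x \<oplus>\<^bsub>L\<^esub> y \<in> carrier L" "x \<otimes>\<^bsub>L\<^esub> y \<in> carrier L"
    unfolding x(1) y(1) add_frac[OF x(2,3) y(2,3)] mult_frac[OF x(2,3) y(2,3)]
    using car S by (auto intro!: frac_carrier)
  have frac_cong: "frac n d = frac n' d'" if "n = n'" "d = d'" for n d n' d'
    using that by simp
  show "x \<oplus>\<^bsub>L\<^esub> y \<oplus>\<^bsub>L\<^esub> z = x \<oplus>\<^bsub>L\<^esub> (y \<oplus>\<^bsub>L\<^esub> z)"
  proof -
    have "(a \<otimes> t \<oplus> b \<otimes> s) \<otimes> w \<oplus> c \<otimes> (s \<otimes> t) = a \<otimes> (t \<otimes> w) \<oplus> (b \<otimes> w \<oplus> c \<otimes> t) \<otimes> s"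
      using car by algebra
    from frac_cong[OF this m_assoc[of s t w]] show ?thesis
      using car S by (simp add: x(1) y(1) z(1) add_frac)
  qed
  show "x \<otimes>\<^bsub>L\<^esub> y \<otimes>\<^bsub>L\<^esub> z = x \<otimes>\<^bsub>L\<^esub> (y \<otimes>\<^bsub>L\<^esub> z)"
    using car S by (simp add: x(1) y(1) z(1) mult_frac m_assoc)
  show "x \<oplus>\<^bsub>L\<^esub> y = y \<oplus>\<^bsub>L\<^esub> x"
    using frac_cong[OF a_comm[of "a \<otimes> t" "b \<otimes> s"] m_comm[of s t]] car S
    by (simp add: x(1) y(1) add_frac)
  show "x \<otimes>\<^bsub>L\<^esub> y = y \<otimes>\<^bsub>L\<^esub> x"
    using frac_cong[OF m_comm[of a b] m_comm[of s t]] car S by (simp add: x(1) y(1) mult_frac)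
  have "(x \<oplus>\<^bsub>L\<^esub> y) \<otimes>\<^bsub>L\<^esub> z = frac ((a \<otimes> t \<oplus> b \<otimes> s) \<otimes> c) (s \<otimes> t \<otimes> w)"
    using car S by (simp add: x(1) y(1) z(1) add_frac mult_frac)
  \<comment> \<open>the sum of the two products has the denominator \<open>s w t w\<close>\<close>
  also have "\<dots> = frac (w \<otimes> ((a \<otimes> t \<oplus> b \<otimes> s) \<otimes> c)) (w \<otimes> (s \<otimes> t \<otimes> w))"
    using car S by (simp add: frac_cancel)
  also have "\<dots> = frac (a \<otimes> c \<otimes> (t \<otimes> w) \<oplus> b \<otimes> c \<otimes> (s \<otimes> w)) (s \<otimes> w \<otimes> (t \<otimes> w))"
    by (rule frac_cong) (use car in algebra)+
  also have "\<dots> = x \<otimes>\<^bsub>L\<^esub> z \<oplus>\<^bsub>L\<^esub> y \<otimes>\<^bsub>L\<^esub> z"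
    using car S by (simp add: x(1) y(1) z(1) add_frac mult_frac)
  finally show "(x \<oplus>\<^bsub>L\<^esub> y) \<otimes>\<^bsub>L\<^esub> z = x \<otimes>\<^bsub>L\<^esub> z \<oplus>\<^bsub>L\<^esub> y \<otimes>\<^bsub>L\<^esub> z" .
next
  fix x assume "x \<in> carrier L"
  then obtain a s where x: "x = frac a s" "a \<in> carrier R" "s \<in> S" unfolding carrier_L by blast
  show "\<zero>\<^bsub>L\<^esub> \<oplus>\<^bsub>L\<^esub> x = x" "\<one>\<^bsub>L\<^esub> \<otimes>\<^bsub>L\<^esub> x = x"
    using x(2,3) by (simp_all add: x(1) zero_L one_L add_frac mult_frac)
  have "\<ominus> a \<otimes> s \<oplus> a \<otimes> s = \<zero>" using x(2) S_closed[OF x(3)] by algebra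
  hence "frac (\<ominus> a) s \<oplus>\<^bsub>L\<^esub> x = frac \<zero> (s \<otimes> s)"
    unfolding x(1) add_frac[OF a_inv_closed[OF x(2)] x(3) x(2,3)] by (simp only:)
  also have "\<dots> = \<zero>\<^bsub>L\<^esub>" unfolding zero_L by (rule frac_zero[OF S_mult[OF x(3) x(3)]])
  finally have "frac (\<ominus> a) s \<oplus>\<^bsub>L\<^esub> x = \<zero>\<^bsub>L\<^esub>" .
  thus "\<exists>y\<in>carrier L. y \<oplus>\<^bsub>L\<^esub> x = \<zero>\<^bsub>L\<^esub>"
    using frac_carrier[of "\<ominus> a" s] x(2,3) by blast
qed (simp_all add: zero_L one_L frac_carrier)

text \<open>
  The ideal generated by the image of \<open>J\<close> consists of the fractions with numerator in \<open>J\<close>, and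
  \<open>r / 1 = j / s\<close> means that \<open>(u s) r = u j\<close> for some \<open>u \<in> S\<close>.
\<close>

lemma to_localization_mem_genideal_iff:
  assumes J: "ideal J R" and r: "r \<in> carrier R"
  shows "to_localization R S r \<in> genideal L (to_localization R S ` J) \<longleftrightarrow> (\<exists>u\<in>S. u \<otimes> r \<in> J)"
proof
  interpret J: ideal J R by fact
  interpret L: cring L by (rule cring_localization)
  let ?H = "{frac j s |j s. j \<in> J \<and> s \<in> S}"
  have H_ideal: "ideal ?H L"
  proof (rule L.idealI')
    show "?H \<subseteq> carrier L" using J.a_subset by (auto simp: carrier_L)
    show "\<zero>\<^bsub>L\<^esub> \<in> ?H" unfolding zero_L using J.zero_closed S_one by blast
  next
    fix x y assume "x \<in> ?H" "y \<in> ?H"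
    then obtain a s b t where x: "x = frac a s" "a \<in> J" "s \<in> S" and y: "y = frac b t" "b \<in> J" "t \<in> S"
      by blast
    have "x \<oplus>\<^bsub>L\<^esub> y = frac (a \<otimes> t \<oplus> b \<otimes> s) (s \<otimes> t)"
      unfolding x(1) y(1) by (rule add_frac[OF J.Icarr[OF x(2)] x(3) J.Icarr[OF y(2)] y(3)])
    moreover have "a \<otimes> t \<oplus> b \<otimes> s \<in> J" "s \<otimes> t \<in> S"
      using x y by (simp_all add: J.I_r_closed)
    ultimately show "x \<oplus>\<^bsub>L\<^esub> y \<in> ?H" by blast
  next
    fix x y assume "x \<in> ?H" "y \<in> carrier L"
    then obtain a s b t where x: "x = frac a s" "a \<in> J" "s \<in> S" and y: "y = frac b t" "b \<in> carrier R" "t \<in> S"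
      unfolding carrier_L by blast
    have "y \<otimes>\<^bsub>L\<^esub> x = frac (b \<otimes> a) (t \<otimes> s)"
      unfolding x(1) y(1) by (rule mult_frac[OF y(2,3) J.Icarr[OF x(2)] x(3)])
    moreover have "b \<otimes> a \<in> J" "t \<otimes> s \<in> S" using x y by (simp_all add: J.I_l_closed)
    ultimately show "y \<otimes>\<^bsub>L\<^esub> x \<in> ?H" by blast
  qed
  assume "to_localization R S r \<in> genideal L (to_localization R S ` J)"
  moreover have "to_localization R S ` J \<subseteq> ?H" unfolding to_localization_def using S_one by blast
  ultimately have "frac r \<one> \<in> ?H"
    using L.genideal_minimal[OF H_ideal, of "to_localization R S ` J"]
    unfolding to_localization_def by auto
  then obtain j s where j: "frac r \<one> = frac j s" "j \<in> J" "s \<in> S" by blast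
  then obtain u where u: "u \<in> S" "u \<otimes> (r \<otimes> s) = u \<otimes> (j \<otimes> \<one>)"
    using frac_eqD[OF r S_one J.Icarr[OF j(2)] j(3) j(1)] by blast
  have "(u \<otimes> s) \<otimes> r = u \<otimes> (r \<otimes> s)"
    using r S_closed[OF u(1)] S_closed[OF j(3)] by algebra
  also have "\<dots> \<in> J" unfolding u(2) using u(1) j(2) by (simp add: J.I_l_closed J.Icarr)
  finally have "(u \<otimes> s) \<otimes> r \<in> J" .
  thus "\<exists>u\<in>S. u \<otimes> r \<in> J" by (rule bexI[OF _ S_mult[OF u(1) j(3)]])
next
  interpret J: ideal J R by fact
  interpret L: cring L by (rule cring_localization)
  assume "\<exists>u\<in>S. u \<otimes> r \<in> J"
  then obtain u where u: "u \<in> S" "u \<otimes> r \<in> J" by blast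
  have car: "to_localization R S ` J \<subseteq> carrier L"
    unfolding to_localization_def using J.Icarr by (auto intro!: frac_carrier)
  interpret G: ideal "genideal L (to_localization R S ` J)" L by (rule L.genideal_ideal[OF car])
  have "frac (u \<otimes> r) \<one> \<in> genideal L (to_localization R S ` J)"
    using L.genideal_self[OF car] u(2) unfolding to_localization_def by blast
  hence "frac \<one> u \<otimes>\<^bsub>L\<^esub> frac (u \<otimes> r) \<one> \<in> genideal L (to_localization R S ` J)"
    using G.I_l_closed frac_carrier[OF one_closed u(1)] by blast
  moreover have "frac \<one> u \<otimes>\<^bsub>L\<^esub> frac (u \<otimes> r) \<one> = frac r \<one>"
    unfolding mult_frac[OF one_closed u(1) J.Icarr[OF u(2)] S_one] l_one[OF J.Icarr[OF u(2)]]
    by (rule frac_cancel[OF r S_one u(1)])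
  ultimately show "to_localization R S r \<in> genideal L (to_localization R S ` J)"
    unfolding to_localization_def by (simp only:)
qed

end

text \<open>
  This and \<open>symbolic_power_eq\<close> below remove localizations from all later arguments.
\<close>

lemma (in cring) localized_contraction_eq:
  assumes p: "primeideal p R" and J: "ideal J R"
  shows "localized_contraction R p J = {r \<in> carrier R. \<exists>u\<in>carrier R - p. u \<otimes> r \<in> J}"
proof -
  interpret p: primeideal p R by fact
  interpret multiplicative_subset R "carrier R - p"
  proof
    show "\<one> \<in> carrier R - p" using p.one_imp_carrier p.I_notcarr by blast
    show "a \<otimes> b \<in> carrier R - p" if "a \<in> carrier R - p" "b \<in> carrier R - p" for a b
      using that p.I_prime[of a b] by blast
  qed blast
  show ?thesis
    unfolding localized_contraction_def Let_def using to_localization_mem_genideal_iff[OF J] by blast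
qed

context cring
begin

lemma ideal_ideal_power:
  assumes "ideal I R"
  shows "ideal (ideal_power R I m) R"
  by (induction m) (simp_all add: oneideal ideal_prod_is_ideal assms)

lemma ideal_power_mult_closed:
  assumes I: "ideal I R" and "a \<in> ideal_power R I i" "b \<in> ideal_power R I j"
  shows "a \<otimes> b \<in> ideal_power R I (i + j)"
  using assms(2)
proof (induction i arbitrary: a)
  case 0
  interpret ideal "ideal_power R I j" R by (rule ideal_ideal_power[OF I])
  show ?case using 0 assms(3) I_l_closed by simp
next
  case (Suc i)
  interpret I: ideal I R by fact
  interpret P: ideal "ideal_power R I i" R by (rule ideal_ideal_power[OF I])
  interpret Q: ideal "ideal_power R I j" R by (rule ideal_ideal_power[OF I])
  have "a \<in> ideal_prod R I (ideal_power R I i)" using Suc.prems by simp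
  thus ?case
  proof (induction rule: ideal_prod.induct)
    case (prod x y)
    have "x \<otimes> y \<otimes> b = x \<otimes> (y \<otimes> b)"
      using prod assms(3) I.Icarr P.Icarr Q.Icarr by (simp add: m_assoc)
    moreover have "y \<otimes> b \<in> ideal_power R I (i + j)" by (rule Suc.IH[OF prod(2)])
    ultimately show ?case using ideal_prod.prod[OF prod(1), of "y \<otimes> b"] by simp
  next
    case (sum x y)
    have "x \<in> carrier R" "y \<in> carrier R"
      using sum ideal_prod_in_carrier[OF I P.ideal_axioms] by auto
    thus ?case
      using sum assms(3) Q.Icarr ideal_prod.sum[of "x \<otimes> b" R I _ "y \<otimes> b"]
      by (simp add: l_distr)
  qed
qed

lemma symbolic_power_eq:
  assumes "ideal I R"
  shows "symbolic_power R I m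
    = {r \<in> carrier R. \<forall>p\<in>Ass R I. \<exists>u\<in>carrier R - p. u \<otimes> r \<in> ideal_power R I m}"
proof -
  have "localized_contraction R p (ideal_power R I m)
      = {r \<in> carrier R. \<exists>u\<in>carrier R - p. u \<otimes> r \<in> ideal_power R I m}" if "p \<in> Ass R I" for p
    by (rule localized_contraction_eq[OF _ ideal_ideal_power[OF assms]])
       (use that in \<open>simp add: Ass_def associated_primes_def\<close>)
  thus ?thesis unfolding symbolic_power_def by auto
qed

lemma Ass_prime: "p \<in> Ass R I \<Longrightarrow> primeideal p R"
  by (simp add: Ass_def associated_primes_def)

lemma Ass_complement_mult:
  assumes "p \<in> Ass R I" "u \<in> carrier R - p" "v \<in> carrier R - p"
  shows "u \<otimes> v \<in> carrier R - p"
  using primeideal.I_prime[OF Ass_prime[OF assms(1)], of u v] assms(2,3) by auto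

lemma ideal_power_subset_symbolic_power:
  assumes "ideal I R"
  shows "ideal_power R I m \<subseteq> symbolic_power R I m"
proof
  interpret P: ideal "ideal_power R I m" R by (rule ideal_ideal_power[OF assms])
  fix r assume r: "r \<in> ideal_power R I m"
  have "\<exists>u\<in>carrier R - p. u \<otimes> r \<in> ideal_power R I m" if "p \<in> Ass R I" for p
  proof -
    interpret p: primeideal p R by (rule Ass_prime[OF that])
    have "\<one> \<in> carrier R - p" using p.one_imp_carrier p.I_notcarr by blast
    thus ?thesis using r P.Icarr[OF r] l_one by metis
  qed
  thus "r \<in> symbolic_power R I m" using P.Icarr[OF r] by (simp add: symbolic_power_eq[OF assms])
qed

lemma symbolic_power_mult_closed:
  assumes I: "ideal I R" and "a \<in> symbolic_power R I i" "b \<in> symbolic_power R I j"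
  shows "a \<otimes> b \<in> symbolic_power R I (i + j)"
proof -
  have car: "a \<in> carrier R" "b \<in> carrier R" using assms by (auto simp: symbolic_power_eq)
  have "\<exists>w\<in>carrier R - p. w \<otimes> (a \<otimes> b) \<in> ideal_power R I (i + j)" if p: "p \<in> Ass R I" for p
  proof -
    obtain u v where uv: "u \<in> carrier R - p" "u \<otimes> a \<in> ideal_power R I i"
      "v \<in> carrier R - p" "v \<otimes> b \<in> ideal_power R I j"
      using assms(2,3) p unfolding symbolic_power_eq[OF I] by blast
    have "(u \<otimes> v) \<otimes> (a \<otimes> b) = (u \<otimes> a) \<otimes> (v \<otimes> b)" using uv car by (simp add: m_ac)
    thus ?thesis
      using ideal_power_mult_closed[OF I uv(2,4)] Ass_complement_mult[OF p uv(1,3)] by metis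
  qed
  thus ?thesis using car by (simp add: symbolic_power_eq[OF I])
qed

lemma ideal_symbolic_power:
  assumes I: "ideal I R"
  shows "ideal (symbolic_power R I m) R"
proof (rule idealI')
  interpret P: ideal "ideal_power R I m" R by (rule ideal_ideal_power[OF I])
  show "symbolic_power R I m \<subseteq> carrier R" by (auto simp: symbolic_power_eq[OF I])
  show "\<zero> \<in> symbolic_power R I m"
    using ideal_power_subset_symbolic_power[OF I, of m] P.zero_closed by blast
  show "x \<otimes> a \<in> symbolic_power R I m" if "a \<in> symbolic_power R I m" "x \<in> carrier R" for a x
    using symbolic_power_mult_closed[OF I, of x 0 a m] ideal_power_subset_symbolic_power[OF I, of 0]
      that by auto
  fix a b assume ab: "a \<in> symbolic_power R I m" "b \<in> symbolic_power R I m"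
  have car: "a \<in> carrier R" "b \<in> carrier R" using ab by (auto simp: symbolic_power_eq[OF I])
  have "\<exists>w\<in>carrier R - p. w \<otimes> (a \<oplus> b) \<in> ideal_power R I m" if p: "p \<in> Ass R I" for p
  proof -
    obtain u v where uv: "u \<in> carrier R - p" "u \<otimes> a \<in> ideal_power R I m"
      "v \<in> carrier R - p" "v \<otimes> b \<in> ideal_power R I m"
      using ab p unfolding symbolic_power_eq[OF I] by blast
    have "(u \<otimes> v) \<otimes> (a \<oplus> b) = v \<otimes> (u \<otimes> a) \<oplus> u \<otimes> (v \<otimes> b)"
      using uv car by (simp add: m_ac r_distr)
    moreover have "v \<otimes> (u \<otimes> a) \<oplus> u \<otimes> (v \<otimes> b) \<in> ideal_power R I m"
      using P.a_closed[OF P.I_l_closed[OF uv(2)] P.I_l_closed[OF uv(4)]] uv(1,3) by blast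
    ultimately show ?thesis using Ass_complement_mult[OF p uv(1,3)] by metis
  qed
  thus "a \<oplus> b \<in> symbolic_power R I m" using car by (simp add: symbolic_power_eq[OF I])
qed

lemma symbolic_power_zero:
  assumes "ideal I R"
  shows "symbolic_power R I 0 = carrier R"
  using ideal_power_subset_symbolic_power[OF assms, of 0]
    additive_subgroup.a_subset[OF ideal.axioms(1)[OF ideal_symbolic_power[OF assms, of 0]]] by auto

lemma ideal_subset_ideal_power_one:
  assumes "ideal I R"
  shows "I \<subseteq> ideal_power R I 1"
proof
  fix x assume x: "x \<in> I"
  hence "x \<otimes> \<one> \<in> ideal_prod R I (carrier R)" by (intro ideal_prod.prod) simp_all
  thus "x \<in> ideal_power R I 1" using ideal.Icarr[OF assms x] by simp
qed

end

section \<open>Ideals of graded rings\<close>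

context cring
begin

lemma ideal_finsum_closed:
  assumes "ideal J R" "finite S" "\<And>i. i \<in> S \<Longrightarrow> f i \<in> J"
  shows "finsum R f S \<in> J"
proof -
  interpret J: ideal J R by fact
  from assms(2,3) show ?thesis
  proof (induction S rule: finite_induct)
    case empty
    show ?case by simp
  next
    case (insert i S)
    have "f \<in> S \<rightarrow> carrier R" "f i \<in> carrier R" using insert.prems J.Icarr by auto
    thus ?case using insert by simp
  qed
qed

text \<open>
  With \<open>M = R\<close> this is the ideal generated by \<open>L\<close> and \<open>t\<close>, and with \<open>M = \<mm>\<close> it is \<open>L + \<mm> t\<close>. The former
  serves the exchange property, both serve Nakayama's lemma.
\<close>

lemma ideal_plus_multiples:
  assumes L: "ideal L R" and M: "ideal M R" and t: "t \<in> carrier R"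
  shows "ideal {l \<oplus> a \<otimes> t |l a. l \<in> L \<and> a \<in> M} R"
proof (rule idealI')
  interpret L: ideal L R by fact
  interpret M: ideal M R by fact
  show "{l \<oplus> a \<otimes> t |l a. l \<in> L \<and> a \<in> M} \<subseteq> carrier R"
    using L.Icarr M.Icarr t by auto
  have "\<zero> = \<zero> \<oplus> \<zero> \<otimes> t" using t by simp
  thus "\<zero> \<in> {l \<oplus> a \<otimes> t |l a. l \<in> L \<and> a \<in> M}"
    using L.zero_closed M.zero_closed by blast
next
  interpret L: ideal L R by fact
  interpret M: ideal M R by fact
  fix x y assume "x \<in> {l \<oplus> a \<otimes> t |l a. l \<in> L \<and> a \<in> M}" "y \<in> {l \<oplus> a \<otimes> t |l a. l \<in> L \<and> a \<in> M}"
  then obtain l a l' a' where x: "x = l \<oplus> a \<otimes> t" "l \<in> L" "a \<in> M" and y: "y = l' \<oplus> a' \<otimes> t" "l' \<in> L" "a' \<in> M"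
    by blast
  have "x \<oplus> y = (l \<oplus> l') \<oplus> (a \<oplus> a') \<otimes> t"
    unfolding x(1) y(1) using t L.Icarr[OF x(2)] L.Icarr[OF y(2)] M.Icarr[OF x(3)] M.Icarr[OF y(3)] by algebra
  thus "x \<oplus> y \<in> {l \<oplus> a \<otimes> t |l a. l \<in> L \<and> a \<in> M}"
    using L.a_closed[OF x(2) y(2)] M.a_closed[OF x(3) y(3)] by blast
next
  interpret L: ideal L R by fact
  interpret M: ideal M R by fact
  fix x r assume "x \<in> {l \<oplus> a \<otimes> t |l a. l \<in> L \<and> a \<in> M}" and r: "r \<in> carrier R"
  then obtain l a where x: "x = l \<oplus> a \<otimes> t" "l \<in> L" "a \<in> M" by blast
  have "r \<otimes> x = (r \<otimes> l) \<oplus> (r \<otimes> a) \<otimes> t"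
    unfolding x(1) using t r L.Icarr[OF x(2)] M.Icarr[OF x(3)] by algebra
  thus "r \<otimes> x \<in> {l \<oplus> a \<otimes> t |l a. l \<in> L \<and> a \<in> M}"
    using L.I_l_closed[OF x(2) r] M.I_l_closed[OF x(3) r] by blast
qed

lemma genideal_insert:
  assumes X: "X \<subseteq> carrier R" and t: "t \<in> carrier R"
  shows "Idl (insert t X) = {l \<oplus> a \<otimes> t |l a. l \<in> Idl X \<and> a \<in> carrier R}"
proof
  interpret X: ideal "Idl X" R by (rule genideal_ideal[OF X])
  have car: "insert t X \<subseteq> carrier R" using X t by blast
  interpret Y: ideal "Idl (insert t X)" R by (rule genideal_ideal[OF car])
  show "Idl (insert t X) \<subseteq> {l \<oplus> a \<otimes> t |l a. l \<in> Idl X \<and> a \<in> carrier R}"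
  proof (rule genideal_minimal[OF ideal_plus_multiples[OF X.ideal_axioms oneideal t]], rule subsetI)
    fix x assume "x \<in> insert t X"
    thus "x \<in> {l \<oplus> a \<otimes> t |l a. l \<in> Idl X \<and> a \<in> carrier R}"
    proof
      assume "x = t"
      hence "x = \<zero> \<oplus> \<one> \<otimes> t" using t by simp
      thus ?thesis using X.zero_closed one_closed by blast
    next
      assume "x \<in> X"
      hence "x \<in> Idl X" using genideal_self[OF X] by blast
      moreover have "x = x \<oplus> \<zero> \<otimes> t" using t X.Icarr[OF \<open>x \<in> Idl X\<close>] by simp
      ultimately show ?thesis using zero_closed by blast
    qed
  qed
  have "Idl X \<subseteq> Idl (insert t X)"
    using genideal_self[OF car] by (intro genideal_minimal[OF Y.ideal_axioms]) blast
  moreover have "t \<in> Idl (insert t X)" using genideal_self[OF car] by blast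
  ultimately show "{l \<oplus> a \<otimes> t |l a. l \<in> Idl X \<and> a \<in> carrier R} \<subseteq> Idl (insert t X)"
    using Y.a_closed Y.I_l_closed by blast
qed

end

lemma (in noetherian_ring) exists_maximal_ideal_in_family:
  assumes "F \<noteq> {}" "\<And>J. J \<in> F \<Longrightarrow> ideal J R"
  shows "\<exists>M\<in>F. \<forall>J\<in>F. M \<subseteq> J \<longrightarrow> J = M"
proof (rule subset_Zorn_nonempty[OF assms(1)])
  fix C assume C: "C \<noteq> {}" "subset.chain F C"
  have sub: "C \<subseteq> F" using C(2) by (rule subset_chain_def[THEN iffD1, THEN conjunct1])
  have "subset.chain {I. ideal I R} C"
    using C(2) sub assms(2) unfolding subset_chain_def by auto
  from ideal_chain_is_trivial[OF C(1) this] show "\<Union>C \<in> F" using sub by auto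
qed

locale graded_cring = cring R for R (structure) +
  fixes A :: "int \<Rightarrow> 'a set"
  assumes graded: "graded_ring R A"
begin

lemma A_subgroup: "additive_subgroup (A i) R"
  and A_mult: "\<lbrakk>x \<in> A i; y \<in> A j\<rbrakk> \<Longrightarrow> x \<otimes> y \<in> A (i + j)"
  using graded unfolding graded_ring_def by blast+

lemma A_carrier: "x \<in> A i \<Longrightarrow> x \<in> carrier R"
  using additive_subgroup.a_subset[OF A_subgroup] by blast

lemma A_zero: "\<zero> \<in> A i"
  by (rule additive_subgroup.zero_closed[OF A_subgroup])

lemma A_add: "\<lbrakk>x \<in> A i; y \<in> A i\<rbrakk> \<Longrightarrow> x \<oplus> y \<in> A i"
  by (rule additive_subgroup.a_closed[OF A_subgroup])

lemma A_neg: "x \<in> A i \<Longrightarrow> \<ominus> x \<in> A i"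
  by (rule additive_subgroup.a_inv_closed[OF A_subgroup])

text \<open>
  The homogeneous component of degree \<open>i\<close>; determined only for elements of the carrier.
\<close>

definition comp :: "'a \<Rightarrow> int \<Rightarrow> 'a" where
  "comp x = (THE f. (\<forall>i. f i \<in> A i) \<and> finite {i. f i \<noteq> \<zero>} \<and> x = finsum R f {i. f i \<noteq> \<zero>})"

definition supp :: "'a \<Rightarrow> int set" where
  "supp x = {i. comp x i \<noteq> \<zero>}"

lemma decomposition_ex1:
  "x \<in> carrier R \<Longrightarrow>
    \<exists>!f. (\<forall>i. f i \<in> A i) \<and> finite {i. f i \<noteq> \<zero>} \<and> x = finsum R f {i. f i \<noteq> \<zero>}"
  using graded unfolding graded_ring_def by blast

lemma decomposition:
  assumes "x \<in> carrier R"
  shows comp_mem: "comp x i \<in> A i"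
    and finite_supp: "finite (supp x)"
    and sum_comp: "x = finsum R (comp x) (supp x)"
  using theI'[OF decomposition_ex1[OF assms]] unfolding comp_def[symmetric] supp_def by blast+

lemma comp_closed [simp]: "x \<in> carrier R \<Longrightarrow> comp x i \<in> carrier R"
  using comp_mem A_carrier by blast

lemma comp_eqI:
  assumes f: "\<And>i. f i \<in> A i" and S: "finite S" "\<And>i. i \<notin> S \<Longrightarrow> f i = \<zero>"
    and x: "x = finsum R f S"
  shows "comp x = f"
proof -
  have car: "f \<in> S \<rightarrow> carrier R" using f A_carrier by blast
  hence "x \<in> carrier R" using x by simp
  have sub: "{i. f i \<noteq> \<zero>} \<subseteq> S" using S(2) by blast
  have "finsum R f {i. f i \<noteq> \<zero>} = finsum R f S"
    by (rule add.finprod_mono_neutral_cong_left[OF S(1) sub])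
       (use car in auto)
  hence "(\<forall>i. f i \<in> A i) \<and> finite {i. f i \<noteq> \<zero>} \<and> x = finsum R f {i. f i \<noteq> \<zero>}"
    using f x finite_subset[OF sub S(1)] by simp
  thus ?thesis
    unfolding comp_def using the1_equality[OF decomposition_ex1[OF \<open>x \<in> carrier R\<close>]] by blast
qed

lemma sum_comp_superset:
  assumes "x \<in> carrier R" "finite S" "supp x \<subseteq> S"
  shows "x = finsum R (comp x) S"
proof -
  have "finsum R (comp x) (supp x) = finsum R (comp x) S"
    by (rule add.finprod_mono_neutral_cong_left[OF assms(2,3)])
       (use assms(1) in \<open>auto simp: supp_def\<close>)
  thus ?thesis using sum_comp[OF assms(1)] by simp
qed

lemma comp_homogeneous:
  assumes "x \<in> A i"
  shows "comp x = (\<lambda>j. if j = i then x else \<zero>)"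
  by (rule comp_eqI[where S = "{i}"]) (use assms A_zero A_carrier in auto)

lemma comp_zero: "comp \<zero> i = \<zero>"
  by (simp add: comp_homogeneous[OF A_zero[of i]])

lemma comp_add:
  assumes "x \<in> carrier R" "y \<in> carrier R"
  shows "comp (x \<oplus> y) = (\<lambda>i. comp x i \<oplus> comp y i)"
proof (rule comp_eqI[where S = "supp x \<union> supp y"])
  let ?S = "supp x \<union> supp y"
  have fin: "finite ?S" using assms finite_supp by blast
  have "x = finsum R (comp x) ?S" "y = finsum R (comp y) ?S"
    using sum_comp_superset[OF _ fin] assms by blast+
  thus "x \<oplus> y = finsum R (\<lambda>i. comp x i \<oplus> comp y i) ?S"
    using finsum_addf[of "comp x" ?S "comp y"] assms by simp
qed (use assms finite_supp comp_mem A_add in \<open>auto simp: supp_def\<close>)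

lemma comp_homogeneous_mult:
  assumes a: "a \<in> A i" and x: "x \<in> carrier R"
  shows "comp (a \<otimes> x) = (\<lambda>j. a \<otimes> comp x (j - i))"
proof (rule comp_eqI[where S = "(\<lambda>j. j + i) ` supp x"])
  have a': "a \<in> carrier R" by (rule A_carrier[OF a])
  show "a \<otimes> comp x (j - i) \<in> A j" for j
    using A_mult[OF a comp_mem[OF x, of "j - i"]] by simp
  show "finite ((\<lambda>j. j + i) ` supp x)" using finite_supp[OF x] by simp
  show "a \<otimes> comp x (j - i) = \<zero>" if "j \<notin> (\<lambda>j. j + i) ` supp x" for j
  proof -
    have "j - i \<notin> supp x" using that by (metis diff_add_cancel imageI)
    thus ?thesis using a' by (simp add: supp_def)
  qed
  have "a \<otimes> x = a \<otimes> finsum R (comp x) (supp x)" using sum_comp[OF x] by simp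
  also have "\<dots> = finsum R (\<lambda>j. a \<otimes> comp x j) (supp x)"
    by (rule finsum_rdistr) (use finite_supp x a' in auto)
  also have "\<dots> = finsum R (\<lambda>j. a \<otimes> comp x (j - i)) ((\<lambda>j. j + i) ` supp x)"
    by (subst finsum_reindex) (use a' x in auto)
  finally show "a \<otimes> x = finsum R (\<lambda>j. a \<otimes> comp x (j - i)) ((\<lambda>j. j + i) ` supp x)" .
qed

lemma homogeneous_induct [consumes 1, case_names zero homogeneous add]:
  assumes x: "x \<in> carrier R" and zero: "P \<zero>"
    and hom: "\<And>i a. a \<in> A i \<Longrightarrow> P a"
    and add: "\<And>a b. \<lbrakk>a \<in> carrier R; b \<in> carrier R; P a; P b\<rbrakk> \<Longrightarrow> P (a \<oplus> b)"
  shows "P x"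
proof -
  have "P (finsum R (comp x) S)" if "finite S" for S
    using that
  proof (induction S rule: finite_induct)
    case empty
    show ?case using zero by simp
  next
    case (insert i S)
    have "comp x \<in> S \<rightarrow> carrier R" using x by auto
    thus ?case
      using add[OF _ _ hom[OF comp_mem[OF x]] insert.IH] insert.hyps x by simp
  qed
  thus ?thesis using sum_comp[OF x] finite_supp[OF x] by metis
qed

text \<open>
  Multiplication by the component \<open>e\<close> of \<open>\<one>\<close> of degree \<open>0\<close> fixes every homogeneous element, hence
  every element, so \<open>e = \<one>\<close>.
\<close>

lemma one_homogeneous: "\<one> \<in> A 0"
proof -
  define e where "e = comp \<one> 0"
  have e: "e \<in> carrier R" "e \<in> A 0" using comp_mem by (simp_all add: e_def)
  have "x \<otimes> e = x" if "x \<in> carrier R" for x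
    using that
  proof (induction rule: homogeneous_induct)
    case (homogeneous i a)
    have "a = comp (a \<otimes> \<one>) i"
      using comp_homogeneous[OF homogeneous] A_carrier[OF homogeneous] by simp
    also have "\<dots> = a \<otimes> e" by (simp add: comp_homogeneous_mult[OF homogeneous] e_def)
    finally show ?case by simp
  qed (use e in \<open>simp_all add: l_distr\<close>)
  from this[of \<one>] have "e = \<one>" using e(1) by simp
  thus ?thesis using e(2) by simp
qed

lemma power_homogeneous: "a \<in> A i \<Longrightarrow> a [^] n \<in> A (int n * i)"
proof (induction n)
  case (Suc n)
  have "a [^] n \<otimes> a \<in> A (int n * i + i)" by (rule A_mult) (use Suc in auto)
  thus ?case by (simp add: algebra_simps)
qed (simp add: one_homogeneous)

lemma comp_mult:
  assumes u: "u \<in> carrier R" and r: "r \<in> carrier R" and S: "finite S" "supp u \<subseteq> S"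
  shows "comp (u \<otimes> r) m = finsum R (\<lambda>k. comp u k \<otimes> comp r (m - k)) S"
proof -
  have "comp (finsum R (comp u) S \<otimes> r) m = finsum R (\<lambda>k. comp u k \<otimes> comp r (m - k)) S"
    using S(1)
  proof (induction S rule: finite_induct)
    case empty
    show ?case using r by (simp add: comp_zero)
  next
    case (insert k S)
    have "comp u \<in> S \<rightarrow> carrier R" "(\<lambda>k. comp u k \<otimes> comp r (m - k)) \<in> S \<rightarrow> carrier R"
      using u r by auto
    thus ?case
      using insert u r by (simp add: l_distr comp_add comp_homogeneous_mult[OF comp_mem[OF u]])
  qed
  thus ?thesis using sum_comp_superset[OF u S] by simp
qed

definition graded_ideal :: "'a set \<Rightarrow> bool" where
  "graded_ideal J \<longleftrightarrow> ideal J R \<and> (\<forall>x\<in>J. \<forall>i. comp x i \<in> J)"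

lemma ideal_all_comps:
  assumes J: "ideal J R"
  shows "ideal {x \<in> carrier R. \<forall>i. comp x i \<in> J} R"
proof (rule idealI')
  interpret J: ideal J R by fact
  show "\<zero> \<in> {x \<in> carrier R. \<forall>i. comp x i \<in> J}" by (simp add: comp_zero)
  show "a \<oplus> b \<in> {x \<in> carrier R. \<forall>i. comp x i \<in> J}"
    if "a \<in> {x \<in> carrier R. \<forall>i. comp x i \<in> J}" "b \<in> {x \<in> carrier R. \<forall>i. comp x i \<in> J}" for a b
    using that by (simp add: comp_add)
  show "y \<otimes> x \<in> {x \<in> carrier R. \<forall>i. comp x i \<in> J}"
    if "x \<in> {x \<in> carrier R. \<forall>i. comp x i \<in> J}" and y: "y \<in> carrier R" for x y
  proof -
    have x: "x \<in> carrier R" "\<And>i. comp x i \<in> J" using that by auto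
    have "comp (y \<otimes> x) m \<in> J" for m
      unfolding comp_mult[OF y x(1) finite_supp[OF y] order_refl]
      by (rule ideal_finsum_closed[OF J finite_supp[OF y]]) (use x y in \<open>simp add: J.I_l_closed\<close>)
    thus ?thesis using x(1) y by simp
  qed
qed blast

lemma graded_ideal_genideal:
  assumes S: "S \<subseteq> carrier R" and "\<And>x i. x \<in> S \<Longrightarrow> comp x i \<in> Idl S"
  shows "graded_ideal (Idl S)"
proof -
  interpret ideal "Idl S" R by (rule genideal_ideal[OF S])
  have "Idl S \<subseteq> {x \<in> carrier R. \<forall>i. comp x i \<in> Idl S}"
    by (rule genideal_minimal[OF ideal_all_comps[OF ideal_axioms]]) (use assms in auto)
  thus ?thesis unfolding graded_ideal_def using ideal_axioms by blast
qed

lemma graded_ideal_genideal_homogeneous: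
  assumes "S \<subseteq> (\<Union>i. A i)"
  shows "graded_ideal (Idl S)"
proof (rule graded_ideal_genideal)
  show S: "S \<subseteq> carrier R" using assms A_carrier by blast
  interpret ideal "Idl S" R by (rule genideal_ideal[OF S])
  fix x i assume x: "x \<in> S"
  then obtain j where "x \<in> A j" using assms by blast
  moreover have "x \<in> Idl S" using x genideal_self[OF S] by blast
  ultimately show "comp x i \<in> Idl S" by (simp add: comp_homogeneous)
qed

lemma homogeneous_ideal_iff: "homogeneous_ideal R A J \<longleftrightarrow> graded_ideal J"
proof
  assume "homogeneous_ideal R A J"
  hence "J = Idl (J \<inter> (\<Union>i. A i))" by (simp add: homogeneous_ideal_def)
  thus "graded_ideal J" using graded_ideal_genideal_homogeneous[of "J \<inter> (\<Union>i. A i)"] by simp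
next
  assume J: "graded_ideal J"
  hence id: "ideal J R" by (simp add: graded_ideal_def)
  interpret J: ideal J R by (rule id)
  have car: "J \<inter> (\<Union>i. A i) \<subseteq> carrier R" using J.a_subset by blast
  have "x \<in> Idl (J \<inter> (\<Union>i. A i))" if x: "x \<in> J" for x
  proof -
    have "comp x i \<in> Idl (J \<inter> (\<Union>i. A i))" for i
      using J x comp_mem[OF J.Icarr[OF x], of i] genideal_self[OF car]
      unfolding graded_ideal_def by blast
    hence "finsum R (comp x) (supp x) \<in> Idl (J \<inter> (\<Union>i. A i))"
      using ideal_finsum_closed[OF genideal_ideal[OF car] finite_supp[OF J.Icarr[OF x]], of "comp x"] by blast
    thus ?thesis using sum_comp[OF J.Icarr[OF x]] by simp
  qed
  moreover have "Idl (J \<inter> (\<Union>i. A i)) \<subseteq> J" by (rule genideal_minimal[OF id]) blast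
  ultimately show "homogeneous_ideal R A J" using id unfolding homogeneous_ideal_def by blast
qed

lemma graded_ideal_prod:
  assumes I: "graded_ideal I" and J: "graded_ideal J"
  shows "graded_ideal (ideal_prod R I J)"
proof -
  have ids: "ideal I R" "ideal J R" using assms by (auto simp: graded_ideal_def)
  interpret I: ideal I R by (rule ids)
  interpret J: ideal J R by (rule ids)
  interpret P: ideal "ideal_prod R I J" R by (rule ideal_prod_is_ideal[OF ids])
  have "comp x m \<in> ideal_prod R I J" if "x \<in> ideal_prod R I J" for x m
    using that
  proof (induction rule: ideal_prod.induct)
    case (prod i j)
    have car: "i \<in> carrier R" "j \<in> carrier R" using prod I.Icarr J.Icarr by auto
    show ?case unfolding comp_mult[OF car finite_supp[OF car(1)] order_refl]
      using prod I J unfolding graded_ideal_def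
      by (intro ideal_finsum_closed[OF P.ideal_axioms finite_supp[OF car(1)]] ideal_prod.prod) auto
  next
    case (sum x y)
    thus ?case using comp_add[OF P.Icarr[OF sum(1)] P.Icarr[OF sum(2)]] P.a_closed by simp
  qed
  thus ?thesis using P.ideal_axioms by (auto simp: graded_ideal_def)
qed

lemma graded_ideal_carrier: "graded_ideal (carrier R)"
  by (simp add: graded_ideal_def oneideal)

lemma graded_ideal_power:
  assumes "graded_ideal I"
  shows "graded_ideal (ideal_power R I m)"
  by (induction m) (simp_all add: graded_ideal_carrier graded_ideal_prod assms)

end

section \<open>Symbolic powers of homogeneous ideals\<close>

context graded_cring
begin

lemma nonmember_comps_homogeneous_mult:
  assumes N: "ideal N R" and a: "a \<in> A k" and r: "r \<in> carrier R"
  shows "{i. comp (a \<otimes> r) i \<notin> N} \<subseteq> (\<lambda>i. i + k) ` {i. comp r i \<notin> N}"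
proof
  fix i assume "i \<in> {i. comp (a \<otimes> r) i \<notin> N}"
  hence "a \<otimes> comp r (i - k) \<notin> N" by (simp add: comp_homogeneous_mult[OF a r])
  hence "comp r (i - k) \<notin> N" using ideal.I_l_closed[OF N _ A_carrier[OF a]] by blast
  thus "i \<in> (\<lambda>i. i + k) ` {i. comp r i \<notin> N}" by (intro image_eqI[of _ _ "i - k"]) auto
qed

lemma finite_nonmember_comps:
  assumes "ideal N R" "r \<in> carrier R"
  shows "finite {i. comp r i \<notin> N}"
proof (rule finite_subset[OF _ finite_supp[OF assms(2)]])
  interpret ideal N R by fact
  show "{i. comp r i \<notin> N} \<subseteq> supp r" unfolding supp_def using zero_closed by force
qed

text \<open>
  A weak form of the Dedekind-Mertens lemma, by induction on the number of components of \<open>u\<close> and of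
  components of \<open>r\<close> outside \<open>N\<close>. Let \<open>a\<close> be the top component of \<open>u\<close>. Its product with the
  top component of \<open>r\<close> outside \<open>N\<close> lies in \<open>N\<close>, so the induction hypothesis applies to \<open>u\<close> and
  \<open>a r\<close>. This settles the component \<open>a\<close> itself. For another component, a power \<open>b\<close> of it satisfies
  \<open>b a r \<in> N\<close>, whence \<open>(u - a) (b r) \<in> N\<close>, and \<open>u - a\<close> has fewer components than \<open>u\<close>.
\<close>

lemma power_comp_annihilates_comps:
  assumes N: "graded_ideal N" and "u \<in> carrier R" "r \<in> carrier R" "u \<otimes> r \<in> N"
  shows "\<exists>n::nat. \<forall>i. comp u j [^] n \<otimes> comp r i \<in> N"
  using assms(2-)
proof (induction "card (supp u) + card {i. comp r i \<notin> N}" arbitrary: u r j rule: less_induct)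
  case less
  note u = less.prems(1) and r = less.prems(2)
  have idN: "ideal N R" using N by (simp add: graded_ideal_def)
  interpret N: ideal N R by (rule idN)
  have comps: "comp x i \<in> N" if "x \<in> N" for x i using N that by (simp add: graded_ideal_def)
  define T where "T = {i. comp r i \<notin> N}"
  have finT: "finite T" unfolding T_def by (rule finite_nonmember_comps[OF idN r])
  show ?case
  proof (cases "T = {} \<or> supp u = {}")
    case True
    thus ?thesis
    proof
      assume "T = {}"
      hence "\<forall>i. comp u j [^] (0::nat) \<otimes> comp r i \<in> N" using r by (simp add: T_def)
      thus ?thesis by blast
    next
      assume "supp u = {}"
      hence "\<forall>i. comp u j [^] (1::nat) \<otimes> comp r i \<in> N" using r by (simp add: supp_def)
      thus ?thesis by blast
    qed
  next
    case False
    define e where "e = Max (supp u)"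
    define t where "t = Max T"
    define a where "a = comp u e"
    have e: "e \<in> supp u" "\<And>k. k \<in> supp u \<Longrightarrow> k \<le> e"
      using False finite_supp[OF u] unfolding e_def by auto
    have t: "t \<in> T" "\<And>i. i \<in> T \<Longrightarrow> i \<le> t"
      using False finT unfolding t_def by auto
    have aA: "a \<in> A e" and a: "a \<in> carrier R"
      unfolding a_def using comp_mem[OF u] u by auto
    \<comment> \<open>in degree \<open>e + t\<close> all products but the one of the top components lie in \<open>N\<close>\<close>
    have top: "a \<otimes> comp r t \<in> N"
    proof -
      let ?f = "\<lambda>k. comp u k \<otimes> comp r (e + t - k)"
      have f: "?f \<in> supp u - {e} \<rightarrow> carrier R" "?f e \<in> carrier R" using u r by auto
      have "finsum R ?f (insert e (supp u - {e})) = ?f e \<oplus> finsum R ?f (supp u - {e})"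
        by (rule finsum_insert) (use finite_supp[OF u] f in auto)
      hence "comp (u \<otimes> r) (e + t) = a \<otimes> comp r t \<oplus> finsum R ?f (supp u - {e})"
        unfolding comp_mult[OF u r finite_supp[OF u] order_refl] insert_Diff[OF e(1)] a_def by simp
      moreover have rest: "finsum R ?f (supp u - {e}) \<in> N"
      proof (rule ideal_finsum_closed[OF idN])
        fix k assume k: "k \<in> supp u - {e}"
        hence "k < e" using e(2)[of k] by auto
        hence "e + t - k \<notin> T" using t(2)[of "e + t - k"] by auto
        thus "?f k \<in> N" using N.I_l_closed u by (simp add: T_def)
      qed (use finite_supp[OF u] in simp)
      moreover have "comp (u \<otimes> r) (e + t) \<in> N" by (rule comps[OF less.prems(3)])
      ultimately have "(a \<otimes> comp r t \<oplus> finsum R ?f (supp u - {e})) \<oplus> \<ominus> finsum R ?f (supp u - {e}) \<in> N"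
        using N.a_closed N.a_inv_closed by simp
      moreover have "(a \<otimes> comp r t \<oplus> finsum R ?f (supp u - {e})) \<oplus> \<ominus> finsum R ?f (supp u - {e})
          = a \<otimes> comp r t"
        using a r N.Icarr[OF rest] by (simp add: a_assoc r_neg)
      ultimately show ?thesis by simp
    qed
    have ar: "a \<otimes> r \<in> carrier R" using a r by simp
    have comp_ar: "comp (a \<otimes> r) (i + e) = a \<otimes> comp r i" for i
      by (simp add: comp_homogeneous_mult[OF aA r])
    have "{i. comp (a \<otimes> r) i \<notin> N} \<subseteq> (\<lambda>i. i + e) ` (T - {t})"
    proof
      fix i assume i: "i \<in> {i. comp (a \<otimes> r) i \<notin> N}"
      then obtain i' where i': "i = i' + e" "i' \<in> T"
        using nonmember_comps_homogeneous_mult[OF idN aA r] unfolding T_def by blast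
      have "i' \<noteq> t" using i top comp_ar[of t] unfolding i'(1) by auto
      thus "i \<in> (\<lambda>i. i + e) ` (T - {t})" using i' by blast
    qed
    hence "card {i. comp (a \<otimes> r) i \<notin> N} \<le> card ((\<lambda>i. i + e) ` (T - {t}))"
      by (rule card_mono[rotated]) (simp add: finT)
    also have "\<dots> \<le> card (T - {t})" by (rule card_image_le) (simp add: finT)
    also have "\<dots> < card T" by (rule card_Diff1_less[OF finT t(1)])
    finally have smaller_r: "card {i. comp (a \<otimes> r) i \<notin> N} < card T" .
    have "u \<otimes> (a \<otimes> r) = a \<otimes> (u \<otimes> r)" using a u r by algebra
    hence "u \<otimes> (a \<otimes> r) \<in> N" using N.I_l_closed[OF less.prems(3) a] by simp
    from less.hyps[OF _ u ar this] smaller_r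
    obtain n :: nat where "\<And>i. comp u j [^] n \<otimes> comp (a \<otimes> r) i \<in> N"
      unfolding T_def by auto
    hence n: "comp u j [^] n \<otimes> (a \<otimes> comp r i) \<in> N" for i using comp_ar by metis
    show ?thesis
    proof (cases "j = e")
      case True
      have "comp u j [^] Suc n \<otimes> comp r i = comp u j [^] n \<otimes> (a \<otimes> comp r i)" for i
        unfolding a_def True using u r by (simp add: m_assoc)
      hence "\<forall>i. comp u j [^] Suc n \<otimes> comp r i \<in> N" using n by simp
      thus ?thesis by blast
    next
      case False
      define b where "b = comp u j [^] n"
      have bA: "b \<in> A (int n * j)" unfolding b_def by (rule power_homogeneous[OF comp_mem[OF u]])
      have b: "b \<in> carrier R" by (rule A_carrier[OF bA])
      have comp_br: "comp (b \<otimes> r) (i + int n * j) = b \<otimes> comp r i" for i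
        by (simp add: comp_homogeneous_mult[OF bA r])
      have "card {i. comp (b \<otimes> r) i \<notin> N} \<le> card ((\<lambda>i. i + int n * j) ` T)"
        by (rule card_mono[OF _ nonmember_comps_homogeneous_mult[OF idN bA r, folded T_def]])
           (simp add: finT)
      also have "\<dots> \<le> card T" by (rule card_image_le[OF finT])
      finally have le_r: "card {i. comp (b \<otimes> r) i \<notin> N} \<le> card T" .
      define u' where "u' = u \<oplus> \<ominus> a"
      have u': "u' \<in> carrier R" using u a by (simp add: u'_def)
      have comp_u': "comp u' k = (if k = e then \<zero> else comp u k)" for k
        unfolding u'_def comp_add[OF u a_inv_closed[OF a]] comp_homogeneous[OF A_neg[OF aA]]
        using u by (simp add: a_def r_neg)
      have "supp u' = supp u - {e}" unfolding supp_def comp_u' by auto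
      hence smaller_u: "card (supp u') < card (supp u)"
        using card_Diff1_less[OF finite_supp[OF u] e(1)] by simp
      have bar: "b \<otimes> (a \<otimes> r) \<in> N"
      proof -
        have eq: "b \<otimes> a \<otimes> r = finsum R (\<lambda>i. (b \<otimes> a) \<otimes> comp r i) (supp r)"
          using finsum_rdistr[OF finite_supp[OF r], of "b \<otimes> a" "comp r"] sum_comp[OF r] a b r by simp
        have "finsum R (\<lambda>i. (b \<otimes> a) \<otimes> comp r i) (supp r) \<in> N"
          by (rule ideal_finsum_closed[OF idN finite_supp[OF r]])
             (use n a b r in \<open>simp add: m_assoc b_def\<close>)
        hence "b \<otimes> a \<otimes> r \<in> N" using eq by simp
        thus ?thesis using a b r by (simp add: m_assoc)
      qed
      have "u' \<otimes> (b \<otimes> r) = b \<otimes> (u \<otimes> r) \<oplus> \<ominus> (b \<otimes> (a \<otimes> r))"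
        unfolding u'_def using u a b r by algebra
      also have "\<dots> \<in> N"
        by (intro N.a_closed N.a_inv_closed bar N.I_l_closed[OF less.prems(3) b])
      finally have "u' \<otimes> (b \<otimes> r) \<in> N" .
      from less.hyps[OF _ u' _ this, of j] smaller_u le_r b r
      obtain n' :: nat where "\<And>i. comp u' j [^] n' \<otimes> comp (b \<otimes> r) i \<in> N"
        unfolding T_def by auto
      hence n': "comp u j [^] n' \<otimes> (b \<otimes> comp r i) \<in> N" for i
        using comp_br comp_u'[of j] False by metis
      have "comp u j [^] (n' + n) \<otimes> comp r i = comp u j [^] n' \<otimes> (b \<otimes> comp r i)" for i
        unfolding b_def using u r by (simp add: nat_pow_mult[symmetric] m_assoc)
      hence "\<forall>i. comp u j [^] (n' + n) \<otimes> comp r i \<in> N" using n' by simp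
      thus ?thesis by blast
    qed
  qed
qed

lemma prime_power_nonmember:
  assumes "primeideal p R" "a \<in> carrier R" "a \<notin> p"
  shows "a [^] (n::nat) \<in> carrier R - p"
proof -
  interpret p: primeideal p R by fact
  show ?thesis
  proof (induction n)
    case 0
    show ?case using p.one_imp_carrier p.I_notcarr by auto
  next
    case (Suc n)
    thus ?case using p.I_prime[of "a [^] n" a] assms(2,3) by auto
  qed
qed

text \<open>
  If \<open>u \<notin> p\<close> carries \<open>x\<close> into \<open>I\<^sup>m\<close>, some component of \<open>u\<close> is not in \<open>p\<close>, and a power of it carries
  each component of \<open>x\<close> into \<open>I\<^sup>m\<close> and still lies outside \<open>p\<close>.
\<close>

lemma graded_symbolic_power:
  assumes I: "graded_ideal I"
  shows "graded_ideal (symbolic_power R I m)"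
proof -
  have id: "ideal I R" using I by (simp add: graded_ideal_def)
  interpret J: ideal "symbolic_power R I m" R by (rule ideal_symbolic_power[OF id])
  have "comp x i \<in> symbolic_power R I m" if x: "x \<in> symbolic_power R I m" for x i
  proof -
    have xc: "x \<in> carrier R" by (rule J.Icarr[OF x])
    have "\<exists>w\<in>carrier R - p. w \<otimes> comp x i \<in> ideal_power R I m" if p: "p \<in> Ass R I" for p
    proof -
      interpret p: primeideal p R by (rule Ass_prime[OF p])
      obtain u where u: "u \<in> carrier R" "u \<notin> p" "u \<otimes> x \<in> ideal_power R I m"
        using x p unfolding symbolic_power_eq[OF id] by blast
      have "\<exists>j. comp u j \<notin> p"
      proof (rule ccontr)
        assume "\<not> ?thesis"
        hence "finsum R (comp u) (supp u) \<in> p"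
          by (intro ideal_finsum_closed[OF p.ideal_axioms finite_supp[OF u(1)]]) blast
        thus False using sum_comp[OF u(1)] u(2) by simp
      qed
      then obtain j where j: "comp u j \<notin> p" by blast
      obtain n :: nat where "comp u j [^] n \<otimes> comp x i \<in> ideal_power R I m"
        using power_comp_annihilates_comps[OF graded_ideal_power[OF I] u(1) xc u(3)] by blast
      thus ?thesis using prime_power_nonmember[OF Ass_prime[OF p] comp_closed[OF u(1)] j] by blast
    qed
    thus ?thesis using xc unfolding symbolic_power_eq[OF id] by simp
  qed
  thus ?thesis using J.ideal_axioms by (auto simp: graded_ideal_def)
qed

end

section \<open>Graded-local rings and Nakayama's lemma\<close>

locale noetherian_graded_local = graded_cring R A + noetherian_ring R for R (structure) and A +
  fixes \<mm> :: "'a set"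
  assumes graded_local: "graded_local_ring R A \<mm>"
begin

lemma maximalideal_mm: "maximalideal \<mm> R"
  and graded_mm: "graded_ideal \<mm>"
  using graded_local homogeneous_ideal_iff
  unfolding graded_local_ring_def maximal_homogeneous_ideal_def by blast+

lemma proper_graded_ideal_subset_mm:
  assumes "graded_ideal J" "J \<noteq> carrier R"
  shows "J \<subseteq> \<mm>"
proof -
  define F where "F = {K. graded_ideal K \<and> K \<noteq> carrier R \<and> J \<subseteq> K}"
  have "F \<noteq> {}" "\<And>K. K \<in> F \<Longrightarrow> ideal K R"
    using assms by (auto simp: F_def graded_ideal_def)
  then obtain M where M: "M \<in> F" "\<And>K. K \<in> F \<Longrightarrow> M \<subseteq> K \<Longrightarrow> K = M"
    using exists_maximal_ideal_in_family[of F] by blast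
  have "maximal_homogeneous_ideal R A M"
    unfolding maximal_homogeneous_ideal_def homogeneous_ideal_iff
  proof (intro conjI allI impI)
    fix K assume K: "graded_ideal K \<and> M \<subseteq> K"
    show "K = M \<or> K = carrier R" using M(2)[of K] M(1) K unfolding F_def by blast
  qed (use M(1) in \<open>auto simp: F_def\<close>)
  hence "M = \<mm>" using graded_local unfolding graded_local_ring_def by blast
  thus ?thesis using M(1) by (simp add: F_def)
qed

lemma degree_zero_unit:
  assumes "u \<in> A 0" "u \<notin> \<mm>"
  shows "\<exists>v\<in>carrier R. v \<otimes> u = \<one>"
proof -
  have u: "u \<in> carrier R" by (rule A_carrier[OF assms(1)])
  have "graded_ideal (Idl {u})"
    by (rule graded_ideal_genideal_homogeneous) (use assms(1) in blast)
  moreover have "u \<in> Idl {u}" using genideal_self[of "{u}"] u by blast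
  ultimately have "Idl {u} = carrier R" using proper_graded_ideal_subset_mm assms(2) by blast
  hence "\<one> \<in> PIdl u" using cgenideal_eq_genideal[OF u] by simp
  thus ?thesis unfolding cgenideal_def by auto
qed

text \<open>
  Otherwise let \<open>M\<close> be maximal among the homogeneous ideals that contain \<open>L\<close> and lie properly inside
  \<open>J\<close>, and let \<open>t\<close> be a homogeneous element of \<open>J\<close> outside \<open>M\<close>. By maximality \<open>J = M + R t\<close>, hence
  \<open>J = M + \<mm> t\<close> and \<open>t = l + a t\<close> with \<open>l \<in> M\<close>, \<open>a \<in> \<mm>\<close>. In the component of the degree of \<open>t\<close> only
  the component \<open>a0\<close> of \<open>a\<close> of degree \<open>0\<close> matters, and \<open>1 - a0\<close> is a unit: it is homogeneous and not
  in \<open>\<mm>\<close>. So \<open>t \<in> M\<close>.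
\<close>

theorem graded_nakayama:
  assumes L: "graded_ideal L" and J: "graded_ideal J" "L \<subseteq> J"
    and gen: "J \<subseteq> Idl (L \<union> ideal_prod R \<mm> J)"
  shows "J = L"
proof (rule ccontr)
  assume "J \<noteq> L"
  interpret mm: maximalideal \<mm> R by (rule maximalideal_mm)
  interpret J: ideal J R using J by (simp add: graded_ideal_def)
  define F where "F = {K. graded_ideal K \<and> L \<subseteq> K \<and> K \<subset> J}"
  have "L \<in> F" unfolding F_def using L J(2) \<open>J \<noteq> L\<close> by simp
  hence "F \<noteq> {}" by blast
  moreover have "ideal K R" if "K \<in> F" for K using that unfolding F_def graded_ideal_def by simp
  ultimately have "\<exists>M\<in>F. \<forall>K\<in>F. M \<subseteq> K \<longrightarrow> K = M" by (rule exists_maximal_ideal_in_family)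
  then obtain M where MF: "M \<in> F" and max: "\<And>K. K \<in> F \<Longrightarrow> M \<subseteq> K \<Longrightarrow> K = M" by blast
  from MF have M: "graded_ideal M" "L \<subseteq> M" "M \<subset> J" by (simp_all add: F_def)
  interpret M: ideal M R using M by (simp add: graded_ideal_def)
  obtain x where x: "x \<in> J" "x \<notin> M" using M(3) by blast
  have xc: "x \<in> carrier R" by (rule J.Icarr[OF x(1)])
  have "\<exists>j. comp x j \<notin> M"
  proof (rule ccontr)
    assume "\<not> ?thesis"
    hence "finsum R (comp x) (supp x) \<in> M"
      by (intro ideal_finsum_closed[OF M.ideal_axioms finite_supp[OF xc]]) blast
    thus False using sum_comp[OF xc] x(2) by simp
  qed
  then obtain j where j: "comp x j \<notin> M" by blast
  define t where "t = comp x j"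
  have t: "t \<in> J" "t \<notin> M" "t \<in> A j" "t \<in> carrier R"
    using J(1) x(1) j comp_mem[OF xc] xc by (auto simp: t_def graded_ideal_def)
  have Mt: "M \<subseteq> carrier R" "insert t M \<subseteq> carrier R" using M.a_subset t(4) by auto
  interpret K: ideal "Idl (insert t M)" R by (rule genideal_ideal[OF Mt(2)])
  have K_self: "insert t M \<subseteq> Idl (insert t M)" by (rule genideal_self[OF Mt(2)])
  have gradedK: "graded_ideal (Idl (insert t M))"
  proof (rule graded_ideal_genideal[OF Mt(2)])
    fix y i assume "y \<in> insert t M"
    thus "comp y i \<in> Idl (insert t M)"
    proof
      assume "y = t"
      thus ?thesis using K_self by (simp add: comp_homogeneous[OF t(3)])
    next
      assume "y \<in> M"
      thus ?thesis using M(1) K_self unfolding graded_ideal_def by blast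
    qed
  qed
  have KJ: "Idl (insert t M) \<subseteq> J"
    by (rule genideal_minimal[OF J.ideal_axioms]) (use t(1) M(3) in blast)
  have K_eq: "Idl (insert t M) = J"
  proof (rule ccontr)
    assume "Idl (insert t M) \<noteq> J"
    moreover have "L \<subseteq> Idl (insert t M)" using M(2) K_self by blast
    ultimately have "Idl (insert t M) \<in> F"
      unfolding F_def mem_Collect_eq psubset_eq using gradedK KJ by (intro conjI)
    moreover have "M \<subseteq> Idl (insert t M)" using K_self by simp
    ultimately have "Idl (insert t M) = M" by (rule max)
    thus False using K_self t(2) by simp
  qed
  have "Idl M \<subseteq> M" by (rule genideal_minimal[OF M.ideal_axioms order_refl])
  hence "Idl M = M" using genideal_self[OF Mt(1)] by (rule equalityI)
  hence J_eq: "J = {l \<oplus> a \<otimes> t |l a. l \<in> M \<and> a \<in> carrier R}"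
    using genideal_insert[OF Mt(1) t(4)] unfolding K_eq by (simp only:)
  let ?K = "{l \<oplus> a \<otimes> t |l a. l \<in> M \<and> a \<in> \<mm>}"
  interpret K': ideal ?K R by (rule ideal_plus_multiples[OF M.ideal_axioms mm.ideal_axioms t(4)])
  have "ideal_prod R \<mm> J \<subseteq> ?K"
  proof
    fix y assume "y \<in> ideal_prod R \<mm> J"
    thus "y \<in> ?K"
    proof (induction rule: ideal_prod.induct)
      case (prod a y)
      then obtain l b where y: "y = l \<oplus> b \<otimes> t" "l \<in> M" "b \<in> carrier R" unfolding J_eq by blast
      have ac: "a \<in> carrier R" by (rule mm.Icarr[OF prod(1)])
      have "a \<otimes> y = a \<otimes> l \<oplus> (a \<otimes> b) \<otimes> t"
        unfolding y(1) using ac M.Icarr[OF y(2)] y(3) t(4) by algebra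
      thus ?case using M.I_l_closed[OF y(2) ac] mm.I_r_closed[OF prod(1) y(3)] by blast
    next
      case (sum y z)
      thus ?case using K'.a_closed by blast
    qed
  qed
  moreover have "L \<subseteq> ?K"
  proof
    fix l assume "l \<in> L"
    hence l: "l \<in> M" using M(2) by blast
    have "l = l \<oplus> \<zero> \<otimes> t" using M.Icarr[OF l] t(4) by simp
    thus "l \<in> ?K" using l mm.zero_closed by blast
  qed
  ultimately have "Idl (L \<union> ideal_prod R \<mm> J) \<subseteq> ?K"
    by (intro genideal_minimal[OF K'.ideal_axioms]) blast
  hence "t \<in> ?K" using t(1) gen by blast
  then obtain l a where la: "t = l \<oplus> a \<otimes> t" "l \<in> M" "a \<in> \<mm>" by blast
  define a0 where "a0 = comp a 0"
  have ac: "a \<in> carrier R" by (rule mm.Icarr[OF la(3)])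
  have lc: "l \<in> carrier R" by (rule M.Icarr[OF la(2)])
  have a0: "a0 \<in> \<mm>" "a0 \<in> A 0" "a0 \<in> carrier R"
    using graded_mm la(3) comp_mem[OF ac] ac unfolding a0_def graded_ideal_def by auto
  have lj: "comp l j \<in> M" "comp l j \<in> carrier R"
    using M(1) la(2) lc unfolding graded_ideal_def by auto
  have t_eq: "t = comp l j \<oplus> t \<otimes> a0"
  proof -
    have "comp t j = comp (l \<oplus> a \<otimes> t) j" by (rule arg_cong[OF la(1), of "\<lambda>x. comp x j"])
    moreover have "comp (l \<oplus> a \<otimes> t) j = comp l j \<oplus> comp (t \<otimes> a) j"
      unfolding m_comm[OF ac t(4)] comp_add[OF lc m_closed[OF t(4) ac]] ..
    moreover have "comp t j = t" unfolding comp_homogeneous[OF t(3)] by simp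
    moreover have "comp (t \<otimes> a) j = t \<otimes> a0" unfolding comp_homogeneous_mult[OF t(3) ac] a0_def by simp
    ultimately show ?thesis by (simp only:)
  qed
  define u where "u = \<one> \<oplus> \<ominus> a0"
  have uA: "u \<in> A 0" unfolding u_def by (rule A_add[OF one_homogeneous A_neg[OF a0(2)]])
  have "u \<notin> \<mm>"
  proof
    assume "u \<in> \<mm>"
    hence "u \<oplus> a0 \<in> \<mm>" using a0(1) mm.a_closed by blast
    moreover have "u \<oplus> a0 = \<one>" unfolding u_def using a0(3) by algebra
    ultimately show False using mm.one_imp_carrier mm.I_notcarr by simp
  qed
  from degree_zero_unit[OF uA this] obtain v where v: "v \<in> carrier R" "v \<otimes> u = \<one>" ..
  have "u \<otimes> t = t \<oplus> \<ominus> (t \<otimes> a0)" unfolding u_def using t(4) a0(3) by algebra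
  moreover have "(comp l j \<oplus> t \<otimes> a0) \<oplus> \<ominus> (t \<otimes> a0) = comp l j" using lj(2) t(4) a0(3) by algebra
  ultimately have "u \<otimes> t = comp l j" unfolding t_eq[symmetric] by (rule trans)
  hence "u \<otimes> t \<in> M" using lj(1) by simp
  hence "v \<otimes> (u \<otimes> t) \<in> M" using M.I_l_closed v(1) by blast
  moreover have "v \<otimes> (u \<otimes> t) = t"
    using v t(4) A_carrier[OF uA] by (simp add: m_assoc[symmetric])
  ultimately show False using t(2) by simp
qed

end

text \<open>
  A local ring is graded-local for the grading concentrated in degree \<open>0\<close>, in which every ideal
  is homogeneous.
\<close>

definition trivial_grading :: "('a, 'b) ring_scheme \<Rightarrow> int \<Rightarrow> 'a set" where
  "trivial_grading R i = (if i = 0 then carrier R else {\<zero>\<^bsub>R\<^esub>})"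

lemma (in cring) graded_ring_trivial_grading: "graded_ring R (trivial_grading R)"
  unfolding graded_ring_def
proof (intro conjI allI ballI)
  show "additive_subgroup (trivial_grading R i) R" for i
    using ideal.axioms(1)[OF oneideal] ideal.axioms(1)[OF zeroideal]
    by (simp add: trivial_grading_def)
  show "x \<otimes> y \<in> trivial_grading R (i + j)"
    if "x \<in> trivial_grading R i" "y \<in> trivial_grading R j" for i j x y
    using that by (auto simp: trivial_grading_def split: if_splits)
  fix x assume x: "x \<in> carrier R"
  define f where "f i = (if i = 0 then x else \<zero>)" for i :: int
  have sum0: "finsum R h {i. h i \<noteq> \<zero>} = h 0"
    if h: "\<And>i. h i \<in> trivial_grading R i" for h :: "int \<Rightarrow> 'a"
  proof -
    have hc: "h 0 \<in> carrier R" using h[of 0] by (simp add: trivial_grading_def)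
    have hz: "h i = \<zero>" if "i \<noteq> 0" for i using h[of i] that by (simp add: trivial_grading_def)
    show ?thesis
    proof (cases "h 0 = \<zero>")
      case True
      hence "{i. h i \<noteq> \<zero>} = {}" using hz by (metis (mono_tags) empty_Collect_eq)
      thus ?thesis using True by simp
    next
      case False
      hence "{i. h i \<noteq> \<zero>} = {0}" using hz by auto
      thus ?thesis using hc by simp
    qed
  qed
  show "\<exists>!h. (\<forall>i. h i \<in> trivial_grading R i) \<and> finite {i. h i \<noteq> \<zero>} \<and> x = finsum R h {i. h i \<noteq> \<zero>}"
  proof (rule ex1I[of _ f])
    have f: "\<And>i. f i \<in> trivial_grading R i" using x by (simp add: f_def trivial_grading_def)
    have "finite {i. f i \<noteq> \<zero>}" by (rule finite_subset[of _ "{0}"]) (auto simp: f_def)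
    moreover have "f 0 = x" by (simp add: f_def)
    ultimately show "(\<forall>i. f i \<in> trivial_grading R i) \<and> finite {i. f i \<noteq> \<zero>} \<and> x = finsum R f {i. f i \<noteq> \<zero>}"
      using f sum0[of f, OF f] by simp
  next
    fix h assume h: "(\<forall>i. h i \<in> trivial_grading R i) \<and> finite {i. h i \<noteq> \<zero>} \<and> x = finsum R h {i. h i \<noteq> \<zero>}"
    hence "x = h 0" using sum0[of h] by simp
    moreover have "h i = \<zero>" if "i \<noteq> 0" for i using h that by (metis singletonD trivial_grading_def)
    ultimately show "h = f" by (auto simp: f_def)
  qed
qed (rule is_cring)

lemma (in cring) homogeneous_ideal_trivial_grading:
  "homogeneous_ideal R (trivial_grading R) J \<longleftrightarrow> ideal J R"
proof
  assume J: "ideal J R"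
  interpret ideal J R by (rule J)
  have "carrier R \<subseteq> (\<Union>i. trivial_grading R i)"
    by (rule UN_upper[of 0, THEN subset_trans[rotated]]) (simp_all add: trivial_grading_def)
  hence "J \<inter> (\<Union>i. trivial_grading R i) = J" using a_subset by blast
  moreover have "Idl J = J"
    using genideal_minimal[OF J order_refl] genideal_self[OF a_subset] by blast
  ultimately show "homogeneous_ideal R (trivial_grading R) J"
    using J by (simp add: homogeneous_ideal_def)
qed (simp add: homogeneous_ideal_def)

lemma local_ring_is_graded_local:
  assumes "local_ring R \<mm>"
  shows "graded_local_ring R (trivial_grading R) \<mm>"
proof -
  interpret cring R using assms by (simp add: local_ring_def)
  have max: "maximal_homogeneous_ideal R (trivial_grading R) J \<longleftrightarrow> maximalideal J R" for J
  proof
    assume J: "maximal_homogeneous_ideal R (trivial_grading R) J"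
    show "maximalideal J R"
      by (rule maximalidealI)
         (use J in \<open>auto simp: maximal_homogeneous_ideal_def homogeneous_ideal_trivial_grading\<close>)
  next
    assume "maximalideal J R"
    then interpret J: maximalideal J R .
    show "maximal_homogeneous_ideal R (trivial_grading R) J"
      unfolding maximal_homogeneous_ideal_def homogeneous_ideal_trivial_grading
    proof (intro conjI allI impI J.ideal_axioms)
      show "J \<noteq> carrier R" using J.I_notcarr by blast
      fix K assume K: "ideal K R \<and> J \<subseteq> K"
      have "K \<subseteq> carrier R" using K additive_subgroup.a_subset[OF ideal.axioms(1)] by blast
      thus "K = J \<or> K = carrier R" using J.I_maximal K by blast
    qed
  qed
  show ?thesis
    using assms unfolding graded_local_ring_def max local_ring_def
    by (auto intro: graded_ring_trivial_grading)
qed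

section \<open>Ideals generated by monomials\<close>

text \<open>
  Exponent vectors are lists as long as the list of generators, so that inductions on the number of
  variables are inductions on lists and the order of lists is the lexicographic monomial order.
\<close>

primrec monomial :: "('a, 'b) ring_scheme \<Rightarrow> 'a list \<Rightarrow> nat list \<Rightarrow> 'a" where
  "monomial R [] a = \<one>\<^bsub>R\<^esub>"
| "monomial R (c # cs) a = c [^]\<^bsub>R\<^esub> hd a \<otimes>\<^bsub>R\<^esub> monomial R cs (tl a)"

definition exponents :: "nat list \<Rightarrow> nat \<Rightarrow> nat list set" where
  "exponents ds k = {a. length a = length ds \<and> weighted_degree ds a = k}"

lemma finite_exponents: "\<forall>d\<in>set ds. 0 < d \<Longrightarrow> finite (exponents ds k)"
  unfolding exponents_def by (rule finite_weighted_degree)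

lemma weighted_degree_add:
  assumes "length a = length ds" "length c = length ds"
  shows "weighted_degree ds (map2 (+) a c) = weighted_degree ds a + weighted_degree ds c"
proof -
  have "length a = length c" "length c = length ds" using assms by simp_all
  thus ?thesis by (induction a c ds rule: list_induct3) (simp_all add: algebra_simps)
qed

lemma exponents_add:
  assumes "a \<in> exponents ds k" "c \<in> exponents ds l"
  shows "map2 (+) a c \<in> exponents ds (k + l)"
  using assms weighted_degree_add[of a ds c] unfolding exponents_def by simp

text \<open>
  The lexicographic order is a monomial order; on lists of different lengths this would fail.
\<close>

lemma lex_less_add:
  fixes a b c :: "nat list"
  assumes "length b = length a" "length a = length c" "b < a"
  shows "map2 (+) b c < map2 (+) a c"
  using assms by (induction b a c rule: list_induct3) auto

lemma list_all2_le_imp_add: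
  fixes a b :: "nat list"
  assumes "list_all2 (\<le>) a b"
  shows "\<exists>c. length c = length a \<and> b = map2 (+) a c"
  using assms
proof (induction rule: list_all2_induct)
  case (Cons x xs y ys)
  then obtain c where c: "length c = length xs" "ys = map2 (+) xs c" by blast
  have "length ((y - x) # c) = length (x # xs) \<and> y # ys = map2 (+) (x # xs) ((y - x) # c)"
    using Cons.hyps(1) c(1) unfolding c(2) by simp
  thus ?case by (rule exI)
qed simp

context cring
begin

lemma monomial_closed:
  "\<lbrakk>set cs \<subseteq> carrier R; length a = length cs\<rbrakk> \<Longrightarrow> monomial R cs a \<in> carrier R"
proof (induction cs arbitrary: a)
  case (Cons c cs)
  then obtain k b where "a = k # b" by (cases a) auto
  thus ?case using Cons by simp
qed simp

lemma monomial_add: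
  assumes "set cs \<subseteq> carrier R" "length a = length cs" "length b = length cs"
  shows "monomial R cs (map2 (+) a b) = monomial R cs a \<otimes> monomial R cs b"
proof -
  have "length a = length b" "length b = length cs" using assms by simp_all
  thus ?thesis using assms(1)
  proof (induction a b cs rule: list_induct3)
    case (Cons k a l b c cs)
    have car: "c \<in> carrier R" "monomial R cs a \<in> carrier R" "monomial R cs b \<in> carrier R"
      using Cons by (auto intro!: monomial_closed)
    have "c [^] (k + l) \<otimes> (monomial R cs a \<otimes> monomial R cs b)
        = (c [^] k \<otimes> c [^] l) \<otimes> (monomial R cs a \<otimes> monomial R cs b)"
      using car by (simp add: nat_pow_mult)
    also have "\<dots> = (c [^] k \<otimes> monomial R cs a) \<otimes> (c [^] l \<otimes> monomial R cs b)"
      using car nat_pow_closed[OF car(1), of k] nat_pow_closed[OF car(1), of l] by algebra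
    finally show ?case using Cons by simp
  qed simp
qed

lemma monomial_zero:
  "set cs \<subseteq> carrier R \<Longrightarrow> monomial R cs (replicate (length cs) 0) = \<one>"
  by (induction cs) simp_all

lemma exists_unit_exponent:
  assumes "set cs \<subseteq> carrier R" "length ds = length cs" "i < length cs"
  shows "\<exists>a\<in>exponents ds (ds ! i). monomial R cs a = cs ! i"
  using assms(2,1,3)
proof (induction ds cs arbitrary: i rule: list_induct2)
  case (Cons d ds c cs)
  have zero: "weighted_degree ds (replicate (length ds) 0) = 0" by (induction ds) simp_all
  show ?case
  proof (cases i)
    case 0
    have "1 # replicate (length cs) 0 \<in> exponents (d # ds) d"
      using Cons.hyps zero by (simp add: exponents_def)
    moreover have "monomial R (c # cs) (1 # replicate (length cs) 0) = c"
      using Cons.prems by (simp add: monomial_zero)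
    ultimately show ?thesis unfolding 0 nth_Cons_0 by (rule bexI[rotated])
  next
    case (Suc j)
    then obtain a where a: "a \<in> exponents ds (ds ! j)" "monomial R cs a = cs ! j"
      using Cons.IH[of j] Cons.prems by auto
    have "cs ! j \<in> carrier R" using Cons.prems Suc by (auto dest: nth_mem)
    hence "monomial R (c # cs) (0 # a) = (c # cs) ! i" using Cons.prems a(2) Suc by simp
    moreover have "0 # a \<in> exponents (d # ds) ((d # ds) ! i)"
      using a(1) Suc by (simp add: exponents_def)
    ultimately show ?thesis by blast
  qed
qed simp

definition monomial_ideal :: "'a list \<Rightarrow> nat list \<Rightarrow> nat \<Rightarrow> 'a set" where
  "monomial_ideal cs ds k = Idl (monomial R cs ` exponents ds k)"

lemma monomials_closed:
  assumes "set cs \<subseteq> carrier R" "length ds = length cs"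
  shows "monomial R cs ` exponents ds k \<subseteq> carrier R"
  using monomial_closed[OF assms(1)] assms(2) unfolding exponents_def by auto

lemma ideal_monomial_ideal:
  assumes "set cs \<subseteq> carrier R" "length ds = length cs"
  shows "ideal (monomial_ideal cs ds k) R"
  unfolding monomial_ideal_def by (rule genideal_ideal[OF monomials_closed[OF assms]])

text \<open>
  The elements that a fixed element multiplies into \<open>K\<close> form an ideal; this extends the assumption
  from \<open>X\<close> to its ideal and then from \<open>Y\<close> to its ideal.
\<close>

lemma genideal_mult_closed:
  assumes X: "X \<subseteq> carrier R" and Y: "Y \<subseteq> carrier R" and K: "ideal K R"
    and XY: "\<And>x y. \<lbrakk>x \<in> X; y \<in> Y\<rbrakk> \<Longrightarrow> x \<otimes> y \<in> K"
    and a: "a \<in> Idl X" and b: "b \<in> Idl Y"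
  shows "a \<otimes> b \<in> K"
proof -
  interpret K: ideal K R by (rule K)
  have quotient: "ideal {r \<in> carrier R. r \<otimes> y \<in> K} R" if y: "y \<in> carrier R" for y
  proof (rule idealI')
    show "\<zero> \<in> {r \<in> carrier R. r \<otimes> y \<in> K}" using y K.zero_closed by simp
    show "r \<oplus> r' \<in> {r \<in> carrier R. r \<otimes> y \<in> K}"
      if "r \<in> {r \<in> carrier R. r \<otimes> y \<in> K}" "r' \<in> {r \<in> carrier R. r \<otimes> y \<in> K}" for r r'
      using that y K.a_closed by (simp add: l_distr)
    show "x \<otimes> r \<in> {r \<in> carrier R. r \<otimes> y \<in> K}"
      if "r \<in> {r \<in> carrier R. r \<otimes> y \<in> K}" "x \<in> carrier R" for r x
      using that y K.I_l_closed by (simp add: m_assoc)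
  qed blast
  have Xy: "a \<otimes> y \<in> K" if y: "y \<in> Y" for y
  proof -
    have "Idl X \<subseteq> {r \<in> carrier R. r \<otimes> y \<in> K}"
      by (rule genideal_minimal[OF quotient]) (use X Y XY y in auto)
    thus ?thesis using a by blast
  qed
  have ac: "a \<in> carrier R" using a additive_subgroup.a_subset[OF ideal.axioms(1)[OF genideal_ideal[OF X]]] by blast
  have bc: "b \<in> carrier R" using b additive_subgroup.a_subset[OF ideal.axioms(1)[OF genideal_ideal[OF Y]]] by blast
  have "Idl Y \<subseteq> {r \<in> carrier R. r \<otimes> a \<in> K}"
  proof (rule genideal_minimal[OF quotient[OF ac]], rule subsetI)
    fix y assume y: "y \<in> Y"
    hence "y \<in> carrier R" using Y by blast
    thus "y \<in> {r \<in> carrier R. r \<otimes> a \<in> K}" using Xy[OF y] m_comm[OF ac] by simp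
  qed
  thus ?thesis using b m_comm[OF ac bc] by auto
qed

lemma monomial_ideal_mult_closed:
  assumes cs: "set cs \<subseteq> carrier R" "length ds = length cs"
    and "a \<in> monomial_ideal cs ds k" "b \<in> monomial_ideal cs ds l"
  shows "a \<otimes> b \<in> monomial_ideal cs ds (k + l)"
proof (rule genideal_mult_closed[OF monomials_closed[OF cs] monomials_closed[OF cs] ideal_monomial_ideal[OF cs]])
  show "a \<in> Idl (monomial R cs ` exponents ds k)" "b \<in> Idl (monomial R cs ` exponents ds l)"
    using assms(3,4) unfolding monomial_ideal_def by simp_all
  fix x y assume "x \<in> monomial R cs ` exponents ds k" "y \<in> monomial R cs ` exponents ds l"
  then obtain a b where a: "x = monomial R cs a" "a \<in> exponents ds k"
    and b: "y = monomial R cs b" "b \<in> exponents ds l" by blast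
  have "length a = length cs" "length b = length cs" using a b cs(2) by (auto simp: exponents_def)
  hence "x \<otimes> y = monomial R cs (map2 (+) a b)" unfolding a(1) b(1) by (rule monomial_add[OF cs(1), symmetric])
  thus "x \<otimes> y \<in> monomial_ideal cs ds (k + l)"
    using exponents_add[OF a(2) b(2)] genideal_self[OF monomials_closed[OF cs]]
    unfolding monomial_ideal_def by blast
qed

lemma monomial_ideal_zero:
  assumes cs: "set cs \<subseteq> carrier R" "length ds = length cs"
  shows "monomial_ideal cs ds 0 = carrier R"
proof -
  have "weighted_degree ds (replicate (length ds) 0) = 0" by (induction ds) simp_all
  hence "replicate (length cs) 0 \<in> exponents ds 0" using cs(2) by (simp add: exponents_def)
  hence "\<one> \<in> monomial R cs ` exponents ds 0" using monomial_zero[OF cs(1)] by (metis imageI)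
  hence "\<one> \<in> monomial_ideal cs ds 0"
    using genideal_self[OF monomials_closed[OF cs]] unfolding monomial_ideal_def by blast
  thus ?thesis by (rule ideal.one_imp_carrier[OF ideal_monomial_ideal[OF cs]])
qed

lemma generator_in_monomial_ideal:
  assumes cs: "set cs \<subseteq> carrier R" "length ds = length cs" and i: "i < length cs"
  shows "cs ! i \<in> monomial_ideal cs ds (ds ! i)"
proof -
  obtain a where "a \<in> exponents ds (ds ! i)" "monomial R cs a = cs ! i"
    using exists_unit_exponent[OF cs i] by blast
  hence "cs ! i \<in> monomial R cs ` exponents ds (ds ! i)" by (metis imageI)
  thus ?thesis using genideal_self[OF monomials_closed[OF cs]] unfolding monomial_ideal_def by blast
qed

lemma ideal_power_subset_monomial_ideal:
  assumes fs: "set fs \<subseteq> carrier R" and I: "I = Idl (set fs)"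
  shows "ideal_power R I k \<subseteq> monomial_ideal fs (replicate (length fs) 1) k"
proof (induction k)
  case 0
  show ?case using monomial_ideal_zero[OF fs, of "replicate (length fs) 1"] by simp
next
  case (Suc k)
  let ?ds = "replicate (length fs) 1"
  have len: "length ?ds = length fs" by simp
  interpret M: ideal "monomial_ideal fs ?ds (Suc k)" R by (rule ideal_monomial_ideal[OF fs len])
  have "set fs \<subseteq> monomial_ideal fs ?ds 1"
  proof
    fix f assume "f \<in> set fs"
    then obtain i where i: "i < length fs" "f = fs ! i" by (metis in_set_conv_nth)
    show "f \<in> monomial_ideal fs ?ds 1"
      using generator_in_monomial_ideal[OF fs len i(1)] i by simp
  qed
  hence I1: "I \<subseteq> monomial_ideal fs ?ds 1"
    unfolding I by (rule genideal_minimal[OF ideal_monomial_ideal[OF fs len]])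
  show ?case
  proof
    fix x assume "x \<in> ideal_power R I (Suc k)"
    hence "x \<in> ideal_prod R I (ideal_power R I k)" by simp
    thus "x \<in> monomial_ideal fs ?ds (Suc k)"
    proof (induction rule: ideal_prod.induct)
      case (prod i j)
      have "i \<in> monomial_ideal fs ?ds 1" "j \<in> monomial_ideal fs ?ds k" using prod I1 Suc.IH by auto
      from monomial_ideal_mult_closed[OF fs len this] show ?case by simp
    next
      case (sum x y)
      show ?case by (rule M.a_closed[OF sum(3,4)])
    qed
  qed
qed

text \<open>
  This is applied to the ordinary powers of an ideal and to its symbolic powers.
\<close>

lemma monomial_mem_multiplicative_family:
  assumes J: "\<And>i. ideal (J i) R" and J0: "J 0 = carrier R"
    and mult: "\<And>i j a b. \<lbrakk>a \<in> J i; b \<in> J j\<rbrakk> \<Longrightarrow> a \<otimes> b \<in> J (i + j)"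
    and cs: "length ds = length cs" "\<And>i. i < length cs \<Longrightarrow> cs ! i \<in> J (ds ! i)"
    and a: "length a = length ds"
  shows "monomial R cs a \<in> J (weighted_degree ds a)"
proof -
  have pow: "c [^] k \<in> J (d * k)" if "c \<in> J d" for c d and k :: nat
  proof (induction k)
    case (Suc k)
    have "c [^] k \<otimes> c \<in> J (d * k + d)" by (rule mult[OF Suc that])
    thus ?case by (simp add: add.commute)
  qed (simp add: J0)
  have "length a = length ds" "length ds = length cs" using a cs(1) by simp_all
  thus ?thesis using cs(2)
  proof (induction a ds cs rule: list_induct3)
    case (Cons k a d ds c cs)
    have "c \<in> J d" using Cons.prems[of 0] by simp
    moreover have "monomial R cs a \<in> J (weighted_degree ds a)"
      by (rule Cons.IH) (use Cons.prems in force)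
    ultimately have "c [^] k \<otimes> monomial R cs a \<in> J (d * k + weighted_degree ds a)"
      by (intro mult pow)
    thus ?case by simp
  qed (simp add: J0)
qed

end

section \<open>The minimal number of generators of a quotient of ideals\<close>

context cring
begin

lemma quot_module_simps:
  shows carrier_quot_module: "carrier (quot_module (ideal_module R J) N) = (\<lambda>x. N +> x) ` J"
    and add_quot_module: "add (quot_module (ideal_module R J) N) = set_add R"
    and zero_quot_module: "zero (quot_module (ideal_module R J) N) = N"
    and smult_quot_module: "smult (quot_module (ideal_module R J) N) = (\<lambda>r X. \<Union>x\<in>X. N +> (r \<otimes> x))"
  unfolding quot_module_def ideal_module_def A_RCOSETS_def RCOSETS_def a_r_coset_def r_coset_def
    set_add_def set_mult_def
  by auto

context
  fixes J N
  assumes J: "ideal J R" and N: "ideal N R" and NJ: "N \<subseteq> J"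
begin

abbreviation Q :: "('a, 'a set) module" where "Q \<equiv> quot_module (ideal_module R J) N"

lemma coset_eq_iff: "\<lbrakk>x \<in> carrier R; y \<in> carrier R\<rbrakk> \<Longrightarrow> N +> x = N +> y \<longleftrightarrow> x \<ominus> y \<in> N"
  using quotient_eq_iff_same_a_r_cos[OF N] by blast

lemma coset_add: "\<lbrakk>x \<in> carrier R; y \<in> carrier R\<rbrakk> \<Longrightarrow> (N +> x) \<oplus>\<^bsub>Q\<^esub> (N +> y) = N +> (x \<oplus> y)"
  unfolding add_quot_module by (rule ideal.a_rcos_sum[OF N])

lemma coset_zero: "\<zero>\<^bsub>Q\<^esub> = N +> \<zero>"
  unfolding zero_quot_module
  using a_rcos_zero[OF N additive_subgroup.zero_closed[OF ideal.axioms(1)[OF N]]] by simp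

lemma coset_smult:
  assumes r: "r \<in> carrier R" and x: "x \<in> carrier R"
  shows "r \<odot>\<^bsub>Q\<^esub> (N +> x) = N +> (r \<otimes> x)"
proof -
  interpret N: ideal N R by (rule N)
  have "N +> (r \<otimes> y) = N +> (r \<otimes> x)" if y: "y \<in> N +> x" for y
  proof -
    obtain h where h: "h \<in> N" "y = h \<oplus> x" using y unfolding a_r_coset_def' by blast
    have hc: "h \<in> carrier R" by (rule N.Icarr[OF h(1)])
    have "r \<otimes> y \<ominus> r \<otimes> x = r \<otimes> h" unfolding h(2) using r x hc by algebra
    hence "r \<otimes> y \<ominus> r \<otimes> x \<in> N" using N.I_l_closed[OF h(1) r] by simp
    thus ?thesis using coset_eq_iff[of "r \<otimes> y" "r \<otimes> x"] r x hc h(2) by simp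
  qed
  moreover have "x \<in> N +> x" using N.a_rcos_self[OF x] .
  ultimately show ?thesis unfolding smult_quot_module by blast
qed

lemma abelian_group_quot_module: "abelian_group Q"
proof (rule abelian_groupI)
  interpret J: ideal J R by (rule J)
  fix X Y Z assume "X \<in> carrier Q" "Y \<in> carrier Q" "Z \<in> carrier Q"
  then obtain x y z where x: "X = N +> x" "x \<in> J" and y: "Y = N +> y" "y \<in> J" and z: "Z = N +> z" "z \<in> J"
    unfolding carrier_quot_module by blast
  note car = J.Icarr[OF x(2)] J.Icarr[OF y(2)] J.Icarr[OF z(2)]
  show "X \<oplus>\<^bsub>Q\<^esub> Y \<in> carrier Q"
    unfolding x(1) y(1) coset_add[OF car(1,2)] carrier_quot_module
    by (rule imageI[OF J.a_closed[OF x(2) y(2)]])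
  show "X \<oplus>\<^bsub>Q\<^esub> Y = Y \<oplus>\<^bsub>Q\<^esub> X"
    unfolding x(1) y(1) coset_add[OF car(1,2)] coset_add[OF car(2,1)] a_comm[OF car(1,2)] ..
  show "X \<oplus>\<^bsub>Q\<^esub> Y \<oplus>\<^bsub>Q\<^esub> Z = X \<oplus>\<^bsub>Q\<^esub> (Y \<oplus>\<^bsub>Q\<^esub> Z)"
    unfolding x(1) y(1) z(1) coset_add[OF car(1,2)] coset_add[OF car(2,3)]
      coset_add[OF a_closed[OF car(1,2)] car(3)] coset_add[OF car(1) a_closed[OF car(2,3)]]
      a_assoc[OF car] ..
next
  interpret J: ideal J R by (rule J)
  show "\<zero>\<^bsub>Q\<^esub> \<in> carrier Q" unfolding coset_zero carrier_quot_module by (rule imageI[OF J.zero_closed])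
  fix X assume "X \<in> carrier Q"
  then obtain x where x: "X = N +> x" "x \<in> J" unfolding carrier_quot_module by blast
  have xc: "x \<in> carrier R" by (rule J.Icarr[OF x(2)])
  show "\<zero>\<^bsub>Q\<^esub> \<oplus>\<^bsub>Q\<^esub> X = X" unfolding coset_zero x(1) coset_add[OF zero_closed xc] l_zero[OF xc] ..
  have "(N +> \<ominus> x) \<oplus>\<^bsub>Q\<^esub> X = \<zero>\<^bsub>Q\<^esub>"
    unfolding coset_zero x(1) coset_add[OF a_inv_closed[OF xc] xc] l_neg[OF xc] ..
  thus "\<exists>Y\<in>carrier Q. Y \<oplus>\<^bsub>Q\<^esub> X = \<zero>\<^bsub>Q\<^esub>"
    unfolding carrier_quot_module by (rule bexI[OF _ imageI[OF J.a_inv_closed[OF x(2)]]])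
qed

text \<open>
  Together with \<open>ideal_of_submodule\<close>: the submodules of \<open>J / N\<close> correspond to the ideals between \<open>N\<close>
  and \<open>J\<close>.
\<close>

lemma submodule_of_ideal:
  assumes L: "ideal L R" "L \<subseteq> J"
  shows "submodule ((\<lambda>x. N +> x) ` L) R Q"
proof (intro submodule.intro submodule_axioms.intro)
  interpret L: ideal L R by (rule L(1))
  interpret Q: abelian_group Q by (rule abelian_group_quot_module)
  show "subgroup ((\<lambda>x. N +> x) ` L) (add_monoid Q)"
  proof (rule Q.add.subgroupI)
    show "(\<lambda>x. N +> x) ` L \<subseteq> carrier Q" unfolding carrier_quot_module using L(2) by blast
    show "(\<lambda>x. N +> x) ` L \<noteq> {}" using L.zero_closed by blast
    fix X assume "X \<in> (\<lambda>x. N +> x) ` L"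
    then obtain x where x: "X = N +> x" "x \<in> L" by blast
    have xc: "x \<in> carrier R" by (rule L.Icarr[OF x(2)])
    have inQ: "N +> y \<in> carrier Q" if "y \<in> L" for y
      unfolding carrier_quot_module using L(2) that by blast
    have "(N +> \<ominus> x) \<oplus>\<^bsub>Q\<^esub> X = \<zero>\<^bsub>Q\<^esub>"
      unfolding coset_zero x(1) coset_add[OF a_inv_closed[OF xc] xc] l_neg[OF xc] ..
    hence "\<ominus>\<^bsub>Q\<^esub> X = N +> \<ominus> x"
      using Q.minus_equality inQ[OF x(2)] inQ[OF L.a_inv_closed[OF x(2)]] x(1) by blast
    thus "\<ominus>\<^bsub>Q\<^esub> X \<in> (\<lambda>x. N +> x) ` L" using L.a_inv_closed[OF x(2)] by blast
    fix Y assume "Y \<in> (\<lambda>x. N +> x) ` L"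
    then obtain y where y: "Y = N +> y" "y \<in> L" by blast
    show "X \<oplus>\<^bsub>Q\<^esub> Y \<in> (\<lambda>x. N +> x) ` L"
      unfolding x(1) y(1) coset_add[OF xc L.Icarr[OF y(2)]] using L.a_closed[OF x(2) y(2)] by blast
  qed
  fix r X assume r: "r \<in> carrier R" and "X \<in> (\<lambda>x. N +> x) ` L"
  then obtain x where x: "X = N +> x" "x \<in> L" by blast
  show "r \<odot>\<^bsub>Q\<^esub> X \<in> (\<lambda>x. N +> x) ` L"
    unfolding x(1) coset_smult[OF r L.Icarr[OF x(2)]] using L.I_l_closed[OF x(2) r] by blast
qed

lemma ideal_of_submodule:
  assumes H: "submodule H R Q"
  shows "ideal {y \<in> J. N +> y \<in> H} R" "N \<subseteq> {y \<in> J. N +> y \<in> H}"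
proof -
  interpret J: ideal J R by (rule J)
  interpret N: ideal N R by (rule N)
  have "\<zero>\<^bsub>Q\<^esub> \<in> H" using subgroup.one_closed[OF submodule.axioms(1)[OF H]] by simp
  hence zero: "N \<in> H" unfolding zero_quot_module .
  show "N \<subseteq> {y \<in> J. N +> y \<in> H}"
    using zero NJ a_rcos_zero[OF N] by auto
  show "ideal {y \<in> J. N +> y \<in> H} R"
  proof (rule idealI')
    show "{y \<in> J. N +> y \<in> H} \<subseteq> carrier R" using J.a_subset by blast
    show "\<zero> \<in> {y \<in> J. N +> y \<in> H}" using \<open>N \<subseteq> {y \<in> J. N +> y \<in> H}\<close> N.zero_closed by blast
  next
    fix a b assume "a \<in> {y \<in> J. N +> y \<in> H}" "b \<in> {y \<in> J. N +> y \<in> H}"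
    hence ab: "a \<in> J" "b \<in> J" "N +> a \<in> H" "N +> b \<in> H" by auto
    have "(N +> a) \<oplus>\<^bsub>Q\<^esub> (N +> b) \<in> H" using subgroup.m_closed[OF submodule.axioms(1)[OF H] ab(3,4)] by simp
    thus "a \<oplus> b \<in> {y \<in> J. N +> y \<in> H}"
      using coset_add[OF J.Icarr[OF ab(1)] J.Icarr[OF ab(2)]] J.a_closed[OF ab(1,2)] by simp
  next
    fix a r assume "a \<in> {y \<in> J. N +> y \<in> H}" and r: "r \<in> carrier R"
    hence a: "a \<in> J" "N +> a \<in> H" by auto
    show "r \<otimes> a \<in> {y \<in> J. N +> y \<in> H}"
      using submodule.smult_closed[OF H r a(2)] coset_smult[OF r J.Icarr[OF a(1)]] J.I_l_closed[OF a(1) r] by simp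
  qed
qed

lemma cosets_generate_iff:
  assumes T: "T \<subseteq> J"
  shows "generated_submodule R Q ((\<lambda>x. N +> x) ` T) = carrier Q \<longleftrightarrow> J \<subseteq> Idl (N \<union> T)"
proof
  interpret J: ideal J R by (rule J)
  interpret N: ideal N R by (rule N)
  have car: "N \<union> T \<subseteq> carrier R" using N.a_subset T J.a_subset by blast
  interpret L: ideal "Idl (N \<union> T)" R by (rule genideal_ideal[OF car])
  have L_self: "N \<union> T \<subseteq> Idl (N \<union> T)" by (rule genideal_self[OF car])
  have LJ: "Idl (N \<union> T) \<subseteq> J" by (rule genideal_minimal[OF J]) (use T NJ in blast)
  assume gen: "generated_submodule R Q ((\<lambda>x. N +> x) ` T) = carrier Q"
  have "generated_submodule R Q ((\<lambda>x. N +> x) ` T) \<subseteq> (\<lambda>x. N +> x) ` (Idl (N \<union> T))"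
    unfolding generated_submodule_def
    using submodule_of_ideal[OF L.ideal_axioms LJ] L_self by blast
  hence sub: "(\<lambda>x. N +> x) ` J \<subseteq> (\<lambda>x. N +> x) ` (Idl (N \<union> T))"
    unfolding gen carrier_quot_module .
  show "J \<subseteq> Idl (N \<union> T)"
  proof
    fix y assume y: "y \<in> J"
    then obtain x where x: "x \<in> Idl (N \<union> T)" "N +> y = N +> x" using sub by blast
    have c: "y \<in> carrier R" "x \<in> carrier R" using J.Icarr[OF y] L.Icarr[OF x(1)] .
    have "y \<ominus> x \<in> Idl (N \<union> T)" using coset_eq_iff[OF c] x(2) L_self by blast
    hence "(y \<ominus> x) \<oplus> x \<in> Idl (N \<union> T)" using L.a_closed x(1) by blast
    moreover have "(y \<ominus> x) \<oplus> x = y" using c by algebra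
    ultimately show "y \<in> Idl (N \<union> T)" by simp
  qed
next
  assume gen: "J \<subseteq> Idl (N \<union> T)"
  have "submodule (carrier Q) R Q"
    using submodule_of_ideal[OF J order_refl] unfolding carrier_quot_module .
  hence "generated_submodule R Q ((\<lambda>x. N +> x) ` T) \<subseteq> carrier Q"
    unfolding generated_submodule_def carrier_quot_module using T by blast
  moreover have "carrier Q \<subseteq> H" if H: "submodule H R Q" "(\<lambda>x. N +> x) ` T \<subseteq> H" for H
  proof -
    have "Idl (N \<union> T) \<subseteq> {y \<in> J. N +> y \<in> H}"
      by (rule genideal_minimal[OF ideal_of_submodule(1)[OF H(1)]])
         (use ideal_of_submodule(2)[OF H(1)] H(2) T in blast)
    thus ?thesis unfolding carrier_quot_module using gen by blast
  qed
  ultimately show "generated_submodule R Q ((\<lambda>x. N +> x) ` T) = carrier Q"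
    unfolding generated_submodule_def by blast
qed

text \<open>
  Elements of \<open>J\<close> may have the same coset, so a set of \<open>n\<close> generators could have fewer than \<open>n\<close>
  cosets; the lower bound, applied to representatives, excludes this.
\<close>

lemma min_generators_quot_module_eqI:
  assumes T: "finite T" "T \<subseteq> J" "card T = n" "J \<subseteq> Idl (N \<union> T)"
    and least: "\<And>S. \<lbrakk>finite S; S \<subseteq> J; J \<subseteq> Idl (N \<union> S)\<rbrakk> \<Longrightarrow> n \<le> card S"
  shows "min_generators R Q = n"
proof -
  have lower: "n \<le> card S"
    if S: "S \<subseteq> carrier Q" "finite S" "generated_submodule R Q S = carrier Q" for S
  proof -
    obtain U where U: "U \<subseteq> J" "inj_on (\<lambda>x. N +> x) U" "S = (\<lambda>x. N +> x) ` U"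
      using S(1) unfolding carrier_quot_module subset_image_inj by blast
    have "finite U" using S(2) U(2,3) finite_imageD by blast
    moreover have "J \<subseteq> Idl (N \<union> U)" using cosets_generate_iff[OF U(1)] S(3) U(3) by simp
    ultimately show ?thesis using least[of U] U card_image[OF U(2)] by simp
  qed
  let ?S = "(\<lambda>x. N +> x) ` T"
  have S: "?S \<subseteq> carrier Q" "finite ?S" "generated_submodule R Q ?S = carrier Q"
    using T cosets_generate_iff[OF T(2)] unfolding carrier_quot_module by auto
  have "card ?S = n" using lower[OF S] card_image_le[OF T(1), of "\<lambda>x. N +> x"] T(3) by simp
  thus ?thesis
    unfolding min_generators_def using S lower by (intro Least_equality) blast+
qed

end

end

section \<open>Standard monomials and the symbolic defect\<close>

context noetherian_graded_local
begin

lemma finite_homogeneous_generators: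
  assumes J: "graded_ideal J"
  shows "\<exists>C. finite C \<and> C \<subseteq> J \<and> C \<subseteq> (\<Union>i. A i) \<and> J \<subseteq> Idl C"
proof -
  have id: "ideal J R" using J by (simp add: graded_ideal_def)
  obtain S where S: "S \<subseteq> carrier R" "finite S" "J = Idl S" using finetely_gen[OF id] by blast
  define C where "C = (\<Union>x\<in>S. comp x ` supp x)"
  have SJ: "S \<subseteq> J" unfolding S(3) by (rule genideal_self[OF S(1)])
  have fin: "finite (supp x)" if "x \<in> S" for x using finite_supp S(1) that by blast
  have CJ: "C \<subseteq> J" using J SJ unfolding C_def graded_ideal_def by blast
  hence car: "C \<subseteq> carrier R" using additive_subgroup.a_subset[OF ideal.axioms(1)[OF id]] by blast
  have "S \<subseteq> Idl C"
  proof
    fix x assume x: "x \<in> S"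
    have "finsum R (comp x) (supp x) \<in> Idl C"
      by (rule ideal_finsum_closed[OF genideal_ideal[OF car] fin[OF x]])
         (use x genideal_self[OF car] in \<open>auto simp: C_def\<close>)
    thus "x \<in> Idl C" using sum_comp[of x] x S(1) by auto
  qed
  hence "J \<subseteq> Idl C" unfolding S(3) by (rule genideal_minimal[OF genideal_ideal[OF car]])
  moreover have "finite C" unfolding C_def using S(2) fin by blast
  moreover have "C \<subseteq> (\<Union>i. A i)" unfolding C_def using comp_mem S(1) by blast
  ultimately show ?thesis using CJ by blast
qed

lemma inverse_modulo_mm:
  assumes a: "a \<in> carrier R" "a \<notin> \<mm>"
  shows "\<exists>b\<in>carrier R. \<exists>l\<in>\<mm>. \<one> = l \<oplus> b \<otimes> a"
proof -
  interpret mm: maximalideal \<mm> R by (rule maximalideal_mm)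
  let ?K = "{l \<oplus> b \<otimes> a |l b. l \<in> \<mm> \<and> b \<in> carrier R}"
  have K: "ideal ?K R" by (rule ideal_plus_multiples[OF mm.ideal_axioms oneideal a(1)])
  have "a = \<zero> \<oplus> \<one> \<otimes> a" using a(1) by simp
  hence "a \<in> ?K" using mm.zero_closed one_closed by blast
  moreover have "\<mm> \<subseteq> ?K"
  proof
    fix l assume l: "l \<in> \<mm>"
    have "l = l \<oplus> \<zero> \<otimes> a" using mm.Icarr[OF l] a(1) by simp
    thus "l \<in> ?K" using l zero_closed by blast
  qed
  ultimately have "?K = carrier R"
    using mm.I_maximal[OF K] a(2) additive_subgroup.a_subset[OF ideal.axioms(1)[OF K]] by blast
  hence "\<one> \<in> ?K" by simp
  thus ?thesis by blast
qed

text \<open>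
  Modulo \<open>\<mm> J\<close> this closure is the linear span in the vector space \<open>J / \<mm> J\<close> over \<open>R / \<mm>\<close>. The
  exchange property expresses that coefficients outside \<open>\<mm>\<close> are invertible modulo \<open>\<mm>\<close>.
\<close>

lemma exchange_closure_modulo_mm:
  assumes J: "ideal J R"
  shows "exchange_closure J (\<lambda>X. Idl (X \<union> ideal_prod R \<mm> J))"
proof
  interpret mm: maximalideal \<mm> R by (rule maximalideal_mm)
  interpret J: ideal J R by (rule J)
  let ?Z = "ideal_prod R \<mm> J"
  have ZJ: "?Z \<subseteq> J" using ideal_prod_inter[OF mm.ideal_axioms J] by blast
  have car: "X \<union> ?Z \<subseteq> carrier R" if "X \<subseteq> J" for X using that ZJ J.a_subset by blast
  show "Idl (X \<union> ?Z) \<subseteq> J" if "X \<subseteq> J" for X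
    by (rule genideal_minimal[OF J]) (use that ZJ in blast)
  show "X \<subseteq> Idl (X \<union> ?Z)" if "X \<subseteq> J" for X
    using genideal_self[OF car[OF that]] by simp
  show "Idl (X \<union> ?Z) \<subseteq> Idl (Y \<union> ?Z)" if "Y \<subseteq> J" "X \<subseteq> Idl (Y \<union> ?Z)" for X Y
    by (rule genideal_minimal[OF genideal_ideal[OF car[OF that(1)]]])
       (use that(2) genideal_self[OF car[OF that(1)]] in simp)
  fix X x y assume X: "X \<subseteq> J" and x: "x \<in> J" and y: "y \<in> Idl (insert x X \<union> ?Z)" "y \<notin> Idl (X \<union> ?Z)"
  interpret I: ideal "Idl (X \<union> ?Z)" R by (rule genideal_ideal[OF car[OF X]])
  have xc: "x \<in> carrier R" by (rule J.Icarr[OF x])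
  obtain l a where y_eq: "y = l \<oplus> a \<otimes> x" and l: "l \<in> Idl (X \<union> ?Z)" and a: "a \<in> carrier R"
    using y(1) unfolding Un_insert_left genideal_insert[OF car[OF X] xc] by blast
  have "a \<notin> \<mm>"
  proof
    assume "a \<in> \<mm>"
    hence "a \<otimes> x \<in> Idl (X \<union> ?Z)"
      using ideal_prod.prod[of a \<mm> x J R] x genideal_self[OF car[OF X]] by blast
    thus False using y(2) I.a_closed[OF l] unfolding y_eq by blast
  qed
  then obtain b m where b: "b \<in> carrier R" and m: "m \<in> \<mm>" and one: "\<one> = m \<oplus> b \<otimes> a"
    using inverse_modulo_mm[OF a] by blast
  have yJ: "insert y X \<subseteq> J"
    unfolding y_eq using X x l a J.a_closed J.I_l_closed genideal_minimal[OF J, of "X \<union> ?Z"] ZJ by blast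
  interpret K: ideal "Idl (insert y X \<union> ?Z)" R by (rule genideal_ideal[OF car[OF yJ]])
  have self: "insert y X \<union> ?Z \<subseteq> Idl (insert y X \<union> ?Z)" by (rule genideal_self[OF car[OF yJ]])
  have "Idl (X \<union> ?Z) \<subseteq> Idl (insert y X \<union> ?Z)"
    by (rule genideal_minimal[OF K.ideal_axioms]) (use self in blast)
  hence lK: "l \<in> Idl (insert y X \<union> ?Z)" using l by blast
  have lc: "l \<in> carrier R" by (rule I.Icarr[OF l])
  have mc: "m \<in> carrier R" by (rule mm.Icarr[OF m])
  \<comment> \<open>modulo \<open>\<mm>\<close>, \<open>b\<close> inverts the coefficient \<open>a\<close> of \<open>x\<close> in \<open>y\<close>\<close>
  have "x = (m \<oplus> b \<otimes> a) \<otimes> x" unfolding one[symmetric] using xc by simp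
  also have "\<dots> = m \<otimes> x \<oplus> (b \<otimes> (l \<oplus> a \<otimes> x) \<oplus> \<ominus> (b \<otimes> l))"
    using mc b a xc lc by algebra
  also have "\<dots> = m \<otimes> x \<oplus> (b \<otimes> y \<oplus> \<ominus> (b \<otimes> l))" unfolding y_eq ..
  also have "\<dots> \<in> Idl (insert y X \<union> ?Z)"
  proof (intro K.a_closed K.a_inv_closed K.I_l_closed[OF _ b] lK)
    show "m \<otimes> x \<in> Idl (insert y X \<union> ?Z)" using ideal_prod.prod[OF m x, of R] self by blast
    show "y \<in> Idl (insert y X \<union> ?Z)" using self by blast
  qed
  finally show "x \<in> Idl (insert y X \<union> ?Z)" .
qed

text \<open>
  The exponents of the monomials that modulo \<open>\<mm> J\<^sub>k\<close> depend linearly on smaller monomials of the same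
  degree \<open>k\<close>: the leading exponents of the relations between the generators in the fibre ring.
\<close>

definition nonstandard :: "(nat \<Rightarrow> 'a set) \<Rightarrow> 'a list \<Rightarrow> nat list \<Rightarrow> nat list set" where
  "nonstandard J cs ds = {a. length a = length ds \<and>
     monomial R cs a \<in> Idl (monomial R cs ` {b \<in> exponents ds (weighted_degree ds a). b < a}
       \<union> ideal_prod R \<mm> (J (weighted_degree ds a)))}"

context
  fixes J :: "nat \<Rightarrow> 'a set"
  assumes J_ideal: "\<And>i. ideal (J i) R" and J_zero: "J 0 = carrier R"
    and J_mult: "\<And>i j a b. \<lbrakk>a \<in> J i; b \<in> J j\<rbrakk> \<Longrightarrow> a \<otimes> b \<in> J (i + j)"
begin

lemma mm_prod_mult_closed:
  assumes "z \<in> ideal_prod R \<mm> (J i)" "b \<in> J j"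
  shows "z \<otimes> b \<in> ideal_prod R \<mm> (J (i + j))"
  using assms(1)
proof (induction rule: ideal_prod.induct)
  case (prod m x)
  have "m \<in> carrier R" "x \<in> carrier R" "b \<in> carrier R"
    using ideal.Icarr[OF maximalideal.axioms(1)[OF maximalideal_mm] prod(1)]
      ideal.Icarr[OF J_ideal prod(2)] ideal.Icarr[OF J_ideal assms(2)] .
  hence "m \<otimes> x \<otimes> b = m \<otimes> (x \<otimes> b)" by (rule m_assoc)
  thus ?case using ideal_prod.prod[OF prod(1) J_mult[OF prod(2) assms(2)], of R] by simp
next
  case (sum x y)
  have "x \<in> carrier R" "y \<in> carrier R"
    using sum(1,2) ideal_prod_in_carrier[OF maximalideal.axioms(1)[OF maximalideal_mm] J_ideal] by blast+
  hence "(x \<oplus> y) \<otimes> b = x \<otimes> b \<oplus> y \<otimes> b" using ideal.Icarr[OF J_ideal assms(2)] by (rule l_distr)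
  thus ?case using ideal_prod.sum[OF sum(3,4)] by simp
qed

context
  fixes cs :: "'a list" and ds :: "nat list"
  assumes len: "length ds = length cs" and cs_mem: "\<And>i. i < length cs \<Longrightarrow> cs ! i \<in> J (ds ! i)"
begin

lemma cs_carrier: "set cs \<subseteq> carrier R"
  using cs_mem ideal.Icarr[OF J_ideal] by (metis in_set_conv_nth subsetI)

lemma monomial_mem: "length a = length ds \<Longrightarrow> monomial R cs a \<in> J (weighted_degree ds a)"
  by (rule monomial_mem_multiplicative_family[of J, OF J_ideal J_zero J_mult len cs_mem])

lemma monomials_subset: "monomial R cs ` exponents ds k \<subseteq> J k"
  using monomial_mem unfolding exponents_def by blast

text \<open>
  Multiplying a relation by a monomial of degree \<open>l\<close> preserves the order of the monomials in it and
  carries \<open>\<mm> J\<^sub>k\<close> into \<open>\<mm> J\<^bsub>k + l\<^esub>\<close>. This uses only that the monomials lie in the family \<open>J\<close>, so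
  that it applies to generators of \<open>I\<close> in degree \<open>1\<close> as well as to those of the symbolic Rees algebra.
\<close>

lemma up_closed_nonstandard: "up_closed (nonstandard J cs ds)"
  unfolding up_closed_def
proof (intro ballI allI impI)
  fix a b assume a: "a \<in> nonstandard J cs ds" and ab: "list_all2 (\<le>) a b"
  obtain c where c: "length c = length a" "b = map2 (+) a c"
    using list_all2_le_imp_add[OF ab] by blast
  have la: "length a = length ds" using a by (simp add: nonstandard_def)
  define k where "k = weighted_degree ds a"
  define l where "l = weighted_degree ds c"
  have aE: "a \<in> exponents ds k" and cE: "c \<in> exponents ds l"
    using la c(1) by (simp_all add: exponents_def k_def l_def)
  have bE: "b \<in> exponents ds (k + l)" unfolding c(2) by (rule exponents_add[OF aE cE])
  let ?X = "\<lambda>k a. monomial R cs ` {b \<in> exponents ds k. b < a} \<union> ideal_prod R \<mm> (J k)"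
  have Xcar: "?X k a \<subseteq> carrier R" for k a
    using monomials_closed[OF cs_carrier len] 
      ideal_prod_in_carrier[OF maximalideal.axioms(1)[OF maximalideal_mm] J_ideal] by blast
  have cJ: "monomial R cs c \<in> J l" using monomials_subset cE by blast
  have cc: "monomial R cs c \<in> carrier R" by (rule ideal.Icarr[OF J_ideal cJ])
  have self: "?X (k + l) b \<subseteq> Idl (?X (k + l) b)" by (rule genideal_self[OF Xcar])
  have "monomial R cs a \<otimes> monomial R cs c \<in> Idl (?X (k + l) b)"
  proof (rule genideal_mult_closed[OF Xcar _ genideal_ideal[OF Xcar], of "{monomial R cs c}" k a])
    show "{monomial R cs c} \<subseteq> carrier R" using cc by simp
    show "monomial R cs a \<in> Idl (?X k a)" using a by (simp add: nonstandard_def k_def)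
    show "monomial R cs c \<in> Idl {monomial R cs c}" using genideal_self[of "{monomial R cs c}"] cc by simp
    fix x y assume x: "x \<in> ?X k a" and "y \<in> {monomial R cs c}"
    hence y: "y = monomial R cs c" by simp
    from x show "x \<otimes> y \<in> Idl (?X (k + l) b)"
    proof
      assume "x \<in> monomial R cs ` {b \<in> exponents ds k. b < a}"
      then obtain a' where a': "x = monomial R cs a'" "a' \<in> exponents ds k" "a' < a" by blast
      have la': "length a' = length ds" using a'(2) by (simp add: exponents_def)
      have "map2 (+) a' c < b" unfolding c(2) by (rule lex_less_add) (use la la' c(1) a'(3) in simp_all)
      moreover have "x \<otimes> y = monomial R cs (map2 (+) a' c)"
        unfolding a'(1) y using monomial_add[OF cs_carrier, of a' c] la' la c(1) len by simp
      ultimately have "x \<otimes> y \<in> ?X (k + l) b" using exponents_add[OF a'(2) cE] by blast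
      thus ?thesis using self by blast
    next
      assume "x \<in> ideal_prod R \<mm> (J k)"
      hence "x \<otimes> y \<in> ideal_prod R \<mm> (J (k + l))" unfolding y using cJ by (rule mm_prod_mult_closed)
      thus ?thesis using self by blast
    qed
  qed
  moreover have "monomial R cs b = monomial R cs a \<otimes> monomial R cs c"
    unfolding c(2) using monomial_add[OF cs_carrier, of a c] la c(1) len by simp
  moreover have "weighted_degree ds b = k + l" "length b = length ds" using bE by (simp_all add: exponents_def)
  ultimately show "b \<in> nonstandard J cs ds" by (simp add: nonstandard_def)
qed

lemma standard_monomials_basis:
  assumes pos: "\<forall>d\<in>set ds. 0 < d"
  shows "\<exists>X. exchange_closure.indep (J k) (\<lambda>X. Idl (X \<union> ideal_prod R \<mm> (J k))) X
    \<and> finite X \<and> card X = standard_count ds (nonstandard J cs ds) k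
    \<and> X \<subseteq> monomial R cs ` exponents ds k
    \<and> monomial R cs ` exponents ds k \<subseteq> Idl (X \<union> ideal_prod R \<mm> (J k))"
proof -
  interpret cl: exchange_closure "J k" "\<lambda>X. Idl (X \<union> ideal_prod R \<mm> (J k))"
    by (rule exchange_closure_modulo_mm[OF J_ideal])
  define B where "B = {a \<in> exponents ds k. monomial R cs a
      \<notin> Idl (monomial R cs ` {b \<in> exponents ds k. b < a} \<union> ideal_prod R \<mm> (J k))}"
  note basis = cl.greedy_basis[OF finite_exponents[OF pos] monomials_subset, folded B_def]
  have "B = {a. length a = length ds \<and> weighted_degree ds a = k \<and> a \<notin> nonstandard J cs ds}"
    unfolding B_def nonstandard_def exponents_def by auto
  hence "card B = standard_count ds (nonstandard J cs ds) k" by (simp add: standard_count_def)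
  hence card: "card (monomial R cs ` B) = standard_count ds (nonstandard J cs ds) k"
    using card_image[OF basis(1)] by simp
  have sub: "B \<subseteq> exponents ds k" by (auto simp: B_def)
  show ?thesis
  proof (intro exI conjI)
    show "cl.indep (monomial R cs ` B)" by (rule basis(2))
    show "finite (monomial R cs ` B)" using finite_subset[OF sub finite_exponents[OF pos]] by simp
    show "monomial R cs ` B \<subseteq> monomial R cs ` exponents ds k" by (rule image_mono[OF sub])
    show "monomial R cs ` exponents ds k \<subseteq> Idl (monomial R cs ` B \<union> ideal_prod R \<mm> (J k))"
      by (rule basis(3))
  qed (rule card)
qed

end

end

text \<open>
  Here \<open>X\<close> is a basis of the image of \<open>N\<close> in \<open>J / \<mm> J\<close> and \<open>Y\<close> a basis of \<open>J / \<mm> J\<close>. For the upper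
  bound, \<open>X\<close> is completed to a basis by elements \<open>T\<close> of a homogeneous generating set of \<open>J\<close>, so that
  Nakayama's lemma applies to the homogeneous ideal generated by \<open>N\<close> and \<open>T\<close>. The lower bound holds
  for arbitrary, also inhomogeneous, generators by the exchange property alone.
\<close>

theorem min_generators_quot_module_eq_rank_diff:
  assumes J: "graded_ideal J" and N: "graded_ideal N" "N \<subseteq> J"
    and X: "exchange_closure.indep J (\<lambda>X. Idl (X \<union> ideal_prod R \<mm> J)) X" "finite X"
      "X \<subseteq> N" "N \<subseteq> Idl (X \<union> ideal_prod R \<mm> J)"
    and Y: "exchange_closure.indep J (\<lambda>X. Idl (X \<union> ideal_prod R \<mm> J)) Y" "finite Y"
      "J \<subseteq> Idl (Y \<union> ideal_prod R \<mm> J)"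
  shows "card X \<le> card Y"
    and "min_generators R (quot_module (ideal_module R J) N) = card Y - card X"
proof -
  let ?Z = "ideal_prod R \<mm> J"
  have ids: "ideal J R" "ideal N R" using J N by (simp_all add: graded_ideal_def)
  interpret J: ideal J R by (rule ids(1))
  interpret N: ideal N R by (rule ids(2))
  have mm: "ideal \<mm> R" by (rule maximalideal.axioms(1)[OF maximalideal_mm])
  have ZJ: "?Z \<subseteq> J" using ideal_prod_inter[OF mm ids(1)] by blast
  interpret cl: exchange_closure J "\<lambda>X. Idl (X \<union> ?Z)"
    by (rule exchange_closure_modulo_mm[OF ids(1)])
  have Yspan: "Idl (Y \<union> ?Z) = J"
    using Y(3) cl.cl_carrier[OF cl.indep_carrier[OF Y(1)]] by (rule equalityI[rotated])
  note rank = cl.relative_rank[OF X(1,2) Y(1,2) Yspan]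
  show "card X \<le> card Y" by (rule rank(1))
  obtain C where C: "finite C" "C \<subseteq> J" "C \<subseteq> (\<Union>i. A i)" "J \<subseteq> Idl C"
    using finite_homogeneous_generators[OF J] by blast
  have Ccar: "C \<subseteq> carrier R" using C(2) J.a_subset by blast
  have mono: "Idl S \<subseteq> Idl T" if "S \<subseteq> T" "T \<subseteq> carrier R" for S T
    using genideal_self[OF that(2)] that(1) by (intro genideal_minimal[OF genideal_ideal[OF that(2)]]) blast
  have car: "S \<union> ?Z \<subseteq> carrier R" if "S \<subseteq> J" for S using that ZJ J.a_subset by blast
  have "J \<subseteq> Idl (C \<union> ?Z)" using C(4) mono[OF Un_upper1 car[OF C(2)]] by blast
  hence "Idl (C \<union> ?Z) = J" using cl.cl_carrier[OF C(2)] by (rule equalityI[rotated])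
  then obtain T where T: "T \<subseteq> C" "card T = card Y - card X" "Idl (X \<union> T \<union> ?Z) = J"
    using rank(2)[OF C(1,2)] by blast
  have NT: "N \<union> T \<subseteq> carrier R" "N \<union> T \<subseteq> J" using T(1) C(2) N(2) J.a_subset by blast+
  have NT_self: "N \<union> T \<subseteq> Idl (N \<union> T)" by (rule genideal_self[OF NT(1)])
  have gradedNT: "graded_ideal (Idl (N \<union> T))"
  proof (rule graded_ideal_genideal[OF NT(1)])
    fix x i assume "x \<in> N \<union> T"
    thus "comp x i \<in> Idl (N \<union> T)"
    proof
      assume "x \<in> N"
      thus ?thesis using N(1) NT_self unfolding graded_ideal_def by blast
    next
      assume x: "x \<in> T"
      then obtain j where "x \<in> A j" using T(1) C(3) by blast
      moreover have "x \<in> Idl (N \<union> T)" using x NT_self by blast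
      ultimately show ?thesis
        using additive_subgroup.zero_closed[OF ideal.axioms(1)[OF genideal_ideal[OF NT(1)]]]
        by (simp add: comp_homogeneous)
    qed
  qed
  have NTJ: "Idl (N \<union> T) \<subseteq> J" by (rule genideal_minimal[OF ids(1) NT(2)])
  have "Idl (X \<union> T \<union> ?Z) \<subseteq> Idl (Idl (N \<union> T) \<union> ?Z)"
    by (rule mono[OF _ car[OF NTJ]]) (use X(3) NT_self in blast)
  hence "J \<subseteq> Idl (Idl (N \<union> T) \<union> ?Z)" using T(3) by simp
  from graded_nakayama[OF gradedNT J NTJ this] have gen: "J \<subseteq> Idl (N \<union> T)" by simp
  show "min_generators R (quot_module (ideal_module R J) N) = card Y - card X"
  proof (rule min_generators_quot_module_eqI[OF ids N(2) finite_subset[OF T(1) C(1)] _ T(2) gen])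
    show "T \<subseteq> J" using T(1) C(2) by blast
    fix S assume S: "finite S" "S \<subseteq> J" "J \<subseteq> Idl (N \<union> S)"
    have XS: "X \<union> S \<subseteq> J" using S(2) X(3) N(2) by blast
    have "Idl (X \<union> ?Z) \<subseteq> Idl (X \<union> S \<union> ?Z)" by (rule mono[OF _ car[OF XS]]) blast
    hence "N \<union> S \<subseteq> Idl (X \<union> S \<union> ?Z)" using X(4) cl.cl_extensive[OF XS] by blast
    hence "Idl (N \<union> S) \<subseteq> Idl (X \<union> S \<union> ?Z)" by (rule genideal_minimal[OF genideal_ideal[OF car[OF XS]]])
    hence "J \<subseteq> Idl (X \<union> S \<union> ?Z)" using S(3) by blast
    hence "Idl (X \<union> S \<union> ?Z) = J" using cl.cl_carrier[OF XS] by (rule equalityI[rotated])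
    thus "card Y - card X \<le> card S" by (rule rank(3)[OF S(1,2)])
  qed
qed

text \<open>
  Both counts refer to the symbolic powers: the monomials in the generators \<open>fs\<close> of \<open>I\<close> are
  reduced modulo \<open>\<mm> J\<^sub>k\<close> and not modulo \<open>\<mm> I\<^sup>k\<close>, so that \<open>q\<close> is the dimension of the image of \<open>I\<^sup>k\<close> in
  \<open>J\<^sub>k / \<mm> J\<^sub>k\<close>.
\<close>

theorem sdefect_eq_standard_count_diff:
  assumes I: "graded_ideal I" "I = Idl (set fs)" "set fs \<subseteq> carrier R"
    and gs: "length ds = length gs" "\<And>i. i < length gs \<Longrightarrow> gs ! i \<in> symbolic_power R I (ds ! i)"
      "\<forall>d\<in>set ds. 0 < d" "\<And>k. symbolic_power R I k \<subseteq> monomial_ideal gs ds k"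
  defines "p \<equiv> standard_count ds (nonstandard (symbolic_power R I) gs ds)"
    and "q \<equiv> standard_count (replicate (length fs) 1)
      (nonstandard (symbolic_power R I) fs (replicate (length fs) 1))"
  shows "q k \<le> p k" and "sdefect R I k = p k - q k"
proof -
  let ?J = "symbolic_power R I" and ?Z = "ideal_prod R \<mm> (symbolic_power R I k)"
    and ?ones = "replicate (length fs) (1::nat)"
  have id: "ideal I R" using I by (simp add: graded_ideal_def)
  have J: "ideal (?J i) R" for i by (rule ideal_symbolic_power[OF id])
  have pow: "ideal_power R I i \<subseteq> ?J i" for i by (rule ideal_power_subset_symbolic_power[OF id])
  have J0: "?J 0 = carrier R" by (rule symbolic_power_zero[OF id])
  have mult: "a \<otimes> b \<in> ?J (i + j)" if "a \<in> ?J i" "b \<in> ?J j" for i j a b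
    by (rule symbolic_power_mult_closed[OF id that])
  have lenf: "length ?ones = length fs" by simp
  have powI: "ideal (ideal_power R I i) R" for i by (rule ideal_ideal_power[OF id])
  have f1: "fs ! i \<in> ideal_power R I (?ones ! i)" if "i < length fs" for i
  proof -
    have "fs ! i \<in> I" unfolding I(2) using genideal_self[OF I(3)] that nth_mem by blast
    thus ?thesis using that ideal_subset_ideal_power_one[OF id] by auto
  qed
  have fJ: "fs ! i \<in> ?J (?ones ! i)" if "i < length fs" for i using f1[OF that] pow by blast
  have closure: "exchange_closure (?J k) (\<lambda>X. Idl (X \<union> ?Z))" by (rule exchange_closure_modulo_mm[OF J])
  have car: "X \<union> ?Z \<subseteq> carrier R" if "X \<subseteq> ?J k" for X
    using that ideal_prod_in_carrier[OF maximalideal.axioms(1)[OF maximalideal_mm] J]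
      additive_subgroup.a_subset[OF ideal.axioms(1)[OF J[of k]]] by blast
  obtain Y where Y: "exchange_closure.indep (?J k) (\<lambda>X. Idl (X \<union> ?Z)) Y" "finite Y" "card Y = p k"
    "monomial R gs ` exponents ds k \<subseteq> Idl (Y \<union> ?Z)"
    using standard_monomials_basis[where J = ?J and cs = gs and ds = ds and k = k, OF J J0 mult gs(1,2,3)] unfolding p_def by blast
  obtain X where X: "exchange_closure.indep (?J k) (\<lambda>X. Idl (X \<union> ?Z)) X" "finite X" "card X = q k"
    "X \<subseteq> monomial R fs ` exponents ?ones k" "monomial R fs ` exponents ?ones k \<subseteq> Idl (X \<union> ?Z)"
    using standard_monomials_basis[where J = ?J and cs = fs and ds = ?ones and k = k, OF J J0 mult lenf fJ] unfolding q_def by auto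
  have YJ: "Y \<subseteq> ?J k" and XJ: "X \<subseteq> ?J k"
    using exchange_closure.indep_carrier[OF closure] X(1) Y(1) by blast+
  have "monomial_ideal gs ds k \<subseteq> Idl (Y \<union> ?Z)"
    unfolding monomial_ideal_def by (rule genideal_minimal[OF genideal_ideal[OF car[OF YJ]] Y(4)])
  hence Yspan: "?J k \<subseteq> Idl (Y \<union> ?Z)" using gs(4) by blast
  have "monomial_ideal fs ?ones k \<subseteq> Idl (X \<union> ?Z)"
    unfolding monomial_ideal_def by (rule genideal_minimal[OF genideal_ideal[OF car[OF XJ]] X(5)])
  hence Xspan: "ideal_power R I k \<subseteq> Idl (X \<union> ?Z)"
    using ideal_power_subset_monomial_ideal[OF I(3,2), of k] by blast
  have "monomial R fs a \<in> ideal_power R I k" if a: "a \<in> exponents ?ones k" for a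
  proof -
    have "monomial R fs a \<in> ideal_power R I (weighted_degree ?ones a)"
      by (rule monomial_mem_multiplicative_family[of "ideal_power R I", OF powI _ ideal_power_mult_closed[OF id] lenf f1])
         (use a in \<open>simp_all add: exponents_def\<close>)
    thus ?thesis using a by (simp add: exponents_def)
  qed
  hence XN: "X \<subseteq> ideal_power R I k" using X(4) by blast
  note main = min_generators_quot_module_eq_rank_diff[OF graded_symbolic_power[OF I(1), of k]
      graded_ideal_power[OF I(1), of k] pow X(1,2) XN Xspan Y(1,2) Yspan]
  show "q k \<le> p k" "sdefect R I k = p k - q k"
    using main X(3) Y(3) unfolding sdefect_def by simp_all
qed

end

text \<open>
  The polynomials whose coefficient of degree \<open>n\<close> lies in the ideal of the monomials of degree \<open>n\<close>
  form a subring that contains the constants and the generators, hence the whole symbolic Rees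
  algebra.
\<close>

lemma (in cring) symbolic_power_subset_monomial_ideal:
  assumes I: "ideal I R" and g: "homogeneous_generators R I s g d"
    and c: "\<And>i. i < s \<Longrightarrow> c i \<in> symbolic_power R I (d i) \<and> g i = up_ring.monom (UP R) (c i) (d i)"
  shows "symbolic_power R I k \<subseteq> monomial_ideal (map c [0..<s]) (map d [0..<s]) k"
proof
  let ?cs = "map c [0..<s]" and ?ds = "map d [0..<s]"
  interpret P: UP_cring R "UP R" by (unfold_locales, simp)
  have J: "ideal (symbolic_power R I i) R" for i by (rule ideal_symbolic_power[OF I])
  have cc: "c i \<in> carrier R" if "i < s" for i using c[OF that] ideal.Icarr[OF J] by blast
  have cs: "set ?cs \<subseteq> carrier R" "length ?ds = length ?cs" using cc by auto
  let ?G = "monomial_ideal ?cs ?ds"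
  have G: "ideal (?G i) R" for i by (rule ideal_monomial_ideal[OF cs])
  have zero: "\<zero> \<in> ?G i" for i by (rule additive_subgroup.zero_closed[OF ideal.axioms(1)[OF G]])
  have G0: "?G 0 = carrier R" by (rule monomial_ideal_zero[OF cs])
  have generated: "h \<in> carrier (UP R) \<and> (\<forall>n. up_ring.coeff (UP R) h n \<in> ?G n)"
    if "h \<in> generate_ring (UP R) ((\<lambda>r. up_ring.monom (UP R) r 0) ` carrier R \<union> g ` {..<s})" for h
    using that
  proof (induction rule: generate_ring.induct)
    case one
    show ?case using zero G0 by simp
  next
    case (incl h)
    then consider r where "r \<in> carrier R" "h = up_ring.monom (UP R) r 0" | i where "i < s" "h = g i" by blast
    thus ?case
    proof cases
      case (1 r)
      thus ?thesis using zero G0 by simp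
    next
      case (2 i)
      have "c i \<in> ?G (d i)" using generator_in_monomial_ideal[OF cs, of i] 2(1) by simp
      thus ?thesis using 2 c[OF 2(1)] cc[OF 2(1)] zero by simp
    qed
  next
    case (a_inv h)
    thus ?case using additive_subgroup.a_inv_closed[OF ideal.axioms(1)[OF G]] by simp
  next
    case (eng_add h1 h2)
    thus ?case using additive_subgroup.a_closed[OF ideal.axioms(1)[OF G]] by simp
  next
    case (eng_mult h1 h2)
    have "(\<Oplus>i\<in>{..n}. up_ring.coeff (UP R) h1 i \<otimes> up_ring.coeff (UP R) h2 (n - i)) \<in> ?G n" for n
    proof (rule ideal_finsum_closed[OF G])
      fix i assume "i \<in> {..n}"
      thus "up_ring.coeff (UP R) h1 i \<otimes> up_ring.coeff (UP R) h2 (n - i) \<in> ?G n"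
        using monomial_ideal_mult_closed[OF cs, of _ i _ "n - i"] eng_mult.IH by simp
    qed simp
    thus ?case using eng_mult.IH by simp
  qed
  fix x assume x: "x \<in> symbolic_power R I k"
  have xc: "x \<in> carrier R" by (rule ideal.Icarr[OF J x])
  have "up_ring.coeff (UP R) (up_ring.monom (UP R) x k) i \<in> symbolic_power R I i" for i
    using x xc additive_subgroup.zero_closed[OF ideal.axioms(1)[OF J]] by auto
  hence "up_ring.monom (UP R) x k \<in> carrier (symbolic_Rees_algebra R I)"
    using xc by (simp add: symbolic_Rees_algebra_def)
  hence "up_ring.coeff (UP R) (up_ring.monom (UP R) x k) k \<in> ?G k"
    using generated g unfolding homogeneous_generators_def by blast
  thus "x \<in> ?G k" using xc by simp
qed

lemma (in noetherian_graded_local) eventually_quasi_polynomial_sdefect: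
  assumes I: "graded_ideal I" and g: "homogeneous_generators R I s g d"
  shows "eventually_quasi_polynomial (\<lambda>m. of_nat (sdefect R I m)) (Lcm (d ` {..<s}))"
proof -
  have id: "ideal I R" using I by (simp add: graded_ideal_def)
  obtain F where F: "F \<subseteq> carrier R" "finite F" "I = Idl F" using finetely_gen[OF id] by blast
  obtain fs where fs: "set fs = F" using finite_list[OF F(2)] by blast
  have "\<exists>c. \<forall>i<s. c i \<in> symbolic_power R I (d i) \<and> g i = up_ring.monom (UP R) (c i) (d i)"
  proof (rule choice_iff'[THEN iffD1], intro allI impI)
    fix i assume "i < s"
    hence "g i \<in> Rees_component R I (d i)" using g by (simp add: homogeneous_generators_def)
    thus "\<exists>c. c \<in> symbolic_power R I (d i) \<and> g i = up_ring.monom (UP R) c (d i)"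
      unfolding Rees_component_def by blast
  qed
  then obtain c where c: "\<And>i. i < s \<Longrightarrow> c i \<in> symbolic_power R I (d i) \<and> g i = up_ring.monom (UP R) (c i) (d i)"
    by blast
  let ?L = "Lcm (d ` {..<s})" and ?gs = "map c [0..<s]" and ?ds = "map d [0..<s]"
    and ?ones = "replicate (length fs) (1::nat)"
  have dpos: "0 < d i" if "i < s" for i using g that by (simp add: homogeneous_generators_def)
  have pos: "\<forall>e\<in>set ?ds. 0 < e" using dpos by simp
  have "0 \<notin> d ` {..<s}" using dpos by force
  hence Lpos: "0 < ?L" by (intro gr0I) (simp add: Lcm_0_iff)
  have len: "length ?ds = length ?gs" by simp
  have gs: "?gs ! i \<in> symbolic_power R I (?ds ! i)" if "i < length ?gs" for i using c that by simp
  define p where "p = standard_count ?ds (nonstandard (symbolic_power R I) ?gs ?ds)"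
  define q where "q = standard_count ?ones (nonstandard (symbolic_power R I) fs ?ones)"
  have IF: "I = Idl (set fs)" "set fs \<subseteq> carrier R" using F fs by simp_all
  have gen: "symbolic_power R I k \<subseteq> monomial_ideal ?gs ?ds k" for k
    by (rule symbolic_power_subset_monomial_ideal[OF id g]) (rule c)
  have count: "q k \<le> p k" "sdefect R I k = p k - q k" for k
    unfolding p_def q_def
    by (rule sdefect_eq_standard_count_diff[OF I IF len _ pos gen]; rule gs; assumption)+
  have J: "ideal (symbolic_power R I i) R" for i by (rule ideal_symbolic_power[OF id])
  note J0 = symbolic_power_zero[OF id]
  note mult = symbolic_power_mult_closed[OF id]
  have fJ: "fs ! i \<in> symbolic_power R I (?ones ! i)" if "i < length fs" for i
  proof -
    have "fs ! i \<in> I" unfolding IF(1) using genideal_self[OF IF(2)] that nth_mem by blast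
    thus ?thesis
      using that ideal_subset_ideal_power_one[OF id] ideal_power_subset_symbolic_power[OF id, of 1] by auto
  qed
  have "polynomial_on_progressions (\<lambda>m. of_nat (p m)) ?L"
    unfolding p_def
  proof (rule standard_count_polynomial_on_progressions[OF _ Lpos])
    show "\<forall>e\<in>set ?ds. 0 < e \<and> e dvd ?L" using dpos by (auto intro: dvd_Lcm)
    show "up_closed (nonstandard (symbolic_power R I) ?gs ?ds)"
      by (rule up_closed_nonstandard[of "symbolic_power R I", OF J J0 mult len gs])
  qed (simp add: nonstandard_def)
  moreover have "polynomial_on_progressions (\<lambda>m. of_nat (q m)) ?L"
    unfolding q_def
  proof (rule standard_count_polynomial_on_progressions[OF _ Lpos])
    show "\<forall>e\<in>set ?ones. 0 < e \<and> e dvd ?L" by simp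
    show "up_closed (nonstandard (symbolic_power R I) fs ?ones)"
      by (rule up_closed_nonstandard[of "symbolic_power R I", OF J J0 mult length_replicate fJ])
  qed (simp add: nonstandard_def)
  ultimately have "polynomial_on_progressions (\<lambda>m. of_nat (p m) - of_nat (q m)) ?L"
    by (rule polynomial_on_progressions_diff)
  moreover have "(of_nat (p m) - of_nat (q m) :: rat) = of_nat (sdefect R I m)" for m
    unfolding count(2) using count(1) by (rule of_nat_diff[symmetric])
  ultimately have "polynomial_on_progressions (\<lambda>m. of_nat (sdefect R I m)) ?L" by simp
  thus ?thesis using Lpos by (rule eventually_quasi_polynomialI)
qed

theorem theorem2p4:
  fixes R :: "('a, 'b) ring_scheme"
    and A :: "int \<Rightarrow> 'a set"
    and \<mm> I :: "'a set"
    and s :: nat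
    and g :: "nat \<Rightarrow> nat \<Rightarrow> 'a"
    and d :: "nat \<Rightarrow> nat"
  assumes "noetherian_ring R"
    and "(local_ring R \<mm> \<and> ideal I R) \<or> (graded_local_ring R A \<mm> \<and> homogeneous_ideal R A I)"
    and "noetherian_ring (symbolic_Rees_algebra R I)"
    and "homogeneous_generators R I s g d"
  shows "eventually_quasi_polynomial (\<lambda>m. of_nat (sdefect R I m)) (Lcm (d ` {..<s}))"
proof -
  have "\<exists>B. graded_local_ring R B \<mm> \<and> homogeneous_ideal R B I"
    using assms(2)
  proof
    assume local: "local_ring R \<mm> \<and> ideal I R"
    then interpret cring R by (simp add: local_ring_def)
    show ?thesis
      using local local_ring_is_graded_local homogeneous_ideal_trivial_grading by blast
  qed blast
  then obtain B where B: "graded_local_ring R B \<mm>" "homogeneous_ideal R B I" by blast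
  have graded: "graded_ring R B" using B(1) by (simp add: graded_local_ring_def)
  interpret cring R using graded by (simp add: graded_ring_def)
  interpret noetherian_ring R by (rule assms(1))
  interpret noetherian_graded_local R B \<mm>
    by unfold_locales (fact graded, fact B(1))
  show ?thesis
    using B(2) assms(4) eventually_quasi_polynomial_sdefect by (simp add: homogeneous_ideal_iff)
qed

end
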